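(* Let $d\in\{3,4,5\}$ and $T>0$. Given real-valued $(u_0,u_1)\in\mathcal{H}^s(\mathbb{T}^d)$, let $(\mathbf{u}_{0,T}^\omega,\mathbf{u}_{1,T}^\omega)=(\eta_T u_0^\omega,\eta_T u_1^\omega)$ be the random functions on $\mathbb{R}^d$ defined in the context. Then, given $1\le q<\infty$ and $2\le r\le\infty$, there exist $C,c>0$ such that $$P\Big(\|S(t)(\mathbf{u}_{0,T}^\omega,\mathbf{u}_{1,T}^\omega)\|_{L^q_t(I;L^r_x(\mathbb{R}^d))}>\lambda\Big)\le C\exp\Bigg(-c\,\frac{\lambda^2}{\max(1,b^2)\,\langle T\rangle^d\,|I|^{\frac2q}\,\|(u_0,u_1)\|_{\mathcal{H}^s(\mathbb{T}^d)}^2}\Bigg)$$ for all $\lambda>0$ and any compact time interval $I=[a,b]\subset[0,T]$, provided that (i) $s=0$ if $r<\infty$, and (ii) $s>0$ if $r=\infty$.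
   Context: Torus and function spaces: $\mathbb{T}^d=(\mathbb{R}/2\pi\mathbb{Z})^d$; functions on $\mathbb{T}^d$ are written $f(x)=\sum_{n\in\mathbb{Z}^d}\widehat f(n)e^{in\cdot x}$ and are also viewed as periodic functions on $\mathbb{R}^d$; $\langle x\rangle=1+|x|$; $H^s(\mathbb{T}^d)$ has norm $\big(\sum_n\langle n\rangle^{2s}|\widehat f(n)|^2\big)^{1/2}$; $\mathcal{H}^s(\mathbb{T}^d)=H^s(\mathbb{T}^d)\times H^{s-1}(\mathbb{T}^d)$ with the product norm. Random variables: for $j=0,1$, $\{g_{n,j}\}_{n\in\mathbb{Z}^d}$ is a sequence of mean zero complex-valued random variables on a probability space $(\Omega,\mathcal{F},P)$ with $g_{-n,j}=\overline{g_{n,j}}$ for all $n$ (so $g_{0,j}$ is real-valued), and $\{g_{0,j},\operatorname{Re}g_{n,j},\operatorname{Im}g_{n,j}\}_{n\in\mathcal{I},\,j=0,1}$ are independent, where $\mathcal{I}=\bigcup_{k=0}^{d-1}\mathbb{Z}^k\times\mathbb{Z}_+\times\{0\}^{d-k-1}$, $\mathbb{Z}_+=\{1,2,\dots\}$. Moreover, there is $c_0>0$ such that the distributions $\mu_{n,j}$ of $g_{n,j}$ satisfy $\int e^{\gamma\cdot x}\,d\mu_{n,j}(x)\le e^{c_0|\gamma|^2}$ for $j=0,1$, all $n\in\mathbb{Z}^d$, and all $\gamma\in\mathbb{R}$ when $n=0$, all $\gamma\in\mathbb{R}^2$ when $n\neq0$. The randomization of $(u_0,u_1)$ is $u_j^\omega=\sum_{n\in\mathbb{Z}^d}g_{n,j}(\omega)\widehat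 u_j(n)e^{in\cdot x}$, $j=0,1$. Cutoff: $\eta\in C_c^\infty(\mathbb{R}^d;\mathbb{R})$ is fixed once and for all with $\eta\equiv1$ on $[-1,1]^d$, and $\eta_T(x)=\eta(\langle T\rangle^{-1}x)$. Thus $\mathbf{u}_{j,T}^\omega(x)=\eta_T(x)u_j^\omega(x)=\sum_{n}\eta_T(x)g_{n,j}(\omega)\widehat u_j(n)e^{in\cdot x}$. The dependence of constants on $\eta$ is suppressed. Linear propagator on $\mathbb{R}^d$: $S(t)(f_0,f_1)=\cos(t|\nabla|)f_0+\frac{\sin(t|\nabla|)}{|\nabla|}f_1$ as Fourier multipliers. *)

theory Defs
  imports "HOL-Probability.Probability"
begin

section \<open>Smooth functions, Schwartz functions and the Fourier transform on \<open>\<real>\<^sup>d\<close>\<close>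

definition partial_deriv :: "'d::finite \<Rightarrow> (real^'d \<Rightarrow> 'b::real_normed_vector) \<Rightarrow> real^'d \<Rightarrow> 'b" where
  "partial_deriv i f = (\<lambda>x. frechet_derivative f (at x) (axis i 1))"

definition iter_partial :: "'d::finite list \<Rightarrow> (real^'d \<Rightarrow> 'b::real_normed_vector) \<Rightarrow> real^'d \<Rightarrow> 'b" where
  "iter_partial is f = foldr partial_deriv is f"

definition smooth :: "(real^'d::finite \<Rightarrow> 'b::real_normed_vector) \<Rightarrow> bool" where
  "smooth f \<longleftrightarrow> (\<forall>is x. iter_partial is f differentiable (at x))"

definition schwartz :: "(real^'d::finite \<Rightarrow> complex) \<Rightarrow> bool" where
  "schwartz f \<longleftrightarrow> smooth f \<and>
     (\<forall>is (N::nat). bounded (range (\<lambda>x. (1 + norm x) ^ N *\<^sub>R iter_partial is f x)))"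

definition fourier :: "(real^'d::finite \<Rightarrow> complex) \<Rightarrow> real^'d \<Rightarrow> complex" where
  "fourier f \<xi> = (LINT x|lborel. cis (- (x \<bullet> \<xi>)) * f x)"

definition inv_fourier :: "(real^'d::finite \<Rightarrow> complex) \<Rightarrow> real^'d \<Rightarrow> complex" where
  "inv_fourier f x = of_real (1 / (2 * pi) ^ CARD('d)) * (LINT \<xi>|lborel. cis (x \<bullet> \<xi>) * f \<xi>)"


section \<open>Distributions on \<open>\<real>\<^sup>d\<close> and the wave propagator\<close>

text \<open>A (tempered) distribution is given by its action on test functions. Only the values on
  Schwartz functions are meaningful.\<close>

type_synonym 'd distr = "(real^'d \<Rightarrow> complex) \<Rightarrow> complex"

definition mult_distr :: "(real^'d::finite \<Rightarrow> real) \<Rightarrow> 'd distr \<Rightarrow> 'd distr" where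
  "mult_distr h W = (\<lambda>\<phi>. W (\<lambda>x. of_real (h x) * \<phi> x))"

text \<open>The Fourier multiplier with symbol \<open>m\<close>. On tempered distributions the Fourier transform is
  defined by \<open>\<langle>F W, \<psi>\<rangle> = \<langle>W, F \<psi>\<rangle>\<close>, so \<open>\<langle>F\<^sup>-\<^sup>1 (m F W), \<phi>\<rangle> = \<langle>W, F (m F\<^sup>-\<^sup>1 \<phi>)\<rangle>\<close>; the symbols below
  are smooth with polynomially bounded derivatives, so \<open>F (m F\<^sup>-\<^sup>1 \<phi>)\<close> is again Schwartz.\<close>

definition fourier_multiplier :: "(real^'d::finite \<Rightarrow> complex) \<Rightarrow> 'd distr \<Rightarrow> 'd distr" where
  "fourier_multiplier m W = (\<lambda>\<phi>. W (fourier (\<lambda>\<xi>. m \<xi> * inv_fourier \<phi> \<xi>)))"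

definition cos_symbol :: "real \<Rightarrow> real^'d::finite \<Rightarrow> complex" where
  "cos_symbol t \<xi> = of_real (cos (t * norm \<xi>))"

definition sinc_symbol :: "real \<Rightarrow> real^'d::finite \<Rightarrow> complex" where
  "sinc_symbol t \<xi> = of_real (if \<xi> = 0 then t else sin (t * norm \<xi>) / norm \<xi>)"

definition wave_propagator :: "real \<Rightarrow> 'd::finite distr \<Rightarrow> 'd distr \<Rightarrow> 'd distr" where
  "wave_propagator t f0 f1 =
     (\<lambda>\<phi>. fourier_multiplier (cos_symbol t) f0 \<phi> + fourier_multiplier (sinc_symbol t) f1 \<phi>)"


section \<open>Lebesgue norms\<close>

definition enn_powr :: "ennreal \<Rightarrow> real \<Rightarrow> ennreal" where
  "enn_powr x p = (if x = \<infinity> then \<infinity> else ennreal (enn2real x powr p))"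

definition Lp_norm :: "'a measure \<Rightarrow> ennreal \<Rightarrow> ('a \<Rightarrow> ennreal) \<Rightarrow> ennreal" where
  "Lp_norm M p f =
     (if p = \<infinity> then esssup M f
      else enn_powr (\<integral>\<^sup>+x. enn_powr (f x) (enn2real p) \<partial>M) (1 / enn2real p))"

definition represents :: "(real^'d::finite \<Rightarrow> complex) \<Rightarrow> 'd distr \<Rightarrow> bool" where
  "represents v W \<longleftrightarrow> v \<in> borel_measurable lborel \<and>
     (\<forall>\<phi>. schwartz \<phi> \<longrightarrow> integrable lborel (\<lambda>x. v x * \<phi> x) \<and> W \<phi> = (LINT x|lborel. v x * \<phi> x))"

text \<open>The representing function is unique up to null sets if it exists, so the infimum runs over at
  most one value; it is \<open>\<infinity>\<close> if the distribution is not a function.\<close>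

definition Lr_norm_distr :: "ennreal \<Rightarrow> 'd::finite distr \<Rightarrow> ennreal" where
  "Lr_norm_distr r W = (INF v\<in>{v. represents v W}. Lp_norm lborel r (\<lambda>x. ennreal (cmod (v x))))"

definition mixed_norm :: "real \<Rightarrow> ennreal \<Rightarrow> real set \<Rightarrow> (real \<Rightarrow> 'd::finite distr) \<Rightarrow> ennreal" where
  "mixed_norm q r I W =
     Lp_norm (restrict_space lborel I) (ennreal q) (\<lambda>t. Lr_norm_distr r (W t))"


section \<open>Sobolev spaces on the torus\<close>

text \<open>A distribution on the torus \<open>(\<real>/2\<pi>\<int>)\<^sup>d\<close> is given by the family of its Fourier coefficients;
  for negative order the elements of \<open>H\<^sup>s\<close> need not be functions.\<close>

definition bracket :: "'a::real_normed_vector \<Rightarrow> real" where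
  "bracket x = 1 + norm x"

definition freq :: "int^'d::finite \<Rightarrow> real^'d" where
  "freq n = (\<chi> i. of_int (n $ i))"

definition Hs :: "real \<Rightarrow> (int^'d::finite \<Rightarrow> complex) set" where
  "Hs s = {a. (\<lambda>n. bracket (freq n) powr (2 * s) * (cmod (a n))\<^sup>2) summable_on UNIV}"

definition Hs_norm :: "real \<Rightarrow> (int^'d::finite \<Rightarrow> complex) \<Rightarrow> real" where
  "Hs_norm s a = sqrt (\<Sum>\<^sub>\<infinity>n. bracket (freq n) powr (2 * s) * (cmod (a n))\<^sup>2)"

definition pair_Hs_norm :: "real \<Rightarrow> (int^'d::finite \<Rightarrow> complex) \<Rightarrow> (int^'d \<Rightarrow> complex) \<Rightarrow> real" where
  "pair_Hs_norm s a0 a1 = sqrt ((Hs_norm s a0)\<^sup>2 + (Hs_norm (s - 1) a1)\<^sup>2)"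

definition real_valued :: "(int^'d::finite \<Rightarrow> complex) \<Rightarrow> bool" where
  "real_valued a \<longleftrightarrow> (\<forall>n. a (- n) = cnj (a n))"

text \<open>The periodic distribution \<open>\<Sum>n. a n * exp (\<i> n \<bullet> x)\<close>, viewed on \<open>\<real>\<^sup>d\<close>.\<close>

definition periodic_distr :: "(int^'d::finite \<Rightarrow> complex) \<Rightarrow> 'd distr" where
  "periodic_distr a = (\<lambda>\<phi>. \<Sum>\<^sub>\<infinity>n. a n * (LINT x|lborel. cis (freq n \<bullet> x) * \<phi> x))"


section \<open>Randomization and cutoff\<close>

text \<open>\<open>\<int>\<^sup>k \<times> \<int>\<^sub>+ \<times> {0}\<^sup>d\<^sup>-\<^sup>k\<^sup>-\<^sup>1\<close>, \<open>0 \<le> k < d\<close>: the last nonzero coordinate is positive. The order of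
  the coordinates is the linear order of the index type.\<close>

definition half_lattice :: "(int^'d::{finite,linorder}) set" where
  "half_lattice = (\<Union>k. {n. n $ k > 0 \<and> (\<forall>i>k. n $ i = 0)})"

text \<open>\<open>g j n\<close> is the random variable \<open>g\<^sub>n\<^sub>,\<^sub>j\<close>. In the independence assumption the flag selects the
  imaginary part; at \<open>n = 0\<close> only the real part occurs.\<close>

locale random_coefficients = prob_space M
  for M :: "'w measure" and g :: "nat \<Rightarrow> int^'d::{finite,linorder} \<Rightarrow> 'w \<Rightarrow> complex" and c0 :: real +
  assumes random_variable: "j \<in> {0, 1} \<Longrightarrow> g j n \<in> borel_measurable M"
    and mean_zero: "j \<in> {0, 1} \<Longrightarrow> integrable M (g j n) \<and> expectation (g j n) = 0"
    and conj_symmetric: "j \<in> {0, 1} \<Longrightarrow> \<omega> \<in> space M \<Longrightarrow> g j (- n) \<omega> = cnj (g j n \<omega>)"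
    and independent:
      "indep_vars (\<lambda>_. borel)
         (\<lambda>(j, n, im) \<omega>. if im then Im (g j n \<omega>) else Re (g j n \<omega>))
         {(j, n, im). j \<in> {0, 1} \<and> (n \<in> half_lattice \<or> n = 0 \<and> \<not> im)}"
    and c0_pos: "c0 > 0"
    and exp_moment_zero: "j \<in> {0, 1} \<Longrightarrow>
      (\<integral>\<^sup>+x. ennreal (exp (\<gamma> * x)) \<partial>distr M borel (\<lambda>\<omega>. Re (g j 0 \<omega>))) \<le> ennreal (exp (c0 * \<gamma>\<^sup>2))"
    and exp_moment_nonzero: "j \<in> {0, 1} \<Longrightarrow> n \<noteq> 0 \<Longrightarrow>
      (\<integral>\<^sup>+z. ennreal (exp (\<zeta> \<bullet> z)) \<partial>distr M borel (g j n)) \<le> ennreal (exp (c0 * (norm \<zeta>)\<^sup>2))"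

definition randomize ::
  "(nat \<Rightarrow> int^'d::finite \<Rightarrow> 'w \<Rightarrow> complex) \<Rightarrow> nat \<Rightarrow> (int^'d \<Rightarrow> complex) \<Rightarrow> 'w \<Rightarrow> int^'d \<Rightarrow> complex" where
  "randomize g j a \<omega> = (\<lambda>n. g j n \<omega> * a n)"

definition cutoff :: "(real^'d::finite \<Rightarrow> real) \<Rightarrow> bool" where
  "cutoff \<eta> \<longleftrightarrow> smooth \<eta> \<and> compact (closure {x. \<eta> x \<noteq> 0}) \<and>
     (\<forall>x. (\<forall>i. - 1 \<le> x $ i \<and> x $ i \<le> 1) \<longrightarrow> \<eta> x = 1)"

definition rescale :: "(real^'d::finite \<Rightarrow> real) \<Rightarrow> real \<Rightarrow> real^'d \<Rightarrow> real" where
  "rescale \<eta> T = (\<lambda>x. \<eta> (inverse (bracket T) *\<^sub>R x))"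

definition cutoff_random ::
  "(real^'d::finite \<Rightarrow> real) \<Rightarrow> real \<Rightarrow> (nat \<Rightarrow> int^'d \<Rightarrow> 'w \<Rightarrow> complex) \<Rightarrow> nat
     \<Rightarrow> (int^'d \<Rightarrow> complex) \<Rightarrow> 'w \<Rightarrow> 'd distr" where
  "cutoff_random \<eta> T g j a \<omega> = mult_distr (rescale \<eta> T) (periodic_distr (randomize g j a \<omega>))"

text \<open>\<open>exp (- x / D)\<close> for \<open>x > 0\<close>, \<open>D \<ge> 0\<close>, with the limit value \<open>0\<close> at \<open>D = 0\<close> (in HOL, \<open>x / 0 = 0\<close>
  would give \<open>1\<close>).\<close>

definition exp_neg_quot :: "real \<Rightarrow> real \<Rightarrow> real" where
  "exp_neg_quot x D = (if D = 0 then 0 else exp (- (x / D)))"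

end

theory Submission
  imports Defs
begin

text \<open>On a suitable exhaustion of the frequencies the solution is, for almost every \<open>\<omega>\<close>, the limit
  of the sums \<open>V\<^sub>A = \<Sum>\<^bsub>n \<in> A\<^esub> g\<^sub>n a\<^sub>n F\<^sub>n(t, x)\<close>, where \<open>F\<^sub>n\<close> is the linear evolution of \<open>\<eta>\<^sub>T exp (\<i> n \<bullet> x)\<close>.
  The sub-Gaussian bound gives \<open>E \<bar>V\<^sub>A(t, x)\<bar>\<^sup>k \<le> (D \<surd>k \<sigma>(t, x))\<^sup>k\<close> with \<open>\<sigma>\<^sup>2 = \<Sum> \<bar>a\<^sub>n F\<^sub>n\<bar>\<^sup>2\<close>, and Jensen's inequality
  transfers this to \<open>E \<parallel>V\<^sub>A\<parallel>\<^sup>k\<close> for the mixed norm. Since \<open>\<bar>F\<^sub>n\<bar>\<close> is bounded by a constant and \<open>\<parallel>F\<^sub>n\<parallel>\<^sub>2\<close> by a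
  multiple of \<open>\<langle>T\<rangle>\<^bsup>d/2\<^esup>\<close>, with a gain \<open>max 1 b / \<langle>n\<rangle>\<close> for the second datum, \<open>\<parallel>\<sigma>(t)\<parallel>\<^sub>r\<close> has the asserted size.
  Chebyshev's inequality with \<open>k\<close> proportional to \<open>\<lambda>\<^sup>2\<close> gives the tail bound. For \<open>r = \<infinity>\<close> the supremum is
  dominated by an \<open>L\<^sup>\<rho>\<close> norm, \<open>\<rho> > d / s\<close>, at the cost of \<open>s\<close> derivatives.\<close>

section \<open>Weights\<close>

text \<open>\<open>Lr_norm_distr\<close> is an infimum over functions representing a distribution,
  so moment bounds for partial sums say nothing about the event until their limit is known to be the
  only such function. This forces three statements: the sums converge at almost every x; almost
  surely, for all t and all test functions at once, their pairings converge to those of the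
  propagated distribution; representing functions agree almost everywhere. The exhaustion serves the
  first: it depends only on the data and b, with tails below \<open>8^-n\<close>, so that increments
  weighted by \<open>2^n\<close> keep summable second moments. It gives, for each t, a null set that
  depends on t; Fubini in (\<omega>, t) exchanges these for one null set and almost every t, which
  is all that the mixed norm sees. That norm then equals a measurable random variable only almost
  surely, whence the completion. All sizes enter through majorants K i of mode i that are uniform in
  t and x, the origin of \<open>max 1 (b\<^sup>2)\<close>. For r = infinity a second series, with
  the same majorants and the symbols divided by that of a potential, controls the first.\<close>

lemma bracket_ge_1: "1 \<le> bracket x"
  by (simp add: bracket_def)

lemma bracket_pos [simp]: "0 < bracket x"
  using bracket_ge_1[of x] by linarith

lemma bracket_nonneg [simp]: "0 \<le> bracket x"
  using bracket_pos[of x] by linarith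

lemma bracket_neq_0 [simp]: "bracket x \<noteq> 0"
  using bracket_pos[of x] by linarith

lemma bracket_minus [simp]: "bracket (- x) = bracket x"
  by (simp add: bracket_def)

lemma bracket_measurable [measurable]:
  "(bracket :: 'a::real_normed_vector \<Rightarrow> real) \<in> borel_measurable borel"
  unfolding bracket_def[abs_def] by measurable

lemma bracket_triangle: "bracket x \<le> bracket y * bracket (x - y)"
proof -
  have "norm x \<le> norm y + norm (x - y)"
    by (metis add.commute diff_add_cancel norm_triangle_ineq)
  moreover have "0 \<le> norm y * norm (x - y)" by simp
  ultimately show ?thesis unfolding bracket_def distrib_left distrib_right by linarith
qed

text \<open>Peetre's inequality. For negative p the submultiplicativity is used with x and y
  exchanged.\<close>

lemma bracket_powr_peetre: "bracket x powr p \<le> bracket y powr p * bracket (x - y) powr \<bar>p\<bar>"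
proof (cases "p \<ge> 0")
  case True
  have "bracket x powr p \<le> (bracket y * bracket (x - y)) powr p"
    by (intro powr_mono2 True bracket_triangle) auto
  then show ?thesis using True by (simp add: powr_mult)
next
  case False
  have "bracket (y - x) = bracket (x - y)"
    by (metis bracket_minus minus_diff_eq)
  then have "bracket y powr (-p) \<le> (bracket x * bracket (x - y)) powr (-p)"
    using False bracket_triangle[of y x] by (intro powr_mono2) auto
  then have "bracket y powr (-p) \<le> bracket x powr (-p) * bracket (x - y) powr \<bar>p\<bar>"
    using False by (simp add: powr_mult)
  then have "bracket x powr p * bracket y powr p * bracket y powr (-p)
      \<le> bracket x powr p * bracket y powr p * (bracket x powr (-p) * bracket (x - y) powr \<bar>p\<bar>)"
    by (intro mult_left_mono) auto
  then show ?thesis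
    by (simp add: powr_minus field_simps)
qed

text \<open>Dyadic shells: where the bracket lies in \<open>[2^k, 2^(k+1))\<close> the integrand is
  at most \<open>2^(-k N)\<close>, and the ball of radius \<open>2^(k+1)\<close> has volume of order
  \<open>2^(k d)\<close>. Since N is at least d + 1, the k-th contribution is of order
  \<open>2^-k\<close>.\<close>

lemma integrable_bracket_power:
  assumes N: "CARD('d) < N"
  shows "integrable lborel (\<lambda>x::real^'d::finite. 1 / bracket x ^ N)"
proof (rule integrableI_bounded)
  let ?d = "CARD('d)"
  have [measurable]: "ball (0::real^'d) r \<in> sets borel" for r by simp
  let ?B = "\<lambda>k. ball (0::real^'d) (2 ^ Suc k)"
  have "(\<integral>\<^sup>+x. ennreal (norm (1 / bracket (x::real^'d) ^ N)) \<partial>lborel)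
      \<le> (\<integral>\<^sup>+x. (\<Sum>k. ennreal (1 / 2 ^ (k * N)) * indicator (?B k) x) \<partial>lborel)"
  proof (rule nn_integral_mono)
    fix x :: "real^'d"
    have "\<exists>k. bracket x < 2 ^ Suc k" 
      using real_arch_pow[of 2 "bracket x"] by (metis one_less_numeral_iff semiring_norm(76) power_Suc power_strict_increasing less_trans lessI)
    define k where "k = (LEAST k. bracket x < 2 ^ Suc k)"
    have k1: "bracket x < 2 ^ Suc k" unfolding k_def by (rule LeastI_ex) fact
    have k2: "2 ^ k \<le> bracket x"
    proof (cases k)
      case 0 then show ?thesis using bracket_ge_1[of x] by simp
    next
      case (Suc j)
      then have "\<not> bracket x < 2 ^ Suc j" using not_less_Least[of j "\<lambda>k. bracket x < 2 ^ Suc k"] 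
        unfolding k_def[symmetric] by simp
      then show ?thesis using Suc by simp
    qed
    have "1 / bracket x ^ N \<le> 1 / 2 ^ (k * N)"
      using power_mono[OF k2, of N] by (simp add: power_mult frac_le)
    moreover have "x \<in> ?B k" using k1 by (simp add: bracket_def)
    moreover have single: "h k \<le> (\<Sum>k. h k)" for h :: "nat \<Rightarrow> ennreal"
      using sum_le_suminf[of h "{k}"] by auto
    ultimately have "ennreal (norm (1 / bracket x ^ N)) \<le> ennreal (1 / 2 ^ (k * N)) * indicator (?B k) x"
      by (simp add: ennreal_leI abs_mult)
    also have "\<dots> \<le> (\<Sum>k. ennreal (1 / 2 ^ (k * N)) * indicator (?B k) x)"
      by (rule single)
    finally show "ennreal (norm (1 / bracket x ^ N)) \<le> (\<Sum>k. ennreal (1 / 2 ^ (k * N)) * indicator (?B k) x)" .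
  qed
  also have "\<dots> = (\<Sum>k. ennreal (1 / 2 ^ (k * N)) * emeasure lborel (?B k))"
    by (subst nn_integral_suminf) (auto simp: nn_integral_cmult_indicator)
  also have "\<dots> \<le> (\<Sum>k. ennreal (unit_ball_vol ?d * 2 ^ ?d * (1 / 2) ^ k))"
  proof (rule suminf_le)
    fix k
    have "emeasure lborel (?B k) = ennreal (unit_ball_vol ?d * (2 ^ Suc k) ^ ?d)"
      by (subst emeasure_ball) auto
    then have "ennreal (1 / 2 ^ (k * N)) * emeasure lborel (?B k)
        = ennreal (1 / 2 ^ (k * N) * (unit_ball_vol ?d * (2 ^ Suc k) ^ ?d))"
      by (simp only:) (subst ennreal_mult'[symmetric], auto)
    also have "\<dots> \<le> ennreal (unit_ball_vol ?d * 2 ^ ?d * (1 / 2) ^ k)"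
    proof (rule ennreal_leI)
      have "(2::real) ^ (k * ?d) * 2 ^ k \<le> 2 ^ (k * N)"
      proof -
        have "k * ?d + k \<le> k * N" using N by (metis Suc_leI add.commute mult_Suc_right mult_le_mono2)
        then show ?thesis by (metis power_add power_increasing one_le_numeral)
      qed
      then have "1 / 2 ^ (k * N) * (2::real) ^ (k * ?d) \<le> (1 / 2) ^ k"
        by (simp add: field_simps power_one_over)
      then have "unit_ball_vol ?d * 2 ^ ?d * (1 / 2 ^ (k * N) * (2::real) ^ (k * ?d)) \<le> unit_ball_vol ?d * 2 ^ ?d * (1 / 2) ^ k"
        by (intro mult_left_mono) auto
      then show "1 / 2 ^ (k * N) * (unit_ball_vol ?d * (2 ^ Suc k) ^ ?d) \<le> unit_ball_vol ?d * 2 ^ ?d * (1 / 2) ^ k"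
        by (simp add: power_mult_distrib power_mult[symmetric] mult_ac)
    qed
    finally show "ennreal (1 / 2 ^ (k * N)) * emeasure lborel (?B k) \<le> ennreal (unit_ball_vol ?d * 2 ^ ?d * (1 / 2) ^ k)" .
  qed auto
  also have "\<dots> = ennreal (\<Sum>k. unit_ball_vol ?d * 2 ^ ?d * (1 / 2) ^ k)"
    by (rule suminf_ennreal2) (auto intro!: summable_mult)
  also have "\<dots> < \<infinity>" by simp
  finally show "(\<integral>\<^sup>+x. ennreal (norm (1 / bracket (x::real^'d) ^ N)) \<partial>lborel) < \<infinity>" .
qed measurable

text \<open>Comparison with the integral over unit cubes attached to the lattice points: on one cube
  the weight changes at most by the factor \<open>(1 + d)^N\<close>.\<close>

lemma summable_bracket_freq:
  assumes N: "CARD('d) < N"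
  shows "(\<lambda>n::int^'d::finite. 1 / bracket (freq n) ^ N) summable_on UNIV"
proof (rule nonneg_bounded_partial_sums_imp_summable_on)
  define c where "c = (1 + real CARD('d)) ^ N"
  let ?I = "LINT x::real^'d|lborel. 1 / bracket x ^ N"
  let ?Q = "\<lambda>n::int^'d. box (freq n) (freq n + (1::real^'d))"
  show "\<forall>\<^sub>F F in finite_subsets_at_top UNIV. (\<Sum>n\<in>(F::(int^'d) set). 1 / bracket (freq n) ^ N) \<le> c * ?I"
  proof (rule eventually_finite_subsets_at_top_weakI)
    fix F :: "(int^'d) set" assume F: "finite F"
    \<comment> \<open>The cubes are open and each of their points determines n by rounding down, so
      at most one term of the sum over F is nonzero at any x.\<close>
    have floor: "n = (\<chi> i. \<lfloor>x $ i\<rfloor>)" if "x \<in> ?Q n" for x n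
      using that by (auto simp: mem_box_cart freq_def vec_eq_iff intro!: floor_unique[symmetric] less_imp_le)
    have "ennreal (\<Sum>n\<in>F. 1 / bracket (freq n) ^ N) = (\<Sum>n\<in>F. ennreal (1 / bracket (freq n) ^ N))"
      by (simp add: sum_ennreal)
    also have "\<dots> = (\<Sum>n\<in>F. \<integral>\<^sup>+x. ennreal (1 / bracket (freq n) ^ N) * indicator (?Q n) x \<partial>lborel)"
    proof (rule sum.cong[OF refl])
      fix n
      have "emeasure lborel (?Q n) = 1"
        by (subst emeasure_lborel_box_eq) (auto simp: Basis_vec_def inner_axis intro!: prod.neutral)
      then show "ennreal (1 / bracket (freq n) ^ N) = (\<integral>\<^sup>+x. ennreal (1 / bracket (freq n) ^ N) * indicator (?Q n) x \<partial>lborel)"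
        by (subst nn_integral_cmult_indicator) auto
    qed
    also have "\<dots> = (\<integral>\<^sup>+x. (\<Sum>n\<in>F. ennreal (1 / bracket (freq n) ^ N) * indicator (?Q n) x) \<partial>lborel)"
      by (subst nn_integral_sum) auto
    also have "\<dots> \<le> (\<integral>\<^sup>+x. ennreal (c * (1 / bracket (x::real^'d) ^ N)) \<partial>lborel)"
    proof (rule nn_integral_mono)
      fix x :: "real^'d"
      let ?m = "(\<chi> i. \<lfloor>x $ i\<rfloor>) :: int^'d"
      have "(\<Sum>n\<in>F. ennreal (1 / bracket (freq n) ^ N) * indicator (?Q n) x)
          = (\<Sum>n\<in>F \<inter> {?m}. ennreal (1 / bracket (freq n) ^ N) * indicator (?Q n) x)"
        using floor F by (intro sum.mono_neutral_right) (auto simp: indicator_def)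
      also have "\<dots> \<le> ennreal (c * (1 / bracket x ^ N))"
      proof (cases "?m \<in> F \<and> x \<in> ?Q ?m")
        case True
        have "norm (x - freq ?m) \<le> (\<Sum>i\<in>UNIV. \<bar>(x - freq ?m) $ i\<bar>)" by (rule norm_le_l1_cart)
        also have "\<dots> \<le> (\<Sum>i\<in>(UNIV::'d set). 1)"
        proof (rule sum_mono)
          fix i
          have "x $ i - real_of_int \<lfloor>x $ i\<rfloor> \<le> 1"
            by linarith
          then show "\<bar>(x - freq ?m) $ i\<bar> \<le> 1"
            by (simp add: freq_def abs_le_iff)
        qed
        finally have "bracket (x - freq ?m) \<le> 1 + real CARD('d)" by (simp add: bracket_def)
        then have "bracket x \<le> bracket (freq ?m) * (1 + real CARD('d))"
          by (intro order_trans[OF bracket_triangle[of x "freq ?m"]] mult_left_mono) auto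
        then have "bracket x ^ N \<le> bracket (freq ?m) ^ N * c"
          unfolding c_def power_mult_distrib[symmetric] by (intro power_mono) auto
        then have "1 / bracket (freq ?m) ^ N \<le> c * (1 / bracket x ^ N)"
          by (simp add: field_simps)
        then show ?thesis using True by (simp add: ennreal_leI)
      next
        case False
        then have "(\<Sum>n\<in>F \<inter> {?m}. ennreal (1 / bracket (freq n) ^ N) * indicator (?Q n) x) = 0"
          by (intro sum.neutral) (auto simp: indicator_def)
        then show ?thesis by (simp only: zero_le)
      qed
      finally show "(\<Sum>n\<in>F. ennreal (1 / bracket (freq n) ^ N) * indicator (?Q n) x) \<le> ennreal (c * (1 / bracket x ^ N))" .
    qed
    also have "\<dots> = ennreal (c * ?I)"
      using integrable_bracket_power[OF N]
      by (subst nn_integral_eq_integral) (auto simp: c_def simp del: times_divide_eq_right)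
    finally have "ennreal (\<Sum>n\<in>F. 1 / bracket (freq n) ^ N) \<le> ennreal (c * ?I)" .
    moreover have "0 \<le> c * ?I"
      by (auto simp: c_def intro!: mult_nonneg_nonneg integral_nonneg_AE)
    ultimately show "(\<Sum>n\<in>F. 1 / bracket (freq n) ^ N) \<le> c * ?I"
      using ennreal_le_iff by blast
  qed
qed auto

section \<open>Smooth and Schwartz functions\<close>

lemma iter_partial_Nil [simp]: "iter_partial [] f = f"
  by (simp add: iter_partial_def)

lemma iter_partial_Cons [simp]: "iter_partial (i # is) f = partial_deriv i (iter_partial is f)"
  by (simp add: iter_partial_def)

lemma iter_partial_append: "iter_partial (is @ js) f = iter_partial is (iter_partial js f)"
  by (simp add: iter_partial_def)

lemma partial_deriv_eq:
  "(f has_derivative f') (at x) \<Longrightarrow> partial_deriv i f x = f' (axis i 1)"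
  by (simp add: partial_deriv_def frechet_derivative_at[symmetric])

lemma smooth_differentiable: "smooth f \<Longrightarrow> f differentiable (at x)"
  unfolding smooth_def by (metis iter_partial_Nil)

lemma smooth_partial: "smooth f \<Longrightarrow> smooth (partial_deriv i f)"
  unfolding smooth_def by (metis iter_partial_append iter_partial_Nil iter_partial_Cons)

lemma smooth_has_derivative: "smooth f \<Longrightarrow> (f has_derivative frechet_derivative f (at x)) (at x)"
  using smooth_differentiable frechet_derivative_works by blast

lemma smooth_continuous: "smooth f \<Longrightarrow> continuous_on A f"
  by (meson continuous_at_imp_continuous_on differentiable_imp_continuous_within smooth_differentiable)

text \<open>Smoothness by coinduction: exhibiting a class of differentiable functions closed under
  partial derivatives replaces explicit formulas for iterated derivatives of products, dilations and
  so on.\<close>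

lemma smooth_coinduct:
  assumes "f \<in> S" and D: "\<And>f x. f \<in> S \<Longrightarrow> f differentiable (at x)"
    and P: "\<And>f i. f \<in> S \<Longrightarrow> partial_deriv i f \<in> S"
  shows "smooth f"
proof -
  have "iter_partial is f \<in> S" for "is"
    by (induction "is") (auto simp: \<open>f \<in> S\<close> P)
  then show ?thesis using D by (auto simp: smooth_def)
qed

lemma partial_deriv_const: "partial_deriv i (\<lambda>x. c) = (\<lambda>x. 0)"
  by (rule ext) (simp add: partial_deriv_eq[OF has_derivative_const])

lemma smooth_const: "smooth (\<lambda>x. c)"
  by (rule smooth_coinduct[where S = "range (\<lambda>c x. c)"]) (auto simp: partial_deriv_const)

lemma smooth_bounded_linear: "bounded_linear f \<Longrightarrow> smooth f"
proof (rule smooth_coinduct[where S = "insert f (range (\<lambda>c x. c))"])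
  assume f: "bounded_linear f"
  then have "partial_deriv i f = (\<lambda>x. f (axis i 1))" for i
    by (intro ext partial_deriv_eq bounded_linear_imp_has_derivative)
  then show "partial_deriv i h \<in> insert f (range (\<lambda>c x. c))" if "h \<in> insert f (range (\<lambda>c x. c))" for h i
    using that by (auto simp: partial_deriv_const)
  show "h differentiable at x" if "h \<in> insert f (range (\<lambda>c x. c))" for h x
    using that f bounded_linear_imp_differentiable by auto
qed auto

text \<open>The product rule turns one product into a sum of two, so products alone are not closed
  under partial derivatives; finite sums of products are.\<close>

inductive_set prod_span :: "(real^'d::finite \<Rightarrow> real) set" where
  base: "smooth f \<Longrightarrow> smooth g \<Longrightarrow> (\<lambda>x. f x * g x) \<in> prod_span"
| add: "f \<in> prod_span \<Longrightarrow> g \<in> prod_span \<Longrightarrow> (\<lambda>x. f x + g x) \<in> prod_span"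

lemma smooth_prod_span: "f \<in> prod_span \<Longrightarrow> smooth f"
proof (rule smooth_coinduct[where S = prod_span])
  show D: "f differentiable at x" if "f \<in> prod_span" for f :: "real^'d \<Rightarrow> real" and x
    using that by induction (auto intro!: differentiable_mult differentiable_add intro: smooth_differentiable)
  show "partial_deriv i f \<in> prod_span" if "f \<in> prod_span" for f :: "real^'d \<Rightarrow> real" and i
    using that
  proof induction
    case (base f g)
    have "partial_deriv i (\<lambda>x. f x * g x) = (\<lambda>x. f x * partial_deriv i g x + partial_deriv i f x * g x)"
      using partial_deriv_eq[OF has_derivative_mult[OF smooth_has_derivative[OF base(1)] smooth_has_derivative[OF base(2)]]]
      by (auto simp: partial_deriv_def)
    then show ?case by (auto intro!: prod_span.intros base smooth_partial)
  next
    case (add f g)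
    have "partial_deriv i (\<lambda>x. f x + g x) x = partial_deriv i f x + partial_deriv i g x" for x
      using D[OF add(1)] D[OF add(2)]
      by (subst partial_deriv_eq[OF has_derivative_add[of f "frechet_derivative f (at x)" _ g "frechet_derivative g (at x)"]])
        (auto simp: frechet_derivative_works[symmetric] partial_deriv_def)
    then have "partial_deriv i (\<lambda>x. f x + g x) = (\<lambda>x. partial_deriv i f x + partial_deriv i g x)"
      by auto
    then show ?case using add by (auto intro!: prod_span.intros)
  qed
qed

lemma smooth_mult: "smooth f \<Longrightarrow> smooth g \<Longrightarrow> smooth (\<lambda>x. f x * g x :: real)"
  by (rule smooth_prod_span, rule prod_span.base)

text \<open>The sum is the element f * 1 + g * 1 of the span of products.\<close>

lemma smooth_add: "smooth f \<Longrightarrow> smooth g \<Longrightarrow> smooth (\<lambda>x. f x + g x :: real)"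
  using smooth_prod_span[OF prod_span.add[OF prod_span.base[OF _ smooth_const[of 1]] prod_span.base[OF _ smooth_const[of 1]]]]
  by auto

lemma smooth_real_polynomial_function: "real_polynomial_function p \<Longrightarrow> smooth p"
  by (induction rule: real_polynomial_function.induct)
    (auto intro: smooth_const smooth_bounded_linear smooth_mult smooth_add)

text \<open>The class carries a scalar a because every derivative of a dilation produces another
  factor c.\<close>

lemma smooth_scale:
  fixes f :: "real^'d::finite \<Rightarrow> real"
  assumes "smooth f" shows "smooth (\<lambda>x. f (c *\<^sub>R x))"
proof (rule smooth_coinduct[where S = "{\<lambda>x. a * f (c *\<^sub>R x) |a f. smooth f}"])
  have D: "((\<lambda>x. a * f (c *\<^sub>R x)) has_derivative (\<lambda>h. a * frechet_derivative f (at (c *\<^sub>R x)) (c *\<^sub>R h))) (at x)"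
    if "smooth f" for f :: "real^'d \<Rightarrow> real" and a x
    by (intro has_derivative_mult_right has_derivative_compose[of "\<lambda>x. c *\<^sub>R x", OF _ smooth_has_derivative[OF that]]
        has_derivative_scaleR_right has_derivative_ident)
  show "h differentiable at x" if "h \<in> {\<lambda>x. a * f (c *\<^sub>R x) |a f. smooth f}" for h :: "real^'d \<Rightarrow> real" and x
  proof -
    from that obtain a f where h: "h = (\<lambda>x. a * f (c *\<^sub>R x))" and f: "smooth f" by auto
    show ?thesis unfolding h using D[OF f] by (rule differentiableI)
  qed
  show "partial_deriv i h \<in> {\<lambda>x. a * f (c *\<^sub>R x) |a f. smooth f}" if "h \<in> {\<lambda>x. a * f (c *\<^sub>R x) |a f. smooth f}" for h :: "real^'d \<Rightarrow> real" and i
  proof -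
    from that obtain a f where h: "h = (\<lambda>x. a * f (c *\<^sub>R x))" and f: "smooth f" by auto
    have "partial_deriv i h = (\<lambda>x. (a * c) * partial_deriv i f (c *\<^sub>R x))"
      unfolding h using linear_frechet_derivative[OF smooth_differentiable[OF f]]
      by (intro ext, subst partial_deriv_eq[OF D[OF f]]) (simp add: partial_deriv_def linear_scale)
    then show ?thesis using smooth_partial[OF f] by blast
  qed
  show "(\<lambda>x. f (c *\<^sub>R x)) \<in> {\<lambda>x. a * f (c *\<^sub>R x) |a f. smooth f}"
    using assms by (auto intro!: exI[of _ 1])
qed

lemma smooth_of_real:
  fixes f :: "real^'d::finite \<Rightarrow> real"
  assumes "smooth f" shows "smooth (\<lambda>x. complex_of_real (f x))"
proof (rule smooth_coinduct[where S = "{\<lambda>x. complex_of_real (f x) |f. smooth f}"])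
  have D: "((\<lambda>x. complex_of_real (f x)) has_derivative (\<lambda>h. complex_of_real (frechet_derivative f (at x) h))) (at x)"
    if "smooth f" for f :: "real^'d \<Rightarrow> real" and x
    by (intro has_derivative_of_real smooth_has_derivative that)
  show "h differentiable at x" if "h \<in> {\<lambda>x. complex_of_real (f x) |f. smooth f}" for h :: "real^'d \<Rightarrow> complex" and x
  proof -
    from that obtain f where h: "h = (\<lambda>x. complex_of_real (f x))" and f: "smooth f" by auto
    show ?thesis unfolding h using D[OF f] by (rule differentiableI)
  qed
  show "partial_deriv i h \<in> {\<lambda>x. complex_of_real (f x) |f. smooth f}"
    if "h \<in> {\<lambda>x. complex_of_real (f x) |f. smooth f}" for h :: "real^'d \<Rightarrow> complex" and i
  proof -
    from that obtain f where h: "h = (\<lambda>x. complex_of_real (f x))" and f: "smooth f" by auto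
    have "partial_deriv i h = (\<lambda>x. complex_of_real (partial_deriv i f x))"
      unfolding h by (intro ext, subst partial_deriv_eq[OF D[OF f]]) (simp add: partial_deriv_def)
    then show ?thesis using smooth_partial[OF f] by blast
  qed
qed (use assms in auto)

text \<open>The complement of K is open, so a function vanishing there is locally constant near each
  of its points.\<close>

lemma iter_partial_zero_outside:
  assumes K: "closed K" and z: "\<And>x. x \<notin> K \<Longrightarrow> f x = 0" and x: "x \<notin> K"
  shows "iter_partial is f x = 0"
  using x
proof (induction "is" arbitrary: x)
  case (Cons i "is")
  have "(iter_partial is f has_derivative (\<lambda>h. 0)) (at x)"
    by (rule has_derivative_transform_within_open[of "\<lambda>x. 0" _ _ UNIV "- K"])
      (use K Cons in \<open>auto simp: open_Compl\<close>)
  then show ?case by (simp add: partial_deriv_eq)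
qed (use z in auto)

lemma schwartz_compact_support:
  assumes f: "smooth f" and K: "compact K" and z: "\<And>x. x \<notin> K \<Longrightarrow> f x = 0"
  shows "schwartz f"
  unfolding schwartz_def
proof (intro conjI allI)
  fix "is" :: "'a list" and N :: nat
  let ?g = "\<lambda>x. (1 + norm x) ^ N *\<^sub>R iter_partial is f x"
  have "smooth (iter_partial is f)"
    by (induction "is") (auto intro: f smooth_partial)
  then have "continuous_on K ?g"
    by (intro continuous_intros smooth_continuous)
  then have "bounded (?g ` K)"
    using K compact_continuous_image compact_imp_bounded by blast
  moreover have "range ?g \<subseteq> insert 0 (?g ` K)"
  proof (rule image_subsetI)
    fix x show "?g x \<in> insert 0 (?g ` K)"
      using iter_partial_zero_outside[of K f x] compact_imp_closed[OF K] z by (cases "x \<in> K") auto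
  qed
  ultimately show "bounded (range ?g)"
    by (meson bounded_insert bounded_subset)
qed fact

lemma schwartz_partial: "schwartz \<phi> \<Longrightarrow> schwartz (partial_deriv i \<phi>)"
  unfolding schwartz_def
  by (metis smooth_partial iter_partial_append iter_partial_Nil iter_partial_Cons)

lemma schwartz_smooth: "schwartz \<phi> \<Longrightarrow> smooth \<phi>"
  by (simp add: schwartz_def)

lemma schwartz_measurable: "schwartz \<phi> \<Longrightarrow> \<phi> \<in> borel_measurable borel"
  by (intro borel_measurable_continuous_onI smooth_continuous schwartz_smooth)

lemma schwartz_bound:
  assumes "schwartz \<phi>"
  obtains C where "C \<ge> 0" "\<And>x. norm (\<phi> x) \<le> C / bracket x ^ N"
proof -
  have "bounded (range (\<lambda>x. (1 + norm x) ^ N *\<^sub>R iter_partial [] \<phi> x))"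
    using assms unfolding schwartz_def by blast
  then obtain C where C: "\<And>x. norm ((1 + norm x) ^ N *\<^sub>R \<phi> x) \<le> C"
    by (auto simp: bounded_iff)
  have "norm (\<phi> x) \<le> C / bracket x ^ N" for x
  proof -
    have "norm ((1 + norm x) ^ N *\<^sub>R \<phi> x) = norm (\<phi> x) * bracket x ^ N"
      by (simp add: bracket_def mult.commute)
    then show ?thesis using C[of x] by (simp only: pos_le_divide_eq zero_less_power bracket_pos)
  qed
  moreover have "C \<ge> 0" using norm_ge_zero C order_trans by blast
  ultimately show ?thesis using that by blast
qed

lemma integrable_bracket_dominated:
  fixes f :: "real^'d::finite \<Rightarrow> 'b::{banach, second_countable_topology}"
  assumes "f \<in> borel_measurable borel" "CARD('d) < N" "\<And>x. norm (f x) \<le> C / bracket x ^ N"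
  shows "integrable lborel f"
proof (rule Bochner_Integration.integrable_bound)
  show "integrable lborel (\<lambda>x::real^'d. C * (1 / bracket x ^ N))"
    by (intro integrable_mult_right integrable_bracket_power assms)
  show "AE x in lborel. norm (f x) \<le> norm (C * (1 / bracket x ^ N))"
  proof (rule AE_I2)
    fix x show "norm (f x) \<le> norm (C * (1 / bracket x ^ N))"
      using assms(3)[of x] abs_ge_self[of "C / bracket x ^ N"] by simp
  qed
qed (use assms in auto)

lemma schwartz_integrable:
  fixes \<phi> :: "real^'d::finite \<Rightarrow> complex"
  assumes "schwartz \<phi>" shows "integrable lborel \<phi>"
proof -
  obtain C where "\<And>x. norm (\<phi> x) \<le> C / bracket x ^ Suc CARD('d)"
    using schwartz_bound[OF assms, of "Suc CARD('d)"] by blast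
  then show ?thesis
    using schwartz_measurable[OF assms]
    by (intro integrable_bracket_dominated[where N = "Suc CARD('d)" and C = C]) simp_all
qed

section \<open>Decay of the Fourier transform of a Schwartz function\<close>

lemma cis_measurable [measurable]: "cis \<in> borel_measurable borel"
  by (intro borel_measurable_continuous_onI continuous_intros)

lemma integrable_cis_mult:
  assumes "integrable M f" "g \<in> borel_measurable M"
  shows "integrable M (\<lambda>x. cis (g x) * f x)"
proof (rule Bochner_Integration.integrable_bound[OF assms(1)])
  show "(\<lambda>x. cis (g x) * f x) \<in> borel_measurable M" using assms by measurable
qed (simp add: norm_mult)

lemma lborel_integral_translate:
  fixes f :: "'a::euclidean_space \<Rightarrow> 'b::{banach, second_countable_topology}"
  assumes [measurable]: "f \<in> borel_measurable borel"
  shows "(LINT x|lborel. f (c + x)) = (LINT x|lborel. f x)"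
  by (subst (2) lborel_distr_plus[of c, symmetric], subst integral_distr) auto

lemma lborel_integrable_translate:
  fixes f :: "'a::euclidean_space \<Rightarrow> 'b::{banach, second_countable_topology}"
  assumes "integrable lborel f"
  shows "integrable lborel (\<lambda>x. f (c + x))"
proof -
  have [measurable]: "f \<in> borel_measurable borel" using assms by auto
  show ?thesis
    using assms by (subst (asm) lborel_distr_plus[of c, symmetric], subst (asm) integrable_distr_eq) auto
qed

text \<open>A majorant for difference quotients that does not depend on the step h, needed for
  dominated convergence. By the mean value inequality the quotient is bounded by a derivative at
  distance at most 1 from x, and such a shift costs a factor 2 in the bracket.\<close>

lemma schwartz_difference_bound:
  assumes \<phi>: "schwartz \<phi>"
  obtains C where "C \<ge> 0"
    "\<And>x h. 0 < h \<Longrightarrow> h \<le> 1 \<Longrightarrow> norm ((\<phi> (h *\<^sub>R axis i 1 + x) - \<phi> x) /\<^sub>R h) \<le> C / bracket x ^ N"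
proof -
  obtain C where C: "C \<ge> 0" "\<And>x. norm (partial_deriv i \<phi> x) \<le> C / bracket x ^ N"
    using schwartz_bound[OF schwartz_partial[OF \<phi>]] by blast
  have "norm ((\<phi> (h *\<^sub>R axis i 1 + x) - \<phi> x) /\<^sub>R h) \<le> (C * 2 ^ N) / bracket x ^ N"
    if h: "0 < h" "h \<le> 1" for x h
  proof -
    let ?e = "axis i (1::real)"
    have dv: "((\<lambda>u. \<phi> (u *\<^sub>R ?e + x)) has_derivative (\<lambda>v. v *\<^sub>R partial_deriv i \<phi> (u *\<^sub>R ?e + x))) (at u)" for u
    proof -
      have "((\<lambda>u. \<phi> (u *\<^sub>R ?e + x)) has_derivative (\<lambda>v. frechet_derivative \<phi> (at (u *\<^sub>R ?e + x)) (v *\<^sub>R ?e))) (at u)"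
        by (rule has_derivative_compose[of "\<lambda>u. u *\<^sub>R ?e + x", OF _ smooth_has_derivative[OF schwartz_smooth[OF \<phi>]]])
          (auto intro!: derivative_eq_intros)
      then show ?thesis
        using linear_frechet_derivative[OF smooth_differentiable[OF schwartz_smooth[OF \<phi>]]]
        by (simp add: partial_deriv_def linear_scale)
    qed
    have "norm (\<phi> (h *\<^sub>R ?e + x) - \<phi> (0 *\<^sub>R ?e + x)) \<le> (C * 2 ^ N / bracket x ^ N) * norm (h - 0)"
    proof (rule differentiable_bound[of "{0..h}" "\<lambda>u. \<phi> (u *\<^sub>R ?e + x)"])
      fix u assume u: "u \<in> {0..h}"
      show "((\<lambda>u. \<phi> (u *\<^sub>R ?e + x)) has_derivative (\<lambda>v. v *\<^sub>R partial_deriv i \<phi> (u *\<^sub>R ?e + x))) (at u within {0..h})"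
        using dv by (rule has_derivative_at_withinI)
      have "bracket x \<le> bracket (u *\<^sub>R ?e + x) * bracket (x - (u *\<^sub>R ?e + x))"
        by (rule bracket_triangle)
      also have "\<dots> \<le> bracket (u *\<^sub>R ?e + x) * 2"
        using u h by (intro mult_left_mono) (auto simp: bracket_def)
      finally have "bracket x ^ N \<le> (bracket (u *\<^sub>R ?e + x) * 2) ^ N"
        by (intro power_mono) auto
      then have "C / bracket (u *\<^sub>R ?e + x) ^ N \<le> C * 2 ^ N / bracket x ^ N"
        using C(1) by (simp add: field_simps power_mult_distrib mult_left_mono)
      then have "norm (partial_deriv i \<phi> (u *\<^sub>R ?e + x)) \<le> C * 2 ^ N / bracket x ^ N"
        using C(2) order_trans by blast
      then show "onorm (\<lambda>v. v *\<^sub>R partial_deriv i \<phi> (u *\<^sub>R ?e + x)) \<le> C * 2 ^ N / bracket x ^ N"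
        by (intro onorm_le) (simp add: mult.commute mult_left_mono del: times_divide_eq_right)
    qed (use h in auto)
    then show ?thesis
      using h by (simp add: pos_divide_le_eq divide_inverse[symmetric] mult.commute[of "inverse h"] del: scaleR_diff_right times_divide_eq_left)
  qed
  moreover have "C * 2 ^ N \<ge> 0" using C by simp
  ultimately show ?thesis using that by blast
qed

text \<open>The derivative along the fixed steps 1 / (k + 1), in the form that dominated convergence
  for sequences requires.\<close>

lemma has_vector_derivative_imp_quotient_limit:
  fixes f :: "real \<Rightarrow> 'a::real_normed_vector"
  assumes "(f has_vector_derivative f') (at 0)"
  shows "(\<lambda>k. (f (1 / real (Suc k)) - f 0) /\<^sub>R (1 / real (Suc k))) \<longlonglongrightarrow> f'"
proof -
  let ?h = "\<lambda>k. 1 / real (Suc k)"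
  have 1: "((\<lambda>h. norm (f h - f 0 - h *\<^sub>R f') / norm h) \<longlongrightarrow> 0) (at 0)"
    using assms by (simp add: has_vector_derivative_def has_derivative_at)
  have "?h \<longlonglongrightarrow> 0" using LIMSEQ_Suc[OF lim_inverse_n'] by simp
  then have "filterlim ?h (at 0) sequentially"
    by (simp add: filterlim_at)
  from filterlim_compose[OF 1 this]
  have "(\<lambda>k. norm (f (?h k) - f 0 - ?h k *\<^sub>R f') / norm (?h k)) \<longlonglongrightarrow> 0" .
  also have "(\<lambda>k. norm (f (?h k) - f 0 - ?h k *\<^sub>R f') / norm (?h k)) = (\<lambda>k. norm ((f (?h k) - f 0) /\<^sub>R ?h k - f'))"
  proof
    fix k
    have "(f (?h k) - f 0) /\<^sub>R ?h k - f' = (f (?h k) - f 0 - ?h k *\<^sub>R f') /\<^sub>R ?h k"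
      by (simp add: algebra_simps)
    then show "norm (f (?h k) - f 0 - ?h k *\<^sub>R f') / norm (?h k) = norm ((f (?h k) - f 0) /\<^sub>R ?h k - f')"
      by (simp only: norm_scaleR norm_inverse real_norm_def abs_inverse divide_inverse mult.commute)
  qed
  finally have "(\<lambda>k. (f (?h k) - f 0) /\<^sub>R ?h k - f') \<longlonglongrightarrow> 0"
    by (simp only: tendsto_norm_zero_iff)
  then show ?thesis by (simp only: LIM_zero_iff)
qed

text \<open>Translation by h in direction i multiplies the transform by
  \<open>cis (h * \<xi> $ i)\<close>. The transform of the difference quotient is therefore the
  difference quotient of \<open>cis\<close> times the transform of \<phi>, and both sides pass to
  the limit as h tends to 0.\<close>

lemma fourier_partial:
  fixes \<phi> :: "real^'d::finite \<Rightarrow> complex"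
  assumes \<phi>: "schwartz \<phi>"
  shows "fourier (partial_deriv i \<phi>) \<xi> = \<i> * of_real (\<xi> $ i) * fourier \<phi> \<xi>"
proof -
  let ?e = "axis i (1::real) :: real^'d"
  let ?h = "\<lambda>k. 1 / real (Suc k)"
  let ?q = "\<lambda>k x. (\<phi> (?h k *\<^sub>R ?e + x) - \<phi> x) /\<^sub>R ?h k"
  have [measurable]: "\<phi> \<in> borel_measurable borel" "partial_deriv i \<phi> \<in> borel_measurable borel"
    using \<phi> schwartz_measurable schwartz_partial by auto
  obtain C where C: "\<And>x h. 0 < h \<Longrightarrow> h \<le> 1 \<Longrightarrow>
      norm ((\<phi> (h *\<^sub>R axis i 1 + x) - \<phi> x) /\<^sub>R h) \<le> C / bracket x ^ Suc CARD('d)"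
    using schwartz_difference_bound[OF \<phi>, of i "Suc CARD('d)"] by metis
  have h0: "?h \<longlonglongrightarrow> 0" using LIMSEQ_Suc[OF lim_inverse_n'] by simp
  have 1: "(\<lambda>k. LINT x|lborel. cis (- (x \<bullet> \<xi>)) * ?q k x) \<longlonglongrightarrow> (LINT x|lborel. cis (- (x \<bullet> \<xi>)) * partial_deriv i \<phi> x)"
  proof (rule integral_dominated_convergence[where w = "\<lambda>x. C * (1 / bracket x ^ Suc CARD('d))"])
    show "integrable lborel (\<lambda>x::real^'d. C * (1 / bracket x ^ Suc CARD('d)))"
      by (intro integrable_mult_right integrable_bracket_power) auto
    show "AE x in lborel. (\<lambda>k. cis (- (x \<bullet> \<xi>)) * ?q k x) \<longlonglongrightarrow> cis (- (x \<bullet> \<xi>)) * partial_deriv i \<phi> x"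
    proof (intro AE_I2 tendsto_mult tendsto_const)
      fix x
      have "((\<lambda>u. \<phi> (u *\<^sub>R ?e + x)) has_derivative (\<lambda>v. frechet_derivative \<phi> (at (0 *\<^sub>R ?e + x)) (v *\<^sub>R ?e))) (at 0)"
        by (rule has_derivative_compose[of "\<lambda>u. u *\<^sub>R ?e + x", OF _ smooth_has_derivative[OF schwartz_smooth[OF \<phi>]]])
          (auto intro!: derivative_eq_intros)
      then have "((\<lambda>u. \<phi> (u *\<^sub>R ?e + x)) has_vector_derivative partial_deriv i \<phi> x) (at 0)"
        using linear_frechet_derivative[OF smooth_differentiable[OF schwartz_smooth[OF \<phi>]]]
        by (simp add: partial_deriv_def linear_scale has_vector_derivative_def)
      then show "(\<lambda>k. ?q k x) \<longlonglongrightarrow> partial_deriv i \<phi> x"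
        using has_vector_derivative_imp_quotient_limit by fastforce
    qed
    show "AE x in lborel. norm (cis (- (x \<bullet> \<xi>)) * ?q k x) \<le> C * (1 / bracket x ^ Suc CARD('d))" for k
      using C[of "?h k"] by (auto simp: norm_mult)
  qed measurable
  have 2: "(LINT x|lborel. cis (- (x \<bullet> \<xi>)) * ?q k x) = ((cis (?h k * \<xi> $ i) - 1) /\<^sub>R ?h k) * fourier \<phi> \<xi>" for k
  proof -
    let ?f = "\<lambda>x. cis (- (x \<bullet> \<xi>)) * \<phi> x"
    have i: "integrable lborel ?f"
      by (intro integrable_cis_mult schwartz_integrable \<phi>) auto
    have eq: "cis (- (x \<bullet> \<xi>)) * ?q k x = (cis (?h k * \<xi> $ i) * ?f (?h k *\<^sub>R ?e + x) - ?f x) /\<^sub>R ?h k" for x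
    proof -
      have "cis (- (x \<bullet> \<xi>)) = cis (?h k * \<xi> $ i) * cis (- ((?h k *\<^sub>R ?e + x) \<bullet> \<xi>))"
        by (simp only: cis_mult) (simp add: inner_add_left inner_axis' )
      then have "cis (- (x \<bullet> \<xi>)) * \<phi> (?h k *\<^sub>R ?e + x) = cis (?h k * \<xi> $ i) * ?f (?h k *\<^sub>R ?e + x)"
        by (metis mult.assoc)
      then show ?thesis by (simp only: mult_scaleR_right right_diff_distrib)
    qed
    have "(LINT x|lborel. cis (- (x \<bullet> \<xi>)) * ?q k x) 
        = (cis (?h k * \<xi> $ i) * (LINT x|lborel. ?f (?h k *\<^sub>R ?e + x)) - (LINT x|lborel. ?f x)) /\<^sub>R ?h k"
      unfolding eq using i lborel_integrable_translate[OF i, of "?h k *\<^sub>R ?e"]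
      by (subst integral_scaleR_right, subst Bochner_Integration.integral_diff) auto
    also have "(LINT x|lborel. ?f (?h k *\<^sub>R ?e + x)) = (LINT x|lborel. ?f x)"
      by (rule lborel_integral_translate) measurable
    finally show ?thesis by (simp add: fourier_def algebra_simps)
  qed
  have "(\<lambda>k. (cis (?h k * \<xi> $ i) - 1) /\<^sub>R ?h k) \<longlonglongrightarrow> \<i> * of_real (\<xi> $ i)"
  proof -
    have "((\<lambda>h. cis (h * \<xi> $ i)) has_vector_derivative \<i> * of_real (\<xi> $ i)) (at 0)"
      unfolding has_vector_derivative_def
      by (auto intro!: derivative_eq_intros simp: scaleR_conv_of_real)
    then show ?thesis
      using has_vector_derivative_imp_quotient_limit by fastforce
  qed
  then have "(\<lambda>k. ((cis (?h k * \<xi> $ i) - 1) /\<^sub>R ?h k) * fourier \<phi> \<xi>) \<longlonglongrightarrow> \<i> * of_real (\<xi> $ i) * fourier \<phi> \<xi>"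
    by (intro tendsto_intros)
  with 1 show ?thesis unfolding 2 fourier_def using LIMSEQ_unique by blast
qed

lemma norm_fourier_le: "norm (fourier f \<xi>) \<le> (LINT x|lborel. norm (f x))"
  using integral_norm_bound[of lborel "\<lambda>x. cis (- (x \<bullet> \<xi>)) * f x"]
  by (simp add: fourier_def norm_mult)

lemma inv_fourier_eq: 
  fixes f :: "real^'d::finite \<Rightarrow> complex"
  shows "inv_fourier f x = of_real (1 / (2 * pi) ^ CARD('d)) * fourier f (- x)"
  by (simp add: inv_fourier_def fourier_def inner_commute)

lemma fourier_measurable [measurable]:
  assumes [measurable]: "f \<in> borel_measurable borel"
  shows "fourier f \<in> borel_measurable borel"
  unfolding fourier_def[abs_def] by measurable

lemma inv_fourier_measurable [measurable]:
  assumes [measurable]: "f \<in> borel_measurable borel"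
  shows "inv_fourier f \<in> borel_measurable borel"
  unfolding inv_fourier_def[abs_def] by measurable

lemma schwartz_funpow_partial: "schwartz \<phi> \<Longrightarrow> schwartz ((partial_deriv i ^^ k) \<phi>)"
  by (induction k) (auto intro: schwartz_partial)

lemma fourier_funpow_partial:
  "schwartz \<phi> \<Longrightarrow> fourier ((partial_deriv i ^^ k) \<phi>) \<xi> = (\<i> * of_real (\<xi> $ i)) ^ k * fourier \<phi> \<xi>"
  by (induction k) (auto simp: fourier_partial schwartz_funpow_partial)

text \<open>Pure derivatives suffice. Let m be the largest of 1 and the absolute coordinates of
  \<xi>; the bracket is at most (1 + d) m. Either m = 1, where order 0 is used, or m is one
  coordinate, where N derivatives in that direction are used.\<close>

lemma fourier_decay:
  fixes \<phi> :: "real^'d::finite \<Rightarrow> complex"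
  assumes \<phi>: "schwartz \<phi>"
  obtains C where "C \<ge> 0" "\<And>\<xi>. norm (fourier \<phi> \<xi>) \<le> C / bracket \<xi> ^ N"
proof -
  define I where "I i k = (LINT x|lborel. norm ((partial_deriv i ^^ k) \<phi> x))" for i :: 'd and k :: nat
  have I: "\<bar>\<xi> $ i\<bar> ^ k * norm (fourier \<phi> \<xi>) \<le> I i k" for \<xi> i k
    using norm_fourier_le[of "(partial_deriv i ^^ k) \<phi>" \<xi>]
    by (simp add: I_def fourier_funpow_partial[OF \<phi>] norm_mult norm_power)
  have I0: "I i k \<ge> 0" for i k unfolding I_def by (rule integral_nonneg_AE) auto
  define C where "C = (1 + real CARD('d)) ^ N * (\<Sum>i\<in>UNIV. I i 0 + I i N)"
  have "norm (fourier \<phi> \<xi>) \<le> C / bracket \<xi> ^ N" for \<xi>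
  proof -
    define m where "m = Max (insert 1 (range (\<lambda>i. \<bar>\<xi> $ i\<bar>)))"
    have m: "m \<in> insert 1 (range (\<lambda>i. \<bar>\<xi> $ i\<bar>))"
      unfolding m_def by (rule Max_in) auto
    have le: "1 \<le> m" "\<bar>\<xi> $ i\<bar> \<le> m" for i
      unfolding m_def by (rule Max_ge; auto)+
    have "bracket \<xi> \<le> 1 + (\<Sum>i\<in>UNIV. \<bar>\<xi> $ i\<bar>)" 
      using norm_le_l1_cart[of \<xi>] by (simp add: bracket_def)
    also have "\<dots> \<le> m + (\<Sum>i\<in>(UNIV::'d set). m)"
      by (intro add_mono sum_mono le)
    also have "\<dots> = (1 + real CARD('d)) * m" by (simp add: algebra_simps)
    finally have "bracket \<xi> ^ N \<le> ((1 + real CARD('d)) * m) ^ N"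
      by (intro power_mono) auto
    then have 1: "norm (fourier \<phi> \<xi>) * bracket \<xi> ^ N \<le> (1 + real CARD('d)) ^ N * (m ^ N * norm (fourier \<phi> \<xi>))"
      using mult_left_mono[of "bracket \<xi> ^ N" "((1 + real CARD('d)) * m) ^ N" "norm (fourier \<phi> \<xi>)"]
      by (simp add: power_mult_distrib mult_ac)
    have "\<exists>i k. k \<in> {0, N} \<and> m ^ N * norm (fourier \<phi> \<xi>) \<le> I i k"
    proof (cases "m = 1")
      case True then show ?thesis using I[of \<xi> undefined 0] by auto
    next
      case False
      with m obtain i where "m = \<bar>\<xi> $ i\<bar>" by auto
      then show ?thesis using I[of \<xi> i N] by auto
    qed
    then obtain i where i: "m ^ N * norm (fourier \<phi> \<xi>) \<le> I i 0 + I i N"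
      using I0 by (metis add_increasing add_increasing2 insertE singletonD)
    also have "\<dots> \<le> (\<Sum>i\<in>UNIV. I i 0 + I i N)"
      using I0 by (intro member_le_sum) auto
    finally have "norm (fourier \<phi> \<xi>) * bracket \<xi> ^ N \<le> C"
      unfolding C_def using 1 by (smt (verit) mult_left_mono zero_le_power of_nat_0_le_iff)
    then show ?thesis by (simp add: pos_le_divide_eq)
  qed
  moreover have "C \<ge> 0" unfolding C_def using I0 by (auto intro!: mult_nonneg_nonneg sum_nonneg)
  ultimately show ?thesis using that by blast
qed

lemma inv_fourier_decay:
  fixes \<phi> :: "real^'d::finite \<Rightarrow> complex"
  assumes \<phi>: "schwartz \<phi>"
  obtains C where "C \<ge> 0" "\<And>\<xi>. norm (inv_fourier \<phi> \<xi>) \<le> C / bracket \<xi> ^ N"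
proof -
  obtain C where C: "C \<ge> 0" "\<And>\<xi>. norm (fourier \<phi> \<xi>) \<le> C / bracket \<xi> ^ N"
    using fourier_decay[OF \<phi>] by blast
  let ?k = "norm (complex_of_real (1 / (2 * pi) ^ CARD('d)))"
  have "norm (inv_fourier \<phi> \<xi>) \<le> (?k * C) / bracket \<xi> ^ N" for \<xi>
    unfolding inv_fourier_eq norm_mult using mult_left_mono[OF C(2)[of "- \<xi>"], of ?k] by simp
  moreover have "?k * C \<ge> 0" using C(1) by simp
  ultimately show ?thesis using that by blast
qed

section \<open>Test functions built from the cutoff, and uniqueness of the representing
  function\<close>

lemma cutoff_smooth: "cutoff \<eta> \<Longrightarrow> smooth \<eta>"
  by (simp add: cutoff_def)

lemma cutoff_measurable: "cutoff \<eta> \<Longrightarrow> \<eta> \<in> borel_measurable borel"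
  by (intro borel_measurable_continuous_onI smooth_continuous cutoff_smooth)

lemma cutoff_eq_1: "cutoff \<eta> \<Longrightarrow> (\<And>i. \<bar>x $ i\<bar> \<le> 1) \<Longrightarrow> \<eta> x = 1"
  by (auto simp: cutoff_def abs_le_iff)

text \<open>The test functions used below: the factor p is a constant, a polynomial, or the cutoff
  itself.\<close>

lemma schwartz_cutoff_mult:
  assumes \<eta>: "cutoff \<eta>" and p: "smooth p" and c: "c \<noteq> 0"
  shows "schwartz (\<lambda>x. complex_of_real (\<eta> (c *\<^sub>R x) * p x))"
proof (rule schwartz_compact_support)
  let ?K = "closure {x. \<eta> x \<noteq> 0}"
  show "compact ((\<lambda>x. inverse c *\<^sub>R x) ` ?K)"
    using \<eta> by (intro compact_scaling) (simp add: cutoff_def)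
  show "complex_of_real (\<eta> (c *\<^sub>R x) * p x) = 0" if "x \<notin> (\<lambda>x. inverse c *\<^sub>R x) ` ?K" for x
  proof (rule ccontr)
    assume "complex_of_real (\<eta> (c *\<^sub>R x) * p x) \<noteq> 0"
    then have "c *\<^sub>R x \<in> ?K" by (auto intro: closure_subset[THEN subsetD])
    moreover have "x = inverse c *\<^sub>R (c *\<^sub>R x)" using c by simp
    ultimately show False using that by blast
  qed
qed (intro smooth_of_real smooth_mult smooth_scale cutoff_smooth \<eta> p)

lemma schwartz_cutoff: "cutoff \<eta> \<Longrightarrow> schwartz (\<lambda>x. complex_of_real (\<eta> x))"
  using schwartz_cutoff_mult[of \<eta> "\<lambda>x. 1" 1] smooth_const by auto

text \<open>Continuous functions increase to indicators of open sets, open sets generate the Borel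
  sets and are stable under intersection, and an integrable density whose integral over every Borel
  set is 0 vanishes almost everywhere.\<close>

lemma AE_zero_if_integral_continuous_zero:
  fixes u :: "'a::euclidean_space \<Rightarrow> real"
  assumes u: "integrable lborel u"
    and z: "\<And>f::'a \<Rightarrow> real. continuous_on UNIV f \<Longrightarrow> (\<And>x. 0 \<le> f x \<and> f x \<le> 1) \<Longrightarrow> (LINT x|lborel. u x * f x) = 0"
  shows "AE x in lborel. u x = 0"
proof -
  have [measurable]: "u \<in> borel_measurable borel" using u by auto
  have "(LINT x|lborel. indicator U x * u x) = 0" if "open U" for U
  proof -
    have [measurable]: "U \<in> sets borel" using that by simp
    \<comment> \<open>The whole space is separated because \<open>infdist\<close> to the empty set
      is 0 by convention, which would give the zero function instead of 1.\<close>
    define f where "f k x = (if U = UNIV then 1 else min 1 (real k * infdist x (- U)))" for k x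
    have cf: "continuous_on UNIV (f k)" for k
      unfolding f_def by (cases "U = UNIV") (auto intro!: continuous_intros)
    have lim: "(\<lambda>k. f k x) \<longlonglongrightarrow> indicator U x" for x
    proof (cases "x \<in> U \<and> U \<noteq> UNIV")
      case True
      then have "infdist x (- U) > 0"
        using that by (intro infdist_pos_not_in_closed) auto
      then obtain k0 where k0: "real k0 * infdist x (- U) \<ge> 1"
        by (metis ex_less_of_nat_mult less_imp_le)
      have "f k x = 1" if "k \<ge> k0" for k
      proof -
        have "real k0 * infdist x (- U) \<le> real k * infdist x (- U)"
          using that by (intro mult_right_mono) (auto simp: infdist_nonneg)
        then show ?thesis using k0 True by (auto simp: f_def)
      qed
      then have "(\<lambda>k. f k x) \<longlonglongrightarrow> 1"
        by (intro tendsto_eventually) (auto simp: eventually_sequentially)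
      then show ?thesis using True by simp
    next
      case False
      show ?thesis
      proof (cases "U = UNIV")
        case False
        then have "x \<in> - U" using \<open>\<not> (x \<in> U \<and> U \<noteq> UNIV)\<close> by auto
        then show ?thesis using False by (simp add: f_def)
      qed (simp add: f_def)
    qed
    have b: "0 \<le> f k x \<and> f k x \<le> 1" for k x by (auto simp: f_def infdist_nonneg)
    have "(\<lambda>k. LINT x|lborel. u x * f k x) \<longlonglongrightarrow> (LINT x|lborel. u x * indicator U x)"
    proof (rule integral_dominated_convergence[where w = "\<lambda>x. \<bar>u x\<bar>"])
      have [measurable]: "f k \<in> borel_measurable borel" for k
        using cf by (rule borel_measurable_continuous_onI)
      show "(\<lambda>x. u x * f k x) \<in> borel_measurable lborel" for k by measurable
      show "(\<lambda>x. u x * indicator U x) \<in> borel_measurable lborel" by measurable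
      show "AE x in lborel. norm (u x * f k x) \<le> \<bar>u x\<bar>" for k
        using b by (auto simp: abs_mult intro!: mult_left_le)
    qed (use u lim in \<open>auto intro!: tendsto_intros\<close>)
    then show ?thesis using z[OF cf b] by (simp add: LIMSEQ_const_iff mult.commute)
  qed
  note op = this
  have "(LINT x|lborel. indicator A x * u x) = 0" if "A \<in> sets borel" for A
  proof -
    have "Int_stable {S::'a set. open S}" "{S::'a set. open S} \<subseteq> Pow UNIV" "A \<in> sigma_sets UNIV {S. open S}"
      using that by (auto simp: sets_borel Int_stable_def)
    then show ?thesis
    proof (induction rule: sigma_sets_induct_disjoint)
      case (basic A) then show ?case using op by auto
    next
      case (compl A)
      have "A \<in> sets borel" using compl(1) by (simp add: sets_borel)
      then have i: "integrable lborel (\<lambda>x. indicator A x * u x)"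
        using integrable_mult_indicator[OF _ u, of A] by simp
      have "(LINT x|lborel. indicator (UNIV - A) x * u x) = (LINT x|lborel. u x - indicator A x * u x)"
        by (intro Bochner_Integration.integral_cong) (auto simp: indicator_def)
      also have "\<dots> = 0" using compl(2) op[OF open_UNIV] u i by simp
      finally show ?case .
    next
      case (union A)
      have A: "A i \<in> sets borel" for i using union(2) by (auto simp: sets_borel)
      have "set_integrable lborel (\<Union>i. A i) u"
        unfolding set_integrable_def using A by (intro integrable_mult_indicator u) auto
      then have "(LINT x:(\<Union>i. A i)|lborel. u x) = (\<Sum>i. (LINT x:A i|lborel. u x))"
        using A union(1) by (intro lebesgue_integral_countable_add) (auto simp: disjoint_family_on_def)
      then show ?case using union by (simp add: set_lebesgue_integral_def)
    qed auto
  qed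
  then show ?thesis
    using density_unique_real[OF u, of "\<lambda>x. 0"] by (auto simp: set_lebesgue_integral_def)
qed

text \<open>The difference w pairs to zero with cutoff times polynomial. Stone-Weierstrass on the
  support of the cutoff replaces polynomials by continuous functions, so w vanishes almost
  everywhere where the cutoff is nonzero; letting its radius grow reaches every point.\<close>

lemma represents_unique:
  fixes \<eta> :: "real^'d::finite \<Rightarrow> real" and v v' :: "real^'d \<Rightarrow> complex"
  assumes \<eta>: "cutoff \<eta>" and v: "represents v W" and v': "represents v' W"
  shows "AE x in lborel. v x = v' x"
proof -
  define w where "w x = v x - v' x" for x
  have [measurable]: "v \<in> borel_measurable borel" "v' \<in> borel_measurable borel"
    using v v' by (auto simp: represents_def)
  have w: "integrable lborel (\<lambda>x. w x * \<phi> x)" "(LINT x|lborel. w x * \<phi> x) = 0" if "schwartz \<phi>" for \<phi>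
    using v v' that by (auto simp: represents_def w_def algebra_simps)
  have R: "AE x in lborel. w x * of_real (\<eta> (c *\<^sub>R x)) = 0" if c: "c > 0" for c
  proof -
    let ?K = "(\<lambda>x. inverse c *\<^sub>R x) ` closure {x. \<eta> x \<noteq> 0}"
    have K: "compact ?K" using \<eta> by (intro compact_scaling) (simp add: cutoff_def)
    have out: "\<eta> (c *\<^sub>R x) = 0" if "x \<notin> ?K" for x
    proof (rule ccontr)
      assume "\<eta> (c *\<^sub>R x) \<noteq> 0"
      then have "c *\<^sub>R x \<in> closure {x. \<eta> x \<noteq> 0}" by (auto intro: closure_subset[THEN subsetD])
      moreover have "x = inverse c *\<^sub>R (c *\<^sub>R x)" using c by simp
      ultimately show False using that by blast
    qed
    define u where "u x = w x * of_real (\<eta> (c *\<^sub>R x))" for x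
    have u: "integrable lborel u"
      using w(1)[OF schwartz_cutoff_mult[OF \<eta> smooth_const[of 1], of c]] c by (simp add: u_def[abs_def])
    have p0: "(LINT x|lborel. u x * of_real (p x)) = 0" if "real_polynomial_function p" for p :: "real^'d \<Rightarrow> real"
      using w(2)[OF schwartz_cutoff_mult[OF \<eta> smooth_real_polynomial_function[OF that], of c]] c
      by (simp add: u_def mult.assoc)
    have "(LINT x|lborel. u x * of_real (f x)) = 0"
      if f: "continuous_on UNIV f" and f01: "\<And>x. 0 \<le> f x \<and> f x \<le> 1" for f :: "real^'d \<Rightarrow> real"
    proof -
      have [measurable]: "f \<in> borel_measurable borel" "u \<in> borel_measurable borel" 
        using f u by (auto intro: borel_measurable_continuous_onI)
      have "norm (LINT x|lborel. u x * of_real (f x)) \<le> e * (LINT x|lborel. norm (u x))" if e: "e > 0" for e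
      proof -
        \<comment> \<open>The polynomial is close to f only on the compact set \<open>?K\<close>;
          outside it u vanishes, so the values of p there are harmless.\<close>
        obtain p where p: "real_polynomial_function p" "\<And>x. x \<in> ?K \<Longrightarrow> \<bar>f x - p x\<bar> < e"
          using Stone_Weierstrass_real_polynomial_function[OF K continuous_on_subset[OF f subset_UNIV] e] by blast
        have i1: "integrable lborel (\<lambda>x. u x * of_real (f x))"
          by (rule Bochner_Integration.integrable_bound[OF u]) 
            (use f01 in \<open>auto simp: norm_mult intro!: mult_left_le\<close>)
        have i2: "integrable lborel (\<lambda>x. u x * of_real (p x))"
          using w(1)[OF schwartz_cutoff_mult[OF \<eta> smooth_real_polynomial_function[OF p(1)], of c]] c
          by (simp add: u_def mult.assoc)
        have "(LINT x|lborel. u x * of_real (f x)) = (LINT x|lborel. u x * of_real (f x)) - (LINT x|lborel. u x * of_real (p x))"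
          using p0[OF p(1)] by simp
        also have "\<dots> = (LINT x|lborel. u x * of_real (f x) - u x * of_real (p x))"
          using i1 i2 by simp
        also have "norm \<dots> \<le> (LINT x|lborel. e * norm (u x))"
        proof (rule order_trans[OF integral_norm_bound integral_mono])
          fix x show "norm (u x * of_real (f x) - u x * of_real (p x)) \<le> e * norm (u x)"
          proof (cases "x \<in> ?K")
            case True
            have "norm (u x * of_real (f x) - u x * of_real (p x)) = norm (u x) * \<bar>f x - p x\<bar>"
              by (metis norm_mult norm_of_real of_real_diff right_diff_distrib)
            also have "\<dots> \<le> norm (u x) * e" using p(2)[OF True] by (intro mult_left_mono) auto
            finally show ?thesis by (simp add: mult.commute)
          next
            case False then show ?thesis using out e by (simp add: u_def)
          qed
        qed (use i1 i2 u in auto)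
        finally show ?thesis by simp
      qed
      note le = this
      have "norm (LINT x|lborel. u x * of_real (f x)) \<le> 0"
      proof (rule field_le_epsilon)
        fix e :: real assume "e > 0"
        let ?N = "LINT x|lborel. norm (u x)"
        have N: "?N \<ge> 0" by simp
        have "e / (1 + n) * n \<le> e" if "n \<ge> 0" for n
          using that \<open>e > 0\<close> by (simp add: field_simps)
        from this[OF N] have "e / (1 + ?N) * ?N \<le> e" .
        then show "norm (LINT x|lborel. u x * of_real (f x)) \<le> 0 + e"
          using le[of "e / (1 + ?N)"] \<open>e > 0\<close> N by (simp add: add_pos_nonneg)
      qed
      then show ?thesis by simp
    qed
    note z = this
    have 1: "integrable lborel (\<lambda>x. u x * of_real (f x))" 
      if f: "continuous_on UNIV f" and f01: "\<And>x. 0 \<le> f x \<and> f x \<le> 1" for f :: "real^'d \<Rightarrow> real"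
    proof -
      have [measurable]: "f \<in> borel_measurable borel" "u \<in> borel_measurable borel" 
        using f u by (auto intro: borel_measurable_continuous_onI)
      show ?thesis
       by (rule Bochner_Integration.integrable_bound[OF u]) 
            (use f01 in \<open>auto simp: norm_mult intro!: mult_left_le\<close>)
    qed
    have "AE x in lborel. Re (u x) = 0"
    proof (rule AE_zero_if_integral_continuous_zero)
      show "(LINT x|lborel. Re (u x) * f x) = 0"
        if "continuous_on UNIV f" "\<And>x. 0 \<le> f x \<and> f x \<le> 1" for f :: "real^'d \<Rightarrow> real"
        using arg_cong[OF z[OF that], of Re] 1[OF that] integral_Re[of lborel "\<lambda>x. u x * of_real (f x)"] by simp
    qed (use u in auto)
    moreover have "AE x in lborel. Im (u x) = 0"
    proof (rule AE_zero_if_integral_continuous_zero)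
      show "(LINT x|lborel. Im (u x) * f x) = 0"
        if "continuous_on UNIV f" "\<And>x. 0 \<le> f x \<and> f x \<le> 1" for f :: "real^'d \<Rightarrow> real"
        using arg_cong[OF z[OF that], of Im] 1[OF that] integral_Im[of lborel "\<lambda>x. u x * of_real (f x)"] by simp
    qed (use u in auto)
    ultimately show ?thesis unfolding u_def[symmetric] by eventually_elim (simp add: complex_eq_iff)
  qed
  have "AE x in lborel. \<forall>k::nat. w x * of_real (\<eta> ((1 / real (Suc k)) *\<^sub>R x)) = 0"
    unfolding AE_all_countable using R by simp
  then show ?thesis
  proof eventually_elim
    case (elim x)
    obtain k :: nat where k: "norm x \<le> real k" using real_arch_simple by blast
    have "\<eta> ((1 / real (Suc k)) *\<^sub>R x) = 1"
    proof (rule cutoff_eq_1[OF \<eta>])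
      fix i
      have "\<bar>x $ i\<bar> \<le> real (Suc k)" using component_le_norm_cart[of x i] k by simp
      then show "\<bar>((1 / real (Suc k)) *\<^sub>R x) $ i\<bar> \<le> 1" by (simp add: abs_mult field_simps)
    qed
    with elim[rule_format, of k] show ?case by (simp add: w_def)
  qed
qed

section \<open>The Fourier transform on \<open>L\<^sup>2\<close>\<close>

lemma nn_integral_lborel_affine:
  fixes f :: "'a::euclidean_space \<Rightarrow> ennreal"
  assumes [measurable]: "f \<in> borel_measurable borel" and c: "c \<noteq> 0"
  shows "(\<integral>\<^sup>+x. f x \<partial>lborel) = ennreal (\<bar>c\<bar> ^ DIM('a)) * (\<integral>\<^sup>+x. f (t + c *\<^sub>R x) \<partial>lborel)"
  by (subst lborel_affine[OF c, of t])
    (simp add: nn_integral_density nn_integral_distr nn_integral_cmult)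

lemma integral_lborel_affine:
  fixes f :: "'a::euclidean_space \<Rightarrow> 'b::{banach, second_countable_topology}"
  assumes [measurable]: "f \<in> borel_measurable borel" and c: "c \<noteq> 0"
  shows "(LINT x|lborel. f x) = (\<bar>c\<bar> ^ DIM('a)) *\<^sub>R (LINT x|lborel. f (t + c *\<^sub>R x))"
  by (subst lborel_affine[OF c, of t])
    (simp add: integral_density integral_distr)

lemma integrable_lborel_affine:
  fixes f :: "'a::euclidean_space \<Rightarrow> 'b::{banach, second_countable_topology}"
  assumes f: "integrable lborel f" and c: "c \<noteq> 0"
  shows "integrable lborel (\<lambda>x. f (t + c *\<^sub>R x))"
proof -
  have [measurable]: "f \<in> borel_measurable borel" using f by auto
  have "integrable (density (distr lborel borel (\<lambda>x. t + c *\<^sub>R x)) (\<lambda>_. ennreal (\<bar>c\<bar> ^ DIM('a)))) f"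
    using f lborel_affine[OF c, of t] by simp
  then have "integrable lborel (\<lambda>x. (\<bar>c\<bar> ^ DIM('a)) *\<^sub>R f (t + c *\<^sub>R x))"
    by (simp add: integrable_density integrable_distr_eq)
  then have "integrable lborel (\<lambda>x. inverse (\<bar>c\<bar> ^ DIM('a)) *\<^sub>R (\<bar>c\<bar> ^ DIM('a)) *\<^sub>R f (t + c *\<^sub>R x))"
    by (rule integrable_scaleR_right)
  then show ?thesis using c by simp
qed

lemma nn_integral_limit_le:
  fixes u :: "nat \<Rightarrow> 'a \<Rightarrow> ennreal"
  assumes m: "\<And>k. u k \<in> borel_measurable M" and lim: "AE x in M. (\<lambda>k. u k x) \<longlonglongrightarrow> v x"
    and le: "\<And>k. (\<integral>\<^sup>+x. u k x \<partial>M) \<le> B"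
  shows "(\<integral>\<^sup>+x. v x \<partial>M) \<le> B"
proof -
  have "(\<integral>\<^sup>+x. v x \<partial>M) = (\<integral>\<^sup>+x. liminf (\<lambda>k. u k x) \<partial>M)"
    using lim by (intro nn_integral_cong_AE) (auto elim!: eventually_mono dest: lim_imp_Liminf[rotated])
  also have "\<dots> \<le> liminf (\<lambda>k. \<integral>\<^sup>+x. u k x \<partial>M)"
    by (intro nn_integral_liminf m)
  also have "\<dots> \<le> B"
    using le by (intro Liminf_le) auto
  finally show ?thesis .
qed

text \<open>Integrability is not assumed: the Bochner integral of a non-integrable function is 0 by
  convention.\<close>

lemma norm_integral_le_nn_integral:
  fixes h :: "'a \<Rightarrow> 'b::{banach, second_countable_topology}"
  shows "ennreal (norm (integral\<^sup>L M h)) \<le> (\<integral>\<^sup>+x. ennreal (norm (h x)) \<partial>M)"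
  by (cases "integrable M h") (auto simp: not_integrable_integral_eq intro: integral_norm_bound_ennreal)

text \<open>The transform moves from one factor to the other. The sign s = -1 belongs to
  \<open>fourier\<close>, s = 1 to \<open>inv_fourier\<close>.\<close>

lemma oscillatory_fubini:
  fixes f g :: "real^'d::finite \<Rightarrow> complex"
  assumes f: "integrable lborel f" and g: "integrable lborel g"
  shows "(LINT x|lborel. g x * (LINT \<xi>|lborel. cis (s * (x \<bullet> \<xi>)) * f \<xi>))
       = (LINT \<xi>|lborel. f \<xi> * (LINT x|lborel. cis (s * (x \<bullet> \<xi>)) * g x))"
proof -
  have [measurable]: "f \<in> borel_measurable borel" "g \<in> borel_measurable borel" using f g by auto
  have i: "integrable (lborel \<Otimes>\<^sub>M lborel) (\<lambda>(x, \<xi>). cis (s * (x \<bullet> \<xi>)) * (g x * f \<xi>))"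
  proof (rule lborel_pair.Fubini_integrable)
    show "integrable lborel (\<lambda>x. LINT \<xi>|lborel. norm (case (x, \<xi>) of (x, \<xi>) \<Rightarrow> cis (s * (x \<bullet> \<xi>)) * (g x * f \<xi>)))"
      using f g by (simp add: norm_mult)
    show "AE x in lborel. integrable lborel (\<lambda>\<xi>. case (x, \<xi>) of (x, \<xi>) \<Rightarrow> cis (s * (x \<bullet> \<xi>)) * (g x * f \<xi>))"
      using f by (auto intro!: integrable_cis_mult)
  qed measurable
  have "(LINT x|lborel. g x * (LINT \<xi>|lborel. cis (s * (x \<bullet> \<xi>)) * f \<xi>))
      = (LINT x|lborel. LINT \<xi>|lborel. cis (s * (x \<bullet> \<xi>)) * (g x * f \<xi>))"
    by (subst integral_mult_right_zero[symmetric]) (simp add: mult_ac)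
  also have "\<dots> = (LINT \<xi>|lborel. LINT x|lborel. cis (s * (x \<bullet> \<xi>)) * (g x * f \<xi>))"
    using lborel_pair.Fubini_integral[OF i] by simp
  also have "\<dots> = (LINT \<xi>|lborel. f \<xi> * (LINT x|lborel. cis (s * (x \<bullet> \<xi>)) * g x))"
    by (subst integral_mult_right_zero[symmetric]) (simp add: mult_ac)
  finally show ?thesis .
qed

lemma fourier_scale:
  fixes f :: "real^'d::finite \<Rightarrow> complex"
  assumes [measurable]: "f \<in> borel_measurable borel" and R: "R > 0"
  shows "fourier (\<lambda>x. f (inverse R *\<^sub>R x)) \<xi> = of_real (R ^ CARD('d)) * fourier f (R *\<^sub>R \<xi>)"
  using integral_lborel_affine[of "\<lambda>x. cis (- (x \<bullet> \<xi>)) * f (inverse R *\<^sub>R x)" R 0] R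
  by (simp add: fourier_def scaleR_conv_of_real[where 'a = complex])

text \<open>The cutoff \<open>\<eta>\<^sup>2 (x / R)\<close> has an integrable Fourier transform, whose \<open>L\<^sup>1\<close> norm does not
  depend on \<open>R\<close>; it makes the double integral behind Plancherel's theorem absolutely convergent.\<close>

lemma plancherel_le:
  fixes \<eta> :: "real^'d::finite \<Rightarrow> real"
  assumes \<eta>: "cutoff \<eta>"
  obtains C where "C \<ge> 0"
    "\<And>f :: real^'d \<Rightarrow> complex. integrable lborel f \<Longrightarrow>
      (\<integral>\<^sup>+x. ennreal ((norm (inv_fourier f x))\<^sup>2) \<partial>lborel) \<le> ennreal C * (\<integral>\<^sup>+x. ennreal ((norm (f x))\<^sup>2) \<partial>lborel)"
proof -
  have [measurable]: "\<eta> \<in> borel_measurable borel" by (rule cutoff_measurable[OF \<eta>])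
  \<comment> \<open>The square makes the cutoff factor nonnegative, so that the truncated integral
    of the squared modulus of \<open>?F\<close> is an ordinary absolutely convergent integral with
    kernel k.\<close>
  define k where "k x = complex_of_real (\<eta> x * \<eta> x)" for x
  have k: "schwartz k"
    using schwartz_cutoff_mult[OF \<eta> cutoff_smooth[OF \<eta>], of 1] by (simp add: k_def[abs_def])
  have [measurable]: "k \<in> borel_measurable borel" using schwartz_measurable[OF k] .
  obtain D where D: "D \<ge> 0" "\<And>\<xi>. norm (fourier k \<xi>) \<le> D / bracket \<xi> ^ Suc CARD('d)"
    using fourier_decay[OF k] by blast
  have ik: "integrable lborel (fourier k)"
    by (rule integrable_bracket_dominated[where N = "Suc CARD('d)" and C = D]) (use D in auto)
  define C1 where "C1 = (LINT \<xi>|lborel. norm (fourier k \<xi>))"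
  have C1: "(\<integral>\<^sup>+\<xi>. ennreal (norm (fourier k \<xi>)) \<partial>lborel) = ennreal C1" "C1 \<ge> 0"
    unfolding C1_def using ik by (subst nn_integral_eq_integral) auto
  define c where "c = 1 / (2 * pi) ^ CARD('d)"
  have c: "c > 0" by (simp add: c_def)
  show ?thesis
  proof (rule that[of "c\<^sup>2 * C1"])
    show "0 \<le> c\<^sup>2 * C1" using C1 by simp
    fix f :: "real^'d \<Rightarrow> complex" assume f: "integrable lborel f"
    have [measurable]: "f \<in> borel_measurable borel" using f by auto
    let ?F = "inv_fourier f"
    let ?N = "\<integral>\<^sup>+x. ennreal ((norm (f x))\<^sup>2) \<partial>lborel"
    have Fb: "norm (?F x) \<le> c * (LINT x|lborel. norm (f x))" for x
      unfolding inv_fourier_eq norm_mult c_def[symmetric] using norm_fourier_le[of f "- x"] c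
      by (simp add: mult_left_mono)
    have R: "(\<integral>\<^sup>+x. ennreal ((norm (?F x))\<^sup>2 * (\<eta> (inverse R *\<^sub>R x))\<^sup>2) \<partial>lborel) \<le> ennreal (c\<^sup>2 * C1) * ?N"
      if R: "R > 0" for R
    proof -
      define kR where "kR x = k (inverse R *\<^sub>R x)" for x
      have [measurable]: "kR \<in> borel_measurable borel" unfolding kR_def by measurable
      have ikR: "integrable lborel kR"
        unfolding kR_def using integrable_lborel_affine[OF schwartz_integrable[OF k], of "inverse R" 0] R by simp
      define G where "G = fourier kR"
      have [measurable]: "G \<in> borel_measurable borel" unfolding G_def by measurable
      have G: "(\<integral>\<^sup>+\<xi>. ennreal (norm (G \<xi>)) \<partial>lborel) = ennreal C1"
      proof -
        have "(\<integral>\<^sup>+\<xi>. ennreal (norm (G \<xi>)) \<partial>lborel) = ennreal (R ^ CARD('d)) * (\<integral>\<^sup>+\<xi>. ennreal (norm (fourier k (R *\<^sub>R \<xi>))) \<partial>lborel)"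
          unfolding G_def kR_def using R
          by (subst fourier_scale) (auto simp: norm_mult norm_power ennreal_mult' nn_integral_cmult)
        then show ?thesis
          using nn_integral_lborel_affine[of "\<lambda>\<xi>. ennreal (norm (fourier k \<xi>))" R 0] R C1 by simp
      qed
      have G': "(\<integral>\<^sup>+\<xi>. ennreal (norm (G (\<zeta> - \<xi>))) \<partial>lborel) = ennreal C1" 
               "(\<integral>\<^sup>+\<xi>. ennreal (norm (G (\<xi> - \<zeta>))) \<partial>lborel) = ennreal C1" for \<zeta>
        using nn_integral_lborel_affine[of "\<lambda>\<xi>. ennreal (norm (G \<xi>))" "-1" \<zeta>]
           nn_integral_lborel_affine[of "\<lambda>\<xi>. ennreal (norm (G \<xi>))" 1 "-\<zeta>"] G by auto
      have Fx: "?F x = of_real c * (LINT \<xi>|lborel. cis (1 * (x \<bullet> \<xi>)) * f \<xi>)" for x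
        by (simp add: inv_fourier_def c_def)
      have cFx: "cnj (?F x) = of_real c * (LINT \<xi>|lborel. cis (-1 * (x \<bullet> \<xi>)) * cnj (f \<xi>))" for x
        using Bochner_Integration.integral_cnj[of lborel "\<lambda>\<xi>. cis (x \<bullet> \<xi>) * f \<xi>"]
        by (simp only: inv_fourier_def c_def complex_cnj_mult complex_cnj_complex_of_real) (simp add: cis_cnj)
      define g where "g x = cnj (?F x) * kR x" for x
      have g: "integrable lborel g"
      proof (rule Bochner_Integration.integrable_bound)
        show "integrable lborel (\<lambda>x. of_real (c * (LINT x|lborel. norm (f x))) * kR x)"
          using ikR by simp
        show "AE x in lborel. norm (g x) \<le> norm (of_real (c * (LINT x|lborel. norm (f x))) * kR x)"
          using Fb c by (auto simp: g_def norm_mult intro!: mult_right_mono intro: order_trans)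
      next
        have [measurable]: "cnj \<in> borel_measurable borel"
          by (intro borel_measurable_continuous_onI continuous_intros)
        show "g \<in> borel_measurable lborel" unfolding g_def[abs_def] by measurable
      qed
      \<comment> \<open>Multiplying by \<open>kR\<close> before transforming back turns the
        conjugate of f into its convolution with G, so the truncated energy becomes a bilinear form
        in f with kernel G(\<zeta> - \<xi>).\<close>
      have g_ft: "(LINT x|lborel. cis (1 * (x \<bullet> \<xi>)) * g x) = of_real c * (LINT \<zeta>|lborel. cnj (f \<zeta>) * G (\<zeta> - \<xi>))" for \<xi>
      proof -
        have inner: "(LINT x|lborel. cis (-1 * (x \<bullet> \<zeta>)) * (cis (x \<bullet> \<xi>) * kR x)) = G (\<zeta> - \<xi>)" for \<zeta>
          unfolding G_def fourier_def by (simp add: mult.assoc[symmetric] cis_mult inner_diff_right)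
        have "(LINT x|lborel. cis (1 * (x \<bullet> \<xi>)) * g x)
            = of_real c * (LINT x|lborel. (cis (x \<bullet> \<xi>) * kR x) * (LINT \<zeta>|lborel. cis (-1 * (x \<bullet> \<zeta>)) * cnj (f \<zeta>)))"
          unfolding g_def cFx by (subst integral_mult_right_zero[symmetric]) (simp add: mult_ac)
        also have "(LINT x|lborel. (cis (x \<bullet> \<xi>) * kR x) * (LINT \<zeta>|lborel. cis (-1 * (x \<bullet> \<zeta>)) * cnj (f \<zeta>)))
            = (LINT \<zeta>|lborel. cnj (f \<zeta>) * (LINT x|lborel. cis (-1 * (x \<bullet> \<zeta>)) * (cis (x \<bullet> \<xi>) * kR x)))"
          by (rule oscillatory_fubini) (use f ikR in \<open>auto intro!: integrable_cis_mult\<close>)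
        finally show ?thesis unfolding inner .
      qed
      have "complex_of_real (LINT x|lborel. (norm (?F x))\<^sup>2 * (\<eta> (inverse R *\<^sub>R x))\<^sup>2) = (LINT x|lborel. g x * ?F x)"
        by (subst integral_complex_of_real[symmetric], rule Bochner_Integration.integral_cong)
          (simp_all add: g_def kR_def k_def power2_eq_square[of "\<eta> _"] complex_norm_square[unfolded of_real_power] mult_ac)
      also have "\<dots> = of_real c * (LINT x|lborel. g x * (LINT \<xi>|lborel. cis (1 * (x \<bullet> \<xi>)) * f \<xi>))"
        unfolding Fx by (subst integral_mult_right_zero[symmetric]) (simp add: mult_ac)
      also have "\<dots> = of_real c * (LINT \<xi>|lborel. f \<xi> * (LINT x|lborel. cis (1 * (x \<bullet> \<xi>)) * g x))"
        using oscillatory_fubini[OF f g, of 1] by simp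
      also have "\<dots> = of_real (c\<^sup>2) * (LINT \<xi>|lborel. f \<xi> * (LINT \<zeta>|lborel. cnj (f \<zeta>) * G (\<zeta> - \<xi>)))"
        unfolding g_ft by (simp add: power2_eq_square mult.left_commute[of "f _" "of_real c"])
      finally have eq: "complex_of_real (LINT x|lborel. (norm (?F x))\<^sup>2 * (\<eta> (inverse R *\<^sub>R x))\<^sup>2) 
          = of_real (c\<^sup>2) * (LINT \<xi>|lborel. f \<xi> * (LINT \<zeta>|lborel. cnj (f \<zeta>) * G (\<zeta> - \<xi>)))" .
      have int: "integrable lborel (\<lambda>x. (norm (?F x))\<^sup>2 * (\<eta> (inverse R *\<^sub>R x))\<^sup>2)"
      proof (rule Bochner_Integration.integrable_bound)
        show "integrable lborel (\<lambda>x. (c * (LINT x|lborel. norm (f x)))\<^sup>2 *\<^sub>R kR x)" using ikR by simp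
        show "AE x in lborel. norm ((norm (?F x))\<^sup>2 * (\<eta> (inverse R *\<^sub>R x))\<^sup>2) \<le> norm ((c * (LINT x|lborel. norm (f x)))\<^sup>2 *\<^sub>R kR x)"
        proof (rule AE_I2)
          fix x
          have "(norm (?F x))\<^sup>2 \<le> (c * (LINT x|lborel. norm (f x)))\<^sup>2" using Fb by (intro power_mono) auto
          then show "norm ((norm (?F x))\<^sup>2 * (\<eta> (inverse R *\<^sub>R x))\<^sup>2) \<le> norm ((c * (LINT x|lborel. norm (f x)))\<^sup>2 *\<^sub>R kR x)"
            by (simp add: kR_def k_def norm_mult power2_eq_square[of "\<eta> _"] abs_mult mult_right_mono)
        qed
      qed measurable
      \<comment> \<open>Schur's test: the product of the two values of f is split by the
        arithmetic-geometric mean inequality. Each half is then integrated first in the variable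
        occurring only in G, whose integral is \<open>C1\<close> in either variable.\<close>
      let ?a = "\<lambda>\<xi> \<zeta>. ennreal (norm (f \<xi>)) * ennreal (norm (f \<zeta>)) * ennreal (norm (G (\<zeta> - \<xi>)))"
      let ?b = "\<lambda>\<xi> \<zeta>. ennreal ((norm (f \<xi>))\<^sup>2 / 2) * ennreal (norm (G (\<zeta> - \<xi>))) + ennreal ((norm (f \<zeta>))\<^sup>2 / 2) * ennreal (norm (G (\<zeta> - \<xi>)))"
      have half: "(\<integral>\<^sup>+\<xi>. ennreal ((norm (f \<xi>))\<^sup>2 / 2) * ennreal C1 \<partial>lborel) = ennreal (C1 / 2) * ?N"
        using C1(2) by (subst nn_integral_cmult[symmetric]) (auto intro!: nn_integral_cong simp: ennreal_mult'[symmetric] mult_ac)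
      have "(\<integral>\<^sup>+x. ennreal ((norm (?F x))\<^sup>2 * (\<eta> (inverse R *\<^sub>R x))\<^sup>2) \<partial>lborel) 
          = ennreal (norm (complex_of_real (LINT x|lborel. (norm (?F x))\<^sup>2 * (\<eta> (inverse R *\<^sub>R x))\<^sup>2)))"
        using int by (subst nn_integral_eq_integral) (auto simp: abs_of_nonneg)
      also have "\<dots> = ennreal (c\<^sup>2) * ennreal (norm (LINT \<xi>|lborel. f \<xi> * (LINT \<zeta>|lborel. cnj (f \<zeta>) * G (\<zeta> - \<xi>))))"
        unfolding eq norm_mult using c by (simp add: ennreal_mult' norm_power)
      also have "\<dots> \<le> ennreal (c\<^sup>2) * (\<integral>\<^sup>+\<xi>. \<integral>\<^sup>+\<zeta>. ?a \<xi> \<zeta> \<partial>lborel \<partial>lborel)"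
      proof (intro mult_left_mono order_trans[OF norm_integral_le_nn_integral] nn_integral_mono)
        fix \<xi>
        have "ennreal (norm (f \<xi> * (LINT \<zeta>|lborel. cnj (f \<zeta>) * G (\<zeta> - \<xi>))))
            \<le> ennreal (norm (f \<xi>)) * (\<integral>\<^sup>+\<zeta>. ennreal (norm (cnj (f \<zeta>) * G (\<zeta> - \<xi>))) \<partial>lborel)"
          by (simp only: norm_mult ennreal_mult' norm_ge_zero) (intro mult_left_mono order_trans[OF norm_integral_le_nn_integral], auto simp: norm_mult ennreal_mult)
        also have "\<dots> = (\<integral>\<^sup>+\<zeta>. ?a \<xi> \<zeta> \<partial>lborel)"
          by (subst nn_integral_cmult[symmetric]) (auto simp: norm_mult ennreal_mult' mult_ac)
        finally show "ennreal (norm (f \<xi> * (LINT \<zeta>|lborel. cnj (f \<zeta>) * G (\<zeta> - \<xi>)))) \<le> (\<integral>\<^sup>+\<zeta>. ?a \<xi> \<zeta> \<partial>lborel)" .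
      qed auto
      also have "(\<integral>\<^sup>+\<xi>. \<integral>\<^sup>+\<zeta>. ?a \<xi> \<zeta> \<partial>lborel \<partial>lborel) \<le> (\<integral>\<^sup>+\<xi>. \<integral>\<^sup>+\<zeta>. ?b \<xi> \<zeta> \<partial>lborel \<partial>lborel)"
      proof (intro nn_integral_mono)
        fix \<xi> \<zeta>
        have "norm (f \<xi>) * norm (f \<zeta>) \<le> (norm (f \<xi>))\<^sup>2 / 2 + (norm (f \<zeta>))\<^sup>2 / 2"
          using sum_squares_bound[of "norm (f \<xi>)" "norm (f \<zeta>)"] by simp
        then show "?a \<xi> \<zeta> \<le> ?b \<xi> \<zeta>"
          unfolding distrib_right[symmetric]
          by (intro mult_right_mono) (auto simp: ennreal_mult'[symmetric] ennreal_plus[symmetric] simp del: ennreal_plus intro!: ennreal_leI)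
      qed
      also have "\<dots> = (\<integral>\<^sup>+\<xi>. \<integral>\<^sup>+\<zeta>. ennreal ((norm (f \<xi>))\<^sup>2 / 2) * ennreal (norm (G (\<zeta> - \<xi>))) \<partial>lborel \<partial>lborel) 
          + (\<integral>\<^sup>+\<xi>. \<integral>\<^sup>+\<zeta>. ennreal ((norm (f \<zeta>))\<^sup>2 / 2) * ennreal (norm (G (\<zeta> - \<xi>))) \<partial>lborel \<partial>lborel)"
        by (simp add: nn_integral_add)
      also have "(\<integral>\<^sup>+\<xi>. \<integral>\<^sup>+\<zeta>. ennreal ((norm (f \<zeta>))\<^sup>2 / 2) * ennreal (norm (G (\<zeta> - \<xi>))) \<partial>lborel \<partial>lborel)
          = (\<integral>\<^sup>+\<zeta>. \<integral>\<^sup>+\<xi>. ennreal ((norm (f \<zeta>))\<^sup>2 / 2) * ennreal (norm (G (\<zeta> - \<xi>))) \<partial>lborel \<partial>lborel)"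
        by (rule lborel_pair.Fubini') measurable
      also have "\<dots> = ennreal (C1 / 2) * ?N"
        by (subst nn_integral_cmult) (auto simp: G' half)
      also have "(\<integral>\<^sup>+\<xi>. \<integral>\<^sup>+\<zeta>. ennreal ((norm (f \<xi>))\<^sup>2 / 2) * ennreal (norm (G (\<zeta> - \<xi>))) \<partial>lborel \<partial>lborel) = ennreal (C1 / 2) * ?N"
        by (subst nn_integral_cmult) (auto simp: G' half)
      also have "ennreal (c\<^sup>2) * (ennreal (C1 / 2) * ?N + ennreal (C1 / 2) * ?N) = ennreal (c\<^sup>2 * C1) * ?N"
        using C1(2) by (simp add: distrib_right[symmetric] ennreal_plus[symmetric] ennreal_mult' mult.assoc del: ennreal_plus)
      finally show ?thesis by (simp add: mult_left_mono)
    qed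
    show "(\<integral>\<^sup>+x. ennreal ((norm (?F x))\<^sup>2) \<partial>lborel) \<le> ennreal (c\<^sup>2 * C1) * ?N"
    \<comment> \<open>Fatou's lemma as R = k + 1 grows: at each x the rescaled cutoff is eventually
      1, and the bound does not depend on R.\<close>
    proof (rule nn_integral_limit_le)
      show "(\<integral>\<^sup>+x. ennreal ((norm (?F x))\<^sup>2 * (\<eta> (inverse (real (Suc k)) *\<^sub>R x))\<^sup>2) \<partial>lborel) \<le> ennreal (c\<^sup>2 * C1) * ?N" for k
        by (rule R) simp
      show "AE x in lborel. (\<lambda>k. ennreal ((norm (?F x))\<^sup>2 * (\<eta> (inverse (real (Suc k)) *\<^sub>R x))\<^sup>2)) \<longlonglongrightarrow> ennreal ((norm (?F x))\<^sup>2)"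
      proof (intro AE_I2 tendsto_eventually)
        fix x :: "real^'d"
        obtain k0 :: nat where k0: "norm x \<le> real k0" using real_arch_simple by blast
        have "\<eta> (inverse (real (Suc k)) *\<^sub>R x) = 1" if "k \<ge> k0" for k
        proof (rule cutoff_eq_1[OF \<eta>])
          fix i
          have "\<bar>x $ i\<bar> \<le> real (Suc k)" using component_le_norm_cart[of x i] k0 that by simp
          then show "\<bar>(inverse (real (Suc k)) *\<^sub>R x) $ i\<bar> \<le> 1" by (simp add: abs_mult field_simps)
        qed
        then show "\<forall>\<^sub>F k in sequentially. ennreal ((norm (?F x))\<^sup>2 * (\<eta> (inverse (real (Suc k)) *\<^sub>R x))\<^sup>2) = ennreal ((norm (?F x))\<^sup>2)"
          by (auto simp: eventually_sequentially intro!: exI[of _ k0])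
      qed
    qed measurable
  qed
qed

section \<open>Linear evolution of a single mode\<close>

text \<open>The transform of the rescaled cutoff, a bump of height of order
  \<open>bracket T ^ CARD('d)\<close> and width 1 / \<open>bracket T\<close>. Translated by
  \<open>freq n\<close> it is the transform of the cut off character of frequency n.\<close>

definition window :: "(real^'d::finite \<Rightarrow> real) \<Rightarrow> real \<Rightarrow> real^'d \<Rightarrow> complex" where
  "window \<eta> T = fourier (\<lambda>x. of_real (rescale \<eta> T x))"

text \<open>The Fourier multiplier \<open>m\<close> applied to \<open>\<eta>\<^sub>T\<close> times the character of frequency \<open>n\<close>.\<close>

definition atom :: "(real^'d::finite \<Rightarrow> real) \<Rightarrow> real \<Rightarrow> (real^'d \<Rightarrow> complex) \<Rightarrow> int^'d \<Rightarrow> real^'d \<Rightarrow> complex" where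
  "atom \<eta> T m n = inv_fourier (\<lambda>\<xi>. m \<xi> * window \<eta> T (\<xi> - freq n))"

lemma schwartz_rescale: "cutoff \<eta> \<Longrightarrow> schwartz (\<lambda>x. complex_of_real (rescale \<eta> T x))"
  using schwartz_cutoff_mult[of \<eta> "\<lambda>x. 1" "inverse (bracket T)"] smooth_const[of 1]
  by (simp add: rescale_def)

lemma window_measurable [measurable]: "cutoff \<eta> \<Longrightarrow> window \<eta> T \<in> borel_measurable borel"
  unfolding window_def by (intro fourier_measurable schwartz_measurable schwartz_rescale)

lemma window_eq:
  fixes \<eta> :: "real^'d::finite \<Rightarrow> real"
  assumes "cutoff \<eta>"
  shows "window \<eta> T \<xi> = of_real (bracket T ^ CARD('d)) * fourier (\<lambda>x. of_real (\<eta> x)) (bracket T *\<^sub>R \<xi>)"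
  unfolding window_def rescale_def
  by (intro fourier_scale schwartz_measurable schwartz_cutoff assms bracket_pos)

lemma bracket_scale_le: "1 \<le> c \<Longrightarrow> bracket x \<le> bracket (c *\<^sub>R x)"
  by (simp add: bracket_def mult_right_mono[of 1 c "norm x", simplified])

text \<open>Height \<open>bracket T ^ CARD('d)\<close> and width 1 / \<open>bracket T\<close> cancel
  in the integral and leave one factor \<open>bracket T ^ CARD('d)\<close> in the integral of the
  square. The weight only improves under dilation, because \<open>bracket T\<close> is at least
  1.\<close>

lemma window_weights:
  fixes \<eta> :: "real^'d::finite \<Rightarrow> real"
  assumes \<eta>: "cutoff \<eta>"
  obtains C where "C \<ge> 0"
    "\<And>T. (\<integral>\<^sup>+\<xi>. ennreal (bracket \<xi> ^ N * norm (window \<eta> T \<xi>)) \<partial>lborel) \<le> ennreal C"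
    "\<And>T. (\<integral>\<^sup>+\<xi>. ennreal ((bracket \<xi> ^ N * norm (window \<eta> T \<xi>))\<^sup>2) \<partial>lborel) \<le> ennreal (C * bracket T ^ CARD('d))"
proof -
  let ?e = "fourier (\<lambda>x. complex_of_real (\<eta> x))"
  have [measurable]: "?e \<in> borel_measurable borel"
    by (intro fourier_measurable schwartz_measurable schwartz_cutoff \<eta>)
  define h where "h \<xi> = bracket \<xi> ^ N * norm (?e \<xi>)" for \<xi>
  have h0: "0 \<le> h \<xi>" for \<xi> by (simp add: h_def)
  have [measurable]: "h \<in> borel_measurable borel" unfolding h_def[abs_def] by measurable
  obtain D where D: "D \<ge> 0" "\<And>\<xi>. norm (?e \<xi>) \<le> D / bracket \<xi> ^ (N + Suc CARD('d))"
    using fourier_decay[OF schwartz_cutoff[OF \<eta>]] by blast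
  have hb: "h \<xi> \<le> D / bracket \<xi> ^ Suc CARD('d)" for \<xi>
  proof -
    have "h \<xi> \<le> bracket \<xi> ^ N * (D / bracket \<xi> ^ (N + Suc CARD('d)))"
      unfolding h_def by (intro mult_left_mono D) auto
    then show ?thesis by (simp add: power_add)
  qed
  have hD: "h \<xi> \<le> D" for \<xi>
  proof -
    have "D / bracket \<xi> ^ Suc CARD('d) \<le> D / 1"
      by (intro divide_left_mono one_le_power D bracket_ge_1) auto
    then show ?thesis using hb[of \<xi>] by simp
  qed
  have i1: "integrable lborel h"
    by (rule integrable_bracket_dominated[where N = "Suc CARD('d)" and C = D]) (use hb h0 in auto)
  have i2: "integrable lborel (\<lambda>\<xi>. (h \<xi>)\<^sup>2)"
  proof (rule integrable_bracket_dominated[where N = "Suc CARD('d)" and C = "D * D"])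
    fix \<xi>
    have "h \<xi> * h \<xi> \<le> D * (D / bracket \<xi> ^ Suc CARD('d))"
      by (intro mult_mono hb hD h0 D)
    then show "norm ((h \<xi>)\<^sup>2) \<le> D * D / bracket \<xi> ^ Suc CARD('d)" by (simp add: power2_eq_square)
  qed auto
  let ?I1 = "LINT \<xi>|lborel. h \<xi>" and ?I2 = "LINT \<xi>|lborel. (h \<xi>)\<^sup>2"
  have I: "0 \<le> ?I1" "0 \<le> ?I2" using h0 by auto
  have w: "bracket \<xi> ^ N * norm (window \<eta> T \<xi>) \<le> bracket T ^ CARD('d) * h (bracket T *\<^sub>R \<xi>)" for T \<xi>
  proof -
    have "bracket \<xi> ^ N * norm (window \<eta> T \<xi>) = bracket T ^ CARD('d) * (bracket \<xi> ^ N * norm (?e (bracket T *\<^sub>R \<xi>)))"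
      by (simp add: window_eq[OF \<eta>] norm_mult norm_power)
    also have "\<dots> \<le> bracket T ^ CARD('d) * h (bracket T *\<^sub>R \<xi>)"
      unfolding h_def by (intro mult_left_mono mult_right_mono power_mono bracket_scale_le bracket_ge_1) auto
    finally show ?thesis .
  qed
  have sc: "(\<integral>\<^sup>+\<xi>. ennreal (c * f (bracket T *\<^sub>R \<xi>)) \<partial>lborel) = ennreal (c / bracket T ^ CARD('d) * (LINT \<xi>|lborel. f \<xi>))"
    if f: "integrable lborel f" "\<And>\<xi>. 0 \<le> f \<xi>" and c: "c \<ge> 0" for f :: "real^'d \<Rightarrow> real" and c T :: real
  proof -
    have [measurable]: "f \<in> borel_measurable borel" using f by auto
    let ?t = "bracket T ^ CARD('d)"
    have "ennreal (LINT \<xi>|lborel. f \<xi>) = ennreal ?t * (\<integral>\<^sup>+\<xi>. ennreal (f (bracket T *\<^sub>R \<xi>)) \<partial>lborel)"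
      using nn_integral_lborel_affine[of "\<lambda>\<xi>. ennreal (f \<xi>)" "bracket T" 0] f
      by (subst nn_integral_eq_integral[symmetric]) auto
    then have "ennreal (c / ?t) * ennreal (LINT \<xi>|lborel. f \<xi>) = ennreal (c / ?t) * ennreal ?t * (\<integral>\<^sup>+\<xi>. ennreal (f (bracket T *\<^sub>R \<xi>)) \<partial>lborel)"
      by (simp add: mult.assoc)
    also have "ennreal (c / ?t) * ennreal ?t = ennreal c"
      using c by (subst ennreal_mult[symmetric]) auto
    also have "ennreal c * (\<integral>\<^sup>+\<xi>. ennreal (f (bracket T *\<^sub>R \<xi>)) \<partial>lborel) = (\<integral>\<^sup>+\<xi>. ennreal (c * f (bracket T *\<^sub>R \<xi>)) \<partial>lborel)"
      using c f by (subst nn_integral_cmult[symmetric]) (auto simp: ennreal_mult)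
    also have "ennreal (c / ?t) * ennreal (LINT \<xi>|lborel. f \<xi>) = ennreal (c / ?t * (LINT \<xi>|lborel. f \<xi>))"
      using c f by (subst ennreal_mult) auto
    finally show ?thesis by (rule sym)
  qed
  show ?thesis
  proof (rule that[of "?I1 + ?I2"])
    show "0 \<le> ?I1 + ?I2" using I by simp
    fix T :: real
    let ?t = "bracket T ^ CARD('d)"
    have "(\<integral>\<^sup>+\<xi>. ennreal (bracket \<xi> ^ N * norm (window \<eta> T \<xi>)) \<partial>lborel) \<le> (\<integral>\<^sup>+\<xi>. ennreal (?t * h (bracket T *\<^sub>R \<xi>)) \<partial>lborel)"
      by (intro nn_integral_mono ennreal_leI w)
    also have "\<dots> = ennreal ?I1" using sc[OF i1 h0, of ?t T] by simp
    also have "\<dots> \<le> ennreal (?I1 + ?I2)" using I by (intro ennreal_leI) auto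
    finally show "(\<integral>\<^sup>+\<xi>. ennreal (bracket \<xi> ^ N * norm (window \<eta> T \<xi>)) \<partial>lborel) \<le> ennreal (?I1 + ?I2)" .
    have "(\<integral>\<^sup>+\<xi>. ennreal ((bracket \<xi> ^ N * norm (window \<eta> T \<xi>))\<^sup>2) \<partial>lborel) \<le> (\<integral>\<^sup>+\<xi>. ennreal (?t\<^sup>2 * (h (bracket T *\<^sub>R \<xi>))\<^sup>2) \<partial>lborel)"
      unfolding power_mult_distrib[symmetric] by (intro nn_integral_mono ennreal_leI power_mono w) auto
    also have "\<dots> = ennreal (?t * ?I2)" using sc[OF i2, of "?t\<^sup>2" T] by (simp add: power2_eq_square)
    also have "\<dots> \<le> ennreal ((?I1 + ?I2) * ?t)" using I by (intro ennreal_leI) (simp add: algebra_simps)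
    finally show "(\<integral>\<^sup>+\<xi>. ennreal ((bracket \<xi> ^ N * norm (window \<eta> T \<xi>))\<^sup>2) \<partial>lborel) \<le> ennreal ((?I1 + ?I2) * ?t)" .
  qed
qed

text \<open>The supremum is bounded by the integral of symbol times window, the square integral by
  \<open>plancherel_le\<close>. The symbol may grow polynomially away from \<open>freq n\<close>
  because the window decays faster; only its size B relative to \<open>freq n\<close> survives. The
  constant W + P * W serves both bounds at once.\<close>

lemma atom_bounds:
  fixes \<eta> :: "real^'d::finite \<Rightarrow> real"
  assumes \<eta>: "cutoff \<eta>"
  obtains C where "C \<ge> 0"
    "\<And>T m n B. m \<in> borel_measurable borel \<Longrightarrow> B \<ge> 0 \<Longrightarrow> (\<And>\<xi>. norm (m \<xi>) \<le> B * bracket (\<xi> - freq n) ^ N) \<Longrightarrow>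
       integrable lborel (\<lambda>\<xi>. m \<xi> * window \<eta> T (\<xi> - freq n)) \<and>
       (\<forall>x. norm (atom \<eta> T m n x) \<le> C * B) \<and>
       (\<integral>\<^sup>+x. ennreal ((norm (atom \<eta> T m n x))\<^sup>2) \<partial>lborel) \<le> ennreal (C * bracket T ^ CARD('d) * B\<^sup>2)"
proof -
  obtain W where W: "W \<ge> 0"
    "\<And>T. (\<integral>\<^sup>+\<xi>. ennreal (bracket \<xi> ^ N * norm (window \<eta> T \<xi>)) \<partial>lborel) \<le> ennreal W"
    "\<And>T. (\<integral>\<^sup>+\<xi>. ennreal ((bracket \<xi> ^ N * norm (window \<eta> T \<xi>))\<^sup>2) \<partial>lborel) \<le> ennreal (W * bracket T ^ CARD('d))"
    using window_weights[OF \<eta>, of N] by blast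
  obtain P where P: "P \<ge> 0" 
    "\<And>f :: real^'d \<Rightarrow> complex. integrable lborel f \<Longrightarrow>
      (\<integral>\<^sup>+x. ennreal ((norm (inv_fourier f x))\<^sup>2) \<partial>lborel) \<le> ennreal P * (\<integral>\<^sup>+x. ennreal ((norm (f x))\<^sup>2) \<partial>lborel)"
    using plancherel_le[OF \<eta>] by blast
  have [measurable]: "window \<eta> T \<in> borel_measurable borel" for T using \<eta> by measurable
  show ?thesis
  proof (rule that[of "W + P * W"])
    show "0 \<le> W + P * W" using W P by simp
    fix T B :: real and m :: "real^'d \<Rightarrow> complex" and n :: "int^'d" assume [measurable]: "m \<in> borel_measurable borel" and B: "B \<ge> 0"
      and m: "\<And>\<xi>. norm (m \<xi>) \<le> B * bracket (\<xi> - freq n) ^ N"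
    let ?f = "\<lambda>\<xi>. m \<xi> * window \<eta> T (\<xi> - freq n)"
    let ?h = "\<lambda>\<xi>. bracket \<xi> ^ N * norm (window \<eta> T \<xi>)"
    have f: "norm (?f \<xi>) \<le> B * ?h (\<xi> - freq n)" for \<xi>
      using mult_right_mono[OF m[of \<xi>], of "norm (window \<eta> T (\<xi> - freq n))"] by (simp add: norm_mult mult.assoc)
    have sh: "(\<integral>\<^sup>+\<xi>. u (\<xi> - freq n) \<partial>lborel) = (\<integral>\<^sup>+\<xi>. u \<xi> \<partial>lborel)" if [measurable]: "u \<in> borel_measurable borel" for u :: "real^'d \<Rightarrow> ennreal"
      using nn_integral_lborel_affine[of u 1 "- freq n"] by simp
    have "(\<integral>\<^sup>+\<xi>. ennreal (norm (?f \<xi>)) \<partial>lborel) \<le> (\<integral>\<^sup>+\<xi>. ennreal (B * ?h (\<xi> - freq n)) \<partial>lborel)"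
      by (intro nn_integral_mono ennreal_leI f)
    also have "\<dots> = ennreal B * (\<integral>\<^sup>+\<xi>. ennreal (?h (\<xi> - freq n)) \<partial>lborel)"
      using B by (subst nn_integral_cmult[symmetric]) (auto simp: ennreal_mult)
    also have "\<dots> \<le> ennreal B * ennreal W"
      using W(2)[of T] by (subst sh) (auto intro!: mult_left_mono)
    finally have 1: "(\<integral>\<^sup>+\<xi>. ennreal (norm (?f \<xi>)) \<partial>lborel) \<le> ennreal (B * W)" using B W by (simp add: ennreal_mult)
    then have int: "integrable lborel ?f"
      by (intro integrableI_bounded) (auto intro: le_less_trans)
    have "(\<integral>\<^sup>+\<xi>. ennreal ((norm (?f \<xi>))\<^sup>2) \<partial>lborel) \<le> (\<integral>\<^sup>+\<xi>. ennreal ((B * ?h (\<xi> - freq n))\<^sup>2) \<partial>lborel)"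
      by (intro nn_integral_mono ennreal_leI f power_mono) auto
    also have "\<dots> = ennreal (B\<^sup>2) * (\<integral>\<^sup>+\<xi>. ennreal ((?h (\<xi> - freq n))\<^sup>2) \<partial>lborel)"
      unfolding power_mult_distrib[of B] using B by (subst nn_integral_cmult[symmetric]) (auto simp: ennreal_mult)
    also have "\<dots> \<le> ennreal (B\<^sup>2) * ennreal (W * bracket T ^ CARD('d))"
      using W(3)[of T] by (subst sh) (auto intro!: mult_left_mono)
    finally have 2: "(\<integral>\<^sup>+\<xi>. ennreal ((norm (?f \<xi>))\<^sup>2) \<partial>lborel) \<le> ennreal (B\<^sup>2 * (W * bracket T ^ CARD('d)))"
      using B W by (simp add: ennreal_mult)
    have "(\<integral>\<^sup>+x. ennreal ((norm (atom \<eta> T m n x))\<^sup>2) \<partial>lborel) \<le> ennreal P * ennreal (B\<^sup>2 * (W * bracket T ^ CARD('d)))"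
      unfolding atom_def by (intro order_trans[OF P(2)[OF int]] mult_left_mono 2) auto
    also have "\<dots> = ennreal (P * (B\<^sup>2 * (W * bracket T ^ CARD('d))))"
      using P by (simp add: ennreal_mult')
    also have "\<dots> \<le> ennreal ((W + P * W) * bracket T ^ CARD('d) * B\<^sup>2)"
      using W P by (intro ennreal_leI) (simp add: algebra_simps)
    finally have 3: "(\<integral>\<^sup>+x. ennreal ((norm (atom \<eta> T m n x))\<^sup>2) \<partial>lborel) \<le> ennreal ((W + P * W) * bracket T ^ CARD('d) * B\<^sup>2)" .
    have "norm (atom \<eta> T m n x) \<le> (W + P * W) * B" for x
    proof -
      have "(2 * pi) ^ CARD('d) \<ge> 1" using pi_gt3 by (intro one_le_power) auto
      then have "norm (atom \<eta> T m n x) \<le> 1 * norm (fourier ?f (- x))"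
        unfolding atom_def inv_fourier_eq norm_mult norm_of_real by (intro mult_right_mono) auto
      also have "\<dots> \<le> (LINT \<xi>|lborel. norm (?f \<xi>))" using norm_fourier_le[of ?f "- x"] by simp
      also have "\<dots> \<le> B * W"
      proof -
        have "ennreal (LINT \<xi>|lborel. norm (?f \<xi>)) \<le> ennreal (B * W)"
          using 1 int by (subst nn_integral_eq_integral[symmetric]) auto
        then show ?thesis using B W by (simp add: ennreal_le_iff)
      qed
      also have "\<dots> \<le> (W + P * W) * B" using B W P by (simp add: algebra_simps)
      finally show ?thesis .
    qed
    with int 3 show "integrable lborel ?f \<and> (\<forall>x. norm (atom \<eta> T m n x) \<le> (W + P * W) * B) \<and>
       (\<integral>\<^sup>+x. ennreal ((norm (atom \<eta> T m n x))\<^sup>2) \<partial>lborel) \<le> ennreal ((W + P * W) * bracket T ^ CARD('d) * B\<^sup>2)"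
      by blast
  qed
qed

text \<open>Two applications of \<open>oscillatory_fubini\<close> carry the multiplier from the test
  function to the mode. The pairing is then an integral of \<open>inv_fourier \<phi>\<close>,
  concentrated near 0, against a window concentrated near \<open>freq n\<close>; by the triangle
  inequality for brackets one of the two is small, which gives decay of any order in n. This beats
  the polynomial growth of the random coefficients.\<close>

lemma atom_pairing:
  fixes \<eta> :: "real^'d::finite \<Rightarrow> real"
  assumes \<eta>: "cutoff \<eta>" and [measurable]: "m \<in> borel_measurable borel" and B: "\<And>\<xi>. norm (m \<xi>) \<le> B"
    and \<phi>: "schwartz \<phi>"
  shows "(LINT x|lborel. cis (freq n \<bullet> x) * (of_real (rescale \<eta> T x) * fourier (\<lambda>\<xi>. m \<xi> * inv_fourier \<phi> \<xi>) x))
        = (LINT x|lborel. atom \<eta> T m n x * \<phi> x)" (is "?L = ?R")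
    and "\<exists>C\<ge>0. \<forall>n. norm (LINT x|lborel. atom \<eta> T m n x * \<phi> x) \<le> C / bracket (freq n) ^ N"
proof -
  let ?w = "window \<eta> T"
  have [measurable]: "?w \<in> borel_measurable borel" using \<eta> by measurable
  have [measurable]: "\<phi> \<in> borel_measurable borel" by (rule schwartz_measurable[OF \<phi>])
  have B0: "B \<ge> 0" using B norm_ge_zero order_trans by blast
  obtain D where D: "D \<ge> 0" "\<And>\<xi>. norm (inv_fourier \<phi> \<xi>) \<le> D / bracket \<xi> ^ (N + Suc CARD('d))"
    using inv_fourier_decay[OF \<phi>] by blast
  obtain K where K: "K \<ge> 0" "\<And>\<xi>. norm (?w \<xi>) \<le> K / bracket \<xi> ^ N"
    unfolding window_def using fourier_decay[OF schwartz_rescale[OF \<eta>]] by blast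
  obtain K' where K': "K' \<ge> 0" "\<And>\<xi>. norm (?w \<xi>) \<le> K' / bracket \<xi> ^ Suc CARD('d)"
    unfolding window_def using fourier_decay[OF schwartz_rescale[OF \<eta>]] by blast
  let ?f = "\<lambda>\<xi>. m \<xi> * inv_fourier \<phi> \<xi>"
  have fb: "norm (?f \<xi>) \<le> (B * D) / bracket \<xi> ^ (N + Suc CARD('d))" for \<xi>
    using mult_mono[OF B[of \<xi>] D(2)[of \<xi>]] B0 by (simp add: norm_mult)
  have f: "integrable lborel ?f"
    by (rule integrable_bracket_dominated[OF _ _ fb]) auto
  have w: "integrable lborel (\<lambda>\<xi>. m \<xi> * ?w (\<xi> - freq n))" for n
  proof (rule Bochner_Integration.integrable_bound)
    have "integrable lborel ?w"
      by (rule integrable_bracket_dominated[OF _ _ K'(2)]) auto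
    then show "integrable lborel (\<lambda>\<xi>. B *\<^sub>R ?w (\<xi> - freq n))"
      using integrable_lborel_affine[of ?w 1 "- freq n"] by simp
    show "AE \<xi> in lborel. norm (m \<xi> * ?w (\<xi> - freq n)) \<le> norm (B *\<^sub>R ?w (\<xi> - freq n))"
      using B B0 by (auto simp: norm_mult intro!: mult_right_mono)
  qed measurable
  let ?c = "complex_of_real (1 / (2 * pi) ^ CARD('d))"
  have 1: "(LINT x|lborel. cis (freq n \<bullet> x) * (of_real (rescale \<eta> T x) * fourier ?f x)) = (LINT \<xi>|lborel. ?f \<xi> * ?w (\<xi> - freq n))" for n
  proof -
    have inner: "(LINT x|lborel. cis (- 1 * (x \<bullet> \<xi>)) * (cis (freq n \<bullet> x) * of_real (rescale \<eta> T x))) = ?w (\<xi> - freq n)" for \<xi>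
      unfolding window_def fourier_def 
      by (simp add: mult.assoc[symmetric] cis_mult inner_diff_right inner_commute[of "freq n"])
    have "(LINT x|lborel. cis (freq n \<bullet> x) * (of_real (rescale \<eta> T x) * fourier ?f x))
        = (LINT x|lborel. (cis (freq n \<bullet> x) * of_real (rescale \<eta> T x)) * (LINT \<xi>|lborel. cis (- 1 * (x \<bullet> \<xi>)) * ?f \<xi>))"
      by (simp add: fourier_def mult.assoc inner_commute)
    also have "\<dots> = (LINT \<xi>|lborel. ?f \<xi> * (LINT x|lborel. cis (- 1 * (x \<bullet> \<xi>)) * (cis (freq n \<bullet> x) * of_real (rescale \<eta> T x))))"
      by (rule oscillatory_fubini[OF f], intro integrable_cis_mult schwartz_integrable schwartz_rescale \<eta>) auto
    finally show ?thesis unfolding inner .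
  qed
  have 2: "(LINT \<xi>|lborel. ?f \<xi> * ?w (\<xi> - freq n)) = (LINT x|lborel. atom \<eta> T m n x * \<phi> x)" for n
  proof -
    have "(LINT \<xi>|lborel. ?f \<xi> * ?w (\<xi> - freq n)) 
        = ?c * (LINT \<xi>|lborel. (m \<xi> * ?w (\<xi> - freq n)) * (LINT x|lborel. cis (1 * (\<xi> \<bullet> x)) * \<phi> x))"
      unfolding inv_fourier_def by (subst integral_mult_right_zero[symmetric]) (simp add: mult_ac)
    also have "(LINT \<xi>|lborel. (m \<xi> * ?w (\<xi> - freq n)) * (LINT x|lborel. cis (1 * (\<xi> \<bullet> x)) * \<phi> x))
        = (LINT x|lborel. \<phi> x * (LINT \<xi>|lborel. cis (1 * (\<xi> \<bullet> x)) * (m \<xi> * ?w (\<xi> - freq n))))"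
      by (rule oscillatory_fubini[OF schwartz_integrable[OF \<phi>] w])
    also have "?c * \<dots> = (LINT x|lborel. atom \<eta> T m n x * \<phi> x)"
      unfolding atom_def inv_fourier_def 
      by (subst integral_mult_right_zero[symmetric]) (simp add: mult_ac inner_commute)
    finally show ?thesis .
  qed
  show "?L = ?R" using 1 2 by simp
  let ?I = "LINT \<xi>|lborel. 1 / bracket (\<xi> :: real^'d) ^ Suc CARD('d)"
  have "norm (LINT x|lborel. atom \<eta> T m n x * \<phi> x) \<le> (B * D * K * ?I) / bracket (freq n) ^ N" for n
  proof -
    have "norm (LINT x|lborel. atom \<eta> T m n x * \<phi> x) \<le> (LINT \<xi>|lborel. norm (?f \<xi> * ?w (\<xi> - freq n)))"
      unfolding 2[symmetric] by (rule integral_norm_bound)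
    also have "\<dots> \<le> (LINT \<xi>|lborel. (B * D * K / bracket (freq n) ^ N) * (1 / bracket (\<xi> :: real^'d) ^ Suc CARD('d)))"
    proof (rule integral_mono_AE')
      show "integrable lborel (\<lambda>\<xi>::real^'d. (B * D * K / bracket (freq n) ^ N) * (1 / bracket \<xi> ^ Suc CARD('d)))"
        by (intro integrable_mult_right integrable_bracket_power) auto
      show "AE \<xi> in lborel. norm (?f \<xi> * ?w (\<xi> - freq n)) \<le> (B * D * K / bracket (freq n) ^ N) * (1 / bracket (\<xi> :: real^'d) ^ Suc CARD('d))"
      proof (rule AE_I2)
        fix \<xi> :: "real^'d"
        have "bracket (freq n) ^ N \<le> (bracket \<xi> * bracket (freq n - \<xi>)) ^ N"
          by (intro power_mono bracket_triangle) auto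
        moreover have "bracket (freq n - \<xi>) = bracket (\<xi> - freq n)" by (metis bracket_minus minus_diff_eq)
        ultimately have t: "1 / (bracket \<xi> ^ N * bracket (\<xi> - freq n) ^ N) \<le> 1 / bracket (freq n) ^ N"
          by (intro divide_left_mono) (auto simp: power_mult_distrib)
        have "norm (?f \<xi> * ?w (\<xi> - freq n)) \<le> (B * D) / bracket \<xi> ^ (N + Suc CARD('d)) * (K / bracket (\<xi> - freq n) ^ N)"
          unfolding norm_mult[of "?f \<xi>"] using B0 D by (intro mult_mono fb K) auto
        also have "\<dots> = B * D * K * (1 / bracket \<xi> ^ Suc CARD('d)) * (1 / (bracket \<xi> ^ N * bracket (\<xi> - freq n) ^ N))"
          by (simp add: power_add field_simps)
        also have "\<dots> \<le> B * D * K * (1 / bracket \<xi> ^ Suc CARD('d)) * (1 / bracket (freq n) ^ N)"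
          using B0 D K by (intro mult_left_mono t) auto
        finally show "norm (?f \<xi> * ?w (\<xi> - freq n)) \<le> (B * D * K / bracket (freq n) ^ N) * (1 / bracket \<xi> ^ Suc CARD('d))"
          by (simp add: field_simps)
      qed
    qed (use B0 D K in auto)
    also have "\<dots> = (B * D * K * ?I) / bracket (freq n) ^ N"
      by (subst integral_mult_right_zero) simp
    finally show ?thesis .
  qed
  moreover have "0 \<le> B * D * K * ?I"
    using B0 D K by (intro mult_nonneg_nonneg integral_nonneg_AE) auto
  ultimately show "\<exists>C\<ge>0. \<forall>n. norm (LINT x|lborel. atom \<eta> T m n x * \<phi> x) \<le> C / bracket (freq n) ^ N"
    by blast
qed

lemma atom_measurable_pair:
  fixes \<eta> :: "real^'d::finite \<Rightarrow> real"
  assumes \<eta>: "cutoff \<eta>" and [measurable]: "(\<lambda>(t, \<xi>). m t \<xi>) \<in> borel_measurable (N \<Otimes>\<^sub>M borel)"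
  shows "(\<lambda>(t, x). atom \<eta> T (m t) n x) \<in> borel_measurable (N \<Otimes>\<^sub>M borel)"
proof -
  have [measurable]: "window \<eta> T \<in> borel_measurable borel" using \<eta> by measurable
  show ?thesis unfolding atom_def inv_fourier_def by measurable
qed

section \<open>Bounds for the symbols of the wave propagator\<close>

lemma cos_symbol_bound: "norm (cos_symbol t \<xi>) \<le> 1"
  by (simp add: cos_symbol_def)

lemma sinc_symbol_bound: 
  assumes t: "t \<ge> 0" shows "norm (sinc_symbol t \<xi>) \<le> t"
proof (cases "\<xi> = 0")
  case False
  have "\<bar>sin (t * norm \<xi>)\<bar> \<le> \<bar>t * norm \<xi>\<bar>" by (rule abs_sin_x_le_abs_x) 
  then show ?thesis using False t by (simp add: sinc_symbol_def abs_mult norm_divide pos_divide_le_eq)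
qed (use t in \<open>simp add: sinc_symbol_def\<close>)

text \<open>The gain of one derivative. For frequencies of size at least 1 it comes from the
  denominator alone; near 0 the symbol is only bounded by t, whence the factor
  \<open>max 1 t\<close>.\<close>

lemma sinc_symbol_bracket_bound:
  assumes t: "t \<ge> 0" shows "norm (sinc_symbol t \<xi>) \<le> 2 * max 1 t / bracket \<xi>"
proof (cases "norm \<xi> \<le> 1")
  case True
  have "norm (sinc_symbol t \<xi>) \<le> max 1 t" using sinc_symbol_bound[OF t, of \<xi>] by simp
  moreover have "max 1 t * bracket \<xi> \<le> max 1 t * 2"
    using True by (intro mult_left_mono) (auto simp: bracket_def)
  then have "max 1 t \<le> 2 * max 1 t / bracket \<xi>"
    by (simp only: pos_le_divide_eq bracket_pos mult.commute)
  ultimately show ?thesis by linarith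
next
  case False
  then have "\<xi> \<noteq> 0" by auto
  then have "norm (sinc_symbol t \<xi>) \<le> 1 / norm \<xi>"
    by (simp add: sinc_symbol_def norm_divide divide_right_mono)
  also have "\<dots> \<le> 2 / bracket \<xi>"
    using False by (simp add: bracket_def divide_simps)
  also have "\<dots> \<le> 2 * max 1 t / bracket \<xi>"
    by (intro divide_right_mono) auto
  finally show ?thesis .
qed

lemma cos_symbol_measurable [measurable]:
  "(\<lambda>(t, \<xi>). cos_symbol t \<xi>) \<in> borel_measurable (borel \<Otimes>\<^sub>M borel)"
  unfolding cos_symbol_def by measurable

lemma sinc_symbol_measurable [measurable]:
  "(\<lambda>(t, \<xi>). sinc_symbol t \<xi>) \<in> borel_measurable (borel \<Otimes>\<^sub>M borel)"
  unfolding sinc_symbol_def by measurable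

section \<open>Moments of random sums\<close>

lemma power_le_fact_exp:
  assumes "(0::real) \<le> y" shows "y ^ k \<le> fact k * exp y"
proof -
  have "(\<Sum>n\<in>{k}. inverse (fact n) * y ^ n) \<le> (\<Sum>n. inverse (fact n) * y ^ n)"
    by (rule sum_le_suminf[OF summable_exp]) (use assms in auto)
  then have "inverse (fact k) * y ^ k \<le> exp y" by (simp add: exp_def scaleR_conv_of_real field_simps)
  then show ?thesis by (simp add: field_simps)
qed

text \<open>The power is one term of the exponential series, so the k-th moment is at most
  \<open>fact k / \<gamma>^k\<close> times two exponential moments, for any \<gamma>; then
  \<open>fact k \<le> k^k\<close>.\<close>

lemma (in prob_space) subgaussian_moment:
  fixes Y :: "'a \<Rightarrow> real"
  assumes [measurable]: "Y \<in> borel_measurable M"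
    and mgf: "\<And>\<gamma>. (\<integral>\<^sup>+\<omega>. ennreal (exp (\<gamma> * Y \<omega>)) \<partial>M) \<le> ennreal (exp (L * \<gamma>\<^sup>2 * \<sigma>\<^sup>2))"
    and \<sigma>: "\<sigma> > 0" and k: "k \<ge> 1"
  shows "(\<integral>\<^sup>+\<omega>. ennreal (\<bar>Y \<omega>\<bar> ^ k) \<partial>M) \<le> ennreal (2 * (exp L * sqrt k * \<sigma>) ^ k)"
proof -
  \<comment> \<open>With this choice the Gaussian factor is exp(L k), geometric in k, and
    \<open>fact k / \<gamma>^k\<close> is at most the k-th power of
    \<open>sqrt k * \<sigma>\<close>.\<close>
  define \<gamma> where "\<gamma> = sqrt k / \<sigma>"
  have \<gamma>: "\<gamma> > 0" using \<sigma> k by (simp add: \<gamma>_def)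
  define a where "a = fact k * inverse \<gamma> ^ k"
  have a: "a > 0" using \<gamma> by (simp add: a_def)
  have "\<bar>Y \<omega>\<bar> ^ k \<le> a * (exp (\<gamma> * Y \<omega>) + exp (- \<gamma> * Y \<omega>))" for \<omega>
  proof -
    have "(\<gamma> * \<bar>Y \<omega>\<bar>) ^ k \<le> fact k * exp (\<gamma> * \<bar>Y \<omega>\<bar>)"
      using \<gamma> by (intro power_le_fact_exp) auto
    also have "exp (\<gamma> * \<bar>Y \<omega>\<bar>) \<le> exp (\<gamma> * Y \<omega>) + exp (- \<gamma> * Y \<omega>)"
      by (cases "Y \<omega> \<ge> 0") auto
    finally have "\<gamma> ^ k * \<bar>Y \<omega>\<bar> ^ k \<le> fact k * (exp (\<gamma> * Y \<omega>) + exp (- \<gamma> * Y \<omega>))"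
      by (simp add: power_mult_distrib)
    then have "inverse \<gamma> ^ k * (\<gamma> ^ k * \<bar>Y \<omega>\<bar> ^ k) \<le> inverse \<gamma> ^ k * (fact k * (exp (\<gamma> * Y \<omega>) + exp (- \<gamma> * Y \<omega>)))"
      using \<gamma> by (intro mult_left_mono) auto
    moreover have "inverse \<gamma> ^ k * (\<gamma> ^ k * \<bar>Y \<omega>\<bar> ^ k) = \<bar>Y \<omega>\<bar> ^ k"
      using \<gamma> by (simp add: mult.assoc[symmetric] power_mult_distrib[symmetric])
    ultimately have "\<bar>Y \<omega>\<bar> ^ k \<le> inverse \<gamma> ^ k * (fact k * (exp (\<gamma> * Y \<omega>) + exp (- \<gamma> * Y \<omega>)))"
      by (simp only:)
    then show ?thesis by (simp only: a_def mult_ac)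
  qed
  then have "(\<integral>\<^sup>+\<omega>. ennreal (\<bar>Y \<omega>\<bar> ^ k) \<partial>M)
      \<le> (\<integral>\<^sup>+\<omega>. ennreal a * (ennreal (exp (\<gamma> * Y \<omega>)) + ennreal (exp (- \<gamma> * Y \<omega>))) \<partial>M)"
    using a by (intro nn_integral_mono) (auto simp: ennreal_plus[symmetric] ennreal_mult'[symmetric] simp del: ennreal_plus intro!: ennreal_leI)
  also have "\<dots> = ennreal a * ((\<integral>\<^sup>+\<omega>. ennreal (exp (\<gamma> * Y \<omega>)) \<partial>M) + (\<integral>\<^sup>+\<omega>. ennreal (exp (- \<gamma> * Y \<omega>)) \<partial>M))"
    by (simp add: nn_integral_cmult nn_integral_add)
  also have "\<dots> \<le> ennreal a * (ennreal (exp (L * \<gamma>\<^sup>2 * \<sigma>\<^sup>2)) + ennreal (exp (L * (- \<gamma>)\<^sup>2 * \<sigma>\<^sup>2)))"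
    by (intro mult_left_mono add_mono mgf) auto
  also have "\<dots> = ennreal (a * (2 * exp (L * k)))"
  proof -
    have "\<gamma>\<^sup>2 * \<sigma>\<^sup>2 = k" using \<sigma> by (simp add: \<gamma>_def power_divide)
    then show ?thesis using a
      by (simp add: ennreal_plus[symmetric] ennreal_mult'[symmetric] mult.assoc del: ennreal_plus)
  qed
  also have "\<dots> \<le> ennreal (2 * (exp L * sqrt k * \<sigma>) ^ k)"
  proof (rule ennreal_leI)
    have "inverse \<gamma> = \<sigma> / sqrt k" by (simp add: \<gamma>_def)
    moreover have "fact k \<le> (sqrt k * sqrt k) ^ k" using fact_le_power[of k, where 'a=real] by simp
    ultimately have "a \<le> (sqrt k * sqrt k) ^ k * (\<sigma> / sqrt k) ^ k"
      unfolding a_def using \<sigma> by (auto intro!: mult_right_mono)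
    also have "\<dots> = (sqrt k * \<sigma>) ^ k"
    proof -
      have "s * s * (\<sigma> / s) = s * \<sigma>" if "s > 0" for s :: real using that by simp
      from this[of "sqrt k"] show ?thesis using k unfolding power_mult_distrib[symmetric] by simp
    qed
    finally have "a * (2 * exp (L * k)) \<le> (sqrt k * \<sigma>) ^ k * (2 * exp (L * k))"
      by (intro mult_right_mono) auto
    moreover have "exp (L * k) = exp L ^ k" by (simp add: exp_of_nat_mult[symmetric] mult.commute)
    ultimately show "a * (2 * exp (L * k)) \<le> 2 * (exp L * sqrt k * \<sigma>) ^ k"
      by (simp only: power_mult_distrib mult_ac)
  qed
  finally show ?thesis .
qed

lemma power_sum4_le:
  assumes "(0::real) \<le> a" "0 \<le> b" "0 \<le> c" "0 \<le> d"
  shows "(a + b + (c + d)) ^ k \<le> 4 ^ k * (a ^ k + b ^ k + c ^ k + d ^ k)"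
proof -
  define m where "m = max (max a b) (max c d)"
  have "(a + b + (c + d)) ^ k \<le> (4 * m) ^ k"
    using assms by (intro power_mono) (auto simp: m_def)
  moreover have "m = a \<or> m = b \<or> m = c \<or> m = d" by (auto simp: m_def max_def)
  then have "m ^ k \<le> a ^ k + b ^ k + c ^ k + d ^ k" using assms by auto
  ultimately show ?thesis unfolding power_mult_distrib
    by (meson mult_left_mono order_trans zero_le_numeral zero_le_power)
qed

section \<open>The half lattice and Khinchine's inequality\<close>

lemma half_lattice_cases:
  fixes n :: "int^'d::{finite,linorder}"
  assumes "n \<noteq> 0" shows "n \<in> half_lattice \<or> - n \<in> half_lattice"
proof -
  define k where "k = Max {i. n $ i \<noteq> 0}"
  have ne: "{i. n $ i \<noteq> 0} \<noteq> {}" using assms by (auto simp: vec_eq_iff)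
  then have "n $ k \<noteq> 0" using Max_in[of "{i. n $ i \<noteq> 0}"] by (auto simp: k_def)
  moreover have "n $ i = 0" if "i > k" for i
    using that ne by (auto simp: k_def)
  ultimately show ?thesis unfolding half_lattice_def
    by (cases "n $ k > 0") (force, (rule disjI2, auto intro!: exI[of _ k]))
qed

lemma half_lattice_nonzero: "n \<in> half_lattice \<Longrightarrow> n \<noteq> 0"
  by (auto simp: half_lattice_def)

context random_coefficients
begin

lemma g_measurable [measurable]: "j \<in> {0, 1} \<Longrightarrow> g j n \<in> borel_measurable M"
  by (rule random_variable)

lemma g_zero_real: "j \<in> {0, 1} \<Longrightarrow> \<omega> \<in> space M \<Longrightarrow> Im (g j 0 \<omega>) = 0"
  using conj_symmetric[of j \<omega> 0] by (simp add: complex_eq_iff)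

definition component :: "nat \<times> ((int, 'd) vec) \<times> bool \<Rightarrow> 'w \<Rightarrow> real" where
  "component = (\<lambda>(j, n, im) \<omega>. if im then Im (g j n \<omega>) else Re (g j n \<omega>))"

abbreviation component_index :: "(nat \<times> ((int, 'd) vec) \<times> bool) set" where
  "component_index \<equiv> {(j, n, im). j \<in> {0, 1} \<and> (n \<in> half_lattice \<or> n = 0 \<and> \<not> im)}"

text \<open>For n nonzero the hypothesis concerns the plane; a vector \<zeta> along the real or
  imaginary axis extracts one component.\<close>

lemma component_mgf:
  assumes "i \<in> component_index"
  shows "(\<integral>\<^sup>+\<omega>. ennreal (exp (\<gamma> * component i \<omega>)) \<partial>M) \<le> ennreal (exp (c0 * \<gamma>\<^sup>2))"
proof -
  obtain j n im where i: "i = (j, n, im)" by (cases i)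
  then have j: "j \<in> {0, 1}" and n: "n \<in> half_lattice \<or> n = 0 \<and> \<not> im" using assms by auto
  have [measurable]: "g j n \<in> borel_measurable M" "(\<lambda>\<omega>. Re (g j 0 \<omega>)) \<in> borel_measurable M"
    using j by auto
  show ?thesis
  proof (cases "n = 0")
    case True
    then have "\<not> im" using n half_lattice_nonzero by auto
    then show ?thesis
      using exp_moment_zero[OF j, of \<gamma>] True by (simp add: i component_def nn_integral_distr)
  next
    case False
    define \<zeta> where "\<zeta> = (if im then Complex 0 \<gamma> else Complex \<gamma> 0)"
    have "\<zeta> \<bullet> z = \<gamma> * (if im then Im z else Re z)" for z
      by (simp add: \<zeta>_def inner_complex_def)
    moreover have "(norm \<zeta>)\<^sup>2 = \<gamma>\<^sup>2" by (simp add: \<zeta>_def cmod_power2)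
    ultimately show ?thesis
      using exp_moment_nonzero[OF j False, of \<zeta>]
      by (simp add: i component_def nn_integral_distr)
  qed
qed

lemma component_measurable: "i \<in> component_index \<Longrightarrow> component i \<in> borel_measurable M"
  using independent unfolding component_def[symmetric] indep_vars_def by auto

lemma component_sum_mgf:
  assumes K: "finite K" "K \<subseteq> component_index"
  shows "(\<integral>\<^sup>+\<omega>. ennreal (exp (\<gamma> * (\<Sum>i\<in>K. c i * component i \<omega>))) \<partial>M) \<le> ennreal (exp (c0 * \<gamma>\<^sup>2 * (\<Sum>i\<in>K. (c i)\<^sup>2)))"
proof -
  have "indep_vars (\<lambda>_. borel) component K"
    using independent unfolding component_def[symmetric] by (rule indep_vars_subset) fact
  then have "indep_vars (\<lambda>_. borel) (\<lambda>i \<omega>. ennreal (exp (\<gamma> * c i * component i \<omega>))) K"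
    by (rule indep_vars_compose2) measurable
  then have "(\<integral>\<^sup>+\<omega>. (\<Prod>i\<in>K. ennreal (exp (\<gamma> * c i * component i \<omega>))) \<partial>M)
      = (\<Prod>i\<in>K. \<integral>\<^sup>+\<omega>. ennreal (exp (\<gamma> * c i * component i \<omega>)) \<partial>M)"
    by (intro indep_vars_nn_integral K) auto
  also have "\<dots> \<le> (\<Prod>i\<in>K. ennreal (exp (c0 * (\<gamma> * c i)\<^sup>2)))"
    using K by (intro prod_mono_ennreal component_mgf) auto
  also have "\<dots> = ennreal (exp (c0 * \<gamma>\<^sup>2 * (\<Sum>i\<in>K. (c i)\<^sup>2)))"
    using K by (simp add: prod_ennreal exp_sum[symmetric] sum_distrib_left power_mult_distrib mult_ac)
  finally show ?thesis
    using K by (simp add: prod_ennreal exp_sum[symmetric] sum_distrib_left mult_ac)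
qed

text \<open>On frequencies in the half lattice or 0 the real and imaginary parts are independent, so
  their combination is sub-Gaussian with variance the sum of squared coefficients. The case \<sigma>
  = 0 is separate because \<open>subgaussian_moment\<close> divides by \<sigma>.\<close>

lemma half_sum_moment:
  fixes a b :: "nat \<times> ((int, 'd) vec) \<Rightarrow> real"
  assumes A: "finite A" "A \<subseteq> {0, 1} \<times> (half_lattice \<union> {0})" and k: "k \<ge> 1"
    and \<sigma>: "\<sigma> \<ge> 0" "(\<Sum>i\<in>A. (a i)\<^sup>2 + (b i)\<^sup>2) \<le> \<sigma>\<^sup>2"
  shows "(\<integral>\<^sup>+\<omega>. ennreal (\<bar>\<Sum>i\<in>A. a i * Re (g (fst i) (snd i) \<omega>) + b i * Im (g (fst i) (snd i) \<omega>)\<bar> ^ k) \<partial>M)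
     \<le> ennreal (2 * (exp c0 * sqrt k * \<sigma>) ^ k)"
proof (cases "\<sigma> = 0")
  case True
  have "(a i)\<^sup>2 + (b i)\<^sup>2 = 0" if "i \<in> A" for i
    using \<sigma> True A that sum_nonneg_eq_0_iff[of A "\<lambda>i. (a i)\<^sup>2 + (b i)\<^sup>2"]
    by (smt (verit, best) power_zero_numeral sum_nonneg sum_power2_ge_zero)
  then have "a i = 0 \<and> b i = 0" if "i \<in> A" for i
    using that by (simp add: sum_power2_eq_zero_iff)
  then show ?thesis using k by (simp add: power_0_left)
next
  case False
  \<comment> \<open>The imaginary part at n = 0 does not belong to the independent family; it is
    left out here, and the corresponding term vanishes by \<open>g_zero_real\<close>.\<close>
  define K where "K = {(j, n, im). (j, n) \<in> A \<and> (n \<in> half_lattice \<or> \<not> im)}"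
  define c where "c = (\<lambda>(j, n, im). if im then b (j, n) else a (j, n))"
  have fin: "finite K"
    by (rule finite_subset[of _ "fst ` A \<times> snd ` A \<times> UNIV"]) (use A in \<open>force simp: K_def\<close>)+
  have K: "K \<subseteq> component_index" using A by (auto simp: K_def)
  have split: "(\<Sum>i\<in>K. f i) = (\<Sum>i\<in>A. f (fst i, snd i, False) + (if snd i \<in> half_lattice then f (fst i, snd i, True) else 0))"
    for f :: "nat \<times> ((int, 'd) vec) \<times> bool \<Rightarrow> real"
  proof -
    let ?e = "\<lambda>p :: (nat \<times> (int, 'd) vec) \<times> bool. (fst (fst p), snd (fst p), snd p)"
    have "K = ?e ` (SIGMA i:A. if snd i \<in> half_lattice then {False, True} else {False})"
    proof (intro set_eqI iffI)
      fix x assume x: "x \<in> K"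
      obtain j n im where "x = (j, n, im)" by (cases x)
      with x show "x \<in> ?e ` (SIGMA i:A. if snd i \<in> half_lattice then {False, True} else {False})"
        by (intro image_eqI[of _ _ "((j, n), im)"]) (auto simp: K_def)
    qed (auto simp: K_def split: if_splits)
    then have "(\<Sum>i\<in>K. f i) = (\<Sum>p\<in>(SIGMA i:A. if snd i \<in> half_lattice then {False, True} else {False}). f (?e p))"
      by (simp only:) (subst sum.reindex, auto simp: inj_on_def prod_eq_iff)
    also have "\<dots> = (\<Sum>i\<in>A. \<Sum>im\<in>(if snd i \<in> half_lattice then {False, True} else {False}). f (?e (i, im)))"
      using A by (subst sum.Sigma) (auto simp: case_prod_unfold)
    also have "\<dots> = (\<Sum>i\<in>A. f (fst i, snd i, False) + (if snd i \<in> half_lattice then f (fst i, snd i, True) else 0))"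
      by (intro sum.cong) auto
    finally show ?thesis .
  qed
  have eq: "(\<Sum>i\<in>A. a i * Re (g (fst i) (snd i) \<omega>) + b i * Im (g (fst i) (snd i) \<omega>)) = (\<Sum>i\<in>K. c i * component i \<omega>)"
    if "\<omega> \<in> space M" for \<omega>
    unfolding split c_def component_def
  proof (rule sum.cong[OF refl], goal_cases)
    case (1 i)
    then have "fst i \<in> {0, 1}" "snd i \<in> half_lattice \<or> snd i = 0" using A by auto
    then show ?case
      using g_zero_real[of "fst i" \<omega>] that by (cases i; cases "snd i \<in> half_lattice") auto
  qed
  have "(\<Sum>i\<in>K. (c i)\<^sup>2) \<le> (\<Sum>i\<in>A. (a i)\<^sup>2 + (b i)\<^sup>2)"
    unfolding split c_def by (intro sum_mono) auto
  then have le: "(\<Sum>i\<in>K. (c i)\<^sup>2) \<le> \<sigma>\<^sup>2" using \<sigma> by linarith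
  have [measurable]: "(\<lambda>\<omega>. \<Sum>i\<in>K. c i * component i \<omega>) \<in> borel_measurable M"
    using K component_measurable by (intro borel_measurable_sum borel_measurable_times) auto
  have "(\<integral>\<^sup>+\<omega>. ennreal (\<bar>\<Sum>i\<in>K. c i * component i \<omega>\<bar> ^ k) \<partial>M) \<le> ennreal (2 * (exp c0 * sqrt k * \<sigma>) ^ k)"
  proof (rule subgaussian_moment)
    fix \<gamma>
    have "c0 * \<gamma>\<^sup>2 * (\<Sum>i\<in>K. (c i)\<^sup>2) \<le> c0 * \<gamma>\<^sup>2 * \<sigma>\<^sup>2"
      using le c0_pos by (intro mult_left_mono) auto
    then have "ennreal (exp (c0 * \<gamma>\<^sup>2 * (\<Sum>i\<in>K. (c i)\<^sup>2))) \<le> ennreal (exp (c0 * \<gamma>\<^sup>2 * \<sigma>\<^sup>2))"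
      by (intro ennreal_leI) simp
    then show "(\<integral>\<^sup>+\<omega>. ennreal (exp (\<gamma> * (\<Sum>i\<in>K. c i * component i \<omega>))) \<partial>M) \<le> ennreal (exp (c0 * \<gamma>\<^sup>2 * \<sigma>\<^sup>2))"
      using component_sum_mgf[OF fin K] order_trans by blast
  qed (use False \<sigma> k in auto)
  then show ?thesis using eq by (simp cong: nn_integral_cong)
qed

text \<open>The coefficients at n and -n are conjugate, hence dependent. Indices outside the half
  lattice are therefore reflected, and the two parts are estimated separately: real and imaginary
  parts of each give the four real sums S1 to S4, every one over independent variables.\<close>

lemma khinchine:
  fixes z :: "nat \<times> ((int, 'd) vec) \<Rightarrow> complex"
  assumes A: "finite A" "A \<subseteq> {0, 1} \<times> UNIV" and k: "k \<ge> 1"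
  shows "(\<integral>\<^sup>+\<omega>. ennreal (norm (\<Sum>i\<in>A. g (fst i) (snd i) \<omega> * z i) ^ k) \<partial>M)
     \<le> ennreal ((32 * exp c0 * sqrt k * sqrt (\<Sum>i\<in>A. (norm (z i))\<^sup>2)) ^ k)"
proof -
  define \<sigma> where "\<sigma> = sqrt (\<Sum>i\<in>A. (norm (z i))\<^sup>2)"
  have \<sigma>: "\<sigma> \<ge> 0" "\<sigma>\<^sup>2 = (\<Sum>i\<in>A. (norm (z i))\<^sup>2)"
    unfolding \<sigma>_def by (auto intro!: sum_nonneg)
  define A1 where "A1 = {i \<in> A. snd i \<in> half_lattice \<union> {0}}"
  define A2 where "A2 = (\<lambda>i. (fst i, - snd i)) ` (A - A1)"
  have fin: "finite A1" "finite A2" using A by (auto simp: A1_def A2_def)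
  have sub: "A1 \<subseteq> {0, 1} \<times> (half_lattice \<union> {0})" "A2 \<subseteq> {0, 1} \<times> (half_lattice \<union> {0})"
    using A half_lattice_cases by (fastforce simp: A1_def A2_def)+
  define z2 where "z2 i = z (fst i, - snd i)" for i
  let ?R = "\<lambda>i \<omega>. Re (g (fst i) (snd i) \<omega>)" and ?I = "\<lambda>i \<omega>. Im (g (fst i) (snd i) \<omega>)"
  define S1 where "S1 \<omega> = (\<Sum>i\<in>A1. Re (z i) * ?R i \<omega> + (- Im (z i)) * ?I i \<omega>)" for \<omega>
  define S2 where "S2 \<omega> = (\<Sum>i\<in>A1. Im (z i) * ?R i \<omega> + Re (z i) * ?I i \<omega>)" for \<omega>
  define S3 where "S3 \<omega> = (\<Sum>i\<in>A2. Re (z2 i) * ?R i \<omega> + Im (z2 i) * ?I i \<omega>)" for \<omega>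
  define S4 where "S4 \<omega> = (\<Sum>i\<in>A2. Im (z2 i) * ?R i \<omega> + (- Re (z2 i)) * ?I i \<omega>)" for \<omega>
  have 1: "(\<Sum>i\<in>A1. (norm (z i))\<^sup>2) \<le> \<sigma>\<^sup>2"
    unfolding \<sigma> using A by (intro sum_mono2) (auto simp: A1_def)
  have inj: "inj_on (\<lambda>i. (fst i, - snd i)) (A - A1)" by (auto simp: inj_on_def)
  have "(\<Sum>i\<in>A2. (norm (z2 i))\<^sup>2) = (\<Sum>i\<in>A - A1. (norm (z i))\<^sup>2)"
    unfolding A2_def z2_def by (subst sum.reindex[OF inj]) auto
  then have 2: "(\<Sum>i\<in>A2. (norm (z2 i))\<^sup>2) \<le> \<sigma>\<^sup>2"
    unfolding \<sigma> using A by (simp only:) (intro sum_mono2, auto)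
  let ?B = "ennreal (2 * (exp c0 * sqrt k * \<sigma>) ^ k)"
  have B: "(\<integral>\<^sup>+\<omega>. ennreal (\<bar>S1 \<omega>\<bar> ^ k) \<partial>M) \<le> ?B" "(\<integral>\<^sup>+\<omega>. ennreal (\<bar>S2 \<omega>\<bar> ^ k) \<partial>M) \<le> ?B"
    "(\<integral>\<^sup>+\<omega>. ennreal (\<bar>S3 \<omega>\<bar> ^ k) \<partial>M) \<le> ?B" "(\<integral>\<^sup>+\<omega>. ennreal (\<bar>S4 \<omega>\<bar> ^ k) \<partial>M) \<le> ?B"
    unfolding S1_def S2_def S3_def S4_def
    by (intro half_sum_moment fin sub k \<sigma>; use 1 2 in \<open>simp add: cmod_power2 add.commute\<close>)+
  have [measurable]: "(\<lambda>\<omega>. g (fst i) (snd i) \<omega>) \<in> borel_measurable M" if "i \<in> A1 \<or> i \<in> A2" for i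
    using that sub by (intro g_measurable) auto
  have [measurable]: "S1 \<in> borel_measurable M" "S2 \<in> borel_measurable M" "S3 \<in> borel_measurable M" "S4 \<in> borel_measurable M"
    unfolding S1_def[abs_def] S2_def[abs_def] S3_def[abs_def] S4_def[abs_def]
    by (intro borel_measurable_sum borel_measurable_add borel_measurable_times borel_measurable_const; measurable; auto)+
  have bnd: "norm (\<Sum>i\<in>A. g (fst i) (snd i) \<omega> * z i) ^ k \<le> 4 ^ k * (\<bar>S1 \<omega>\<bar> ^ k + \<bar>S2 \<omega>\<bar> ^ k + \<bar>S3 \<omega>\<bar> ^ k + \<bar>S4 \<omega>\<bar> ^ k)"
    if \<omega>: "\<omega> \<in> space M" for \<omega>
  proof -
    have "(\<Sum>i\<in>A. g (fst i) (snd i) \<omega> * z i) = (\<Sum>i\<in>A1. g (fst i) (snd i) \<omega> * z i) + (\<Sum>i\<in>A - A1. g (fst i) (snd i) \<omega> * z i)"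
      using sum.subset_diff[of A1 A] A by (simp add: A1_def add.commute)
    also have "(\<Sum>i\<in>A1. g (fst i) (snd i) \<omega> * z i) = Complex (S1 \<omega>) (S2 \<omega>)"
      by (simp add: complex_eq_iff S1_def S2_def sum_subtractf mult_ac add.commute)
    also have "(\<Sum>i\<in>A - A1. g (fst i) (snd i) \<omega> * z i) = (\<Sum>i\<in>A2. cnj (g (fst i) (snd i) \<omega>) * z2 i)"
      unfolding A2_def z2_def using A conj_symmetric \<omega> by (subst sum.reindex[OF inj]) (auto intro!: sum.cong)
    also have "\<dots> = Complex (S3 \<omega>) (S4 \<omega>)"
      by (simp add: complex_eq_iff S3_def S4_def sum.distrib sum_subtractf mult_ac add.commute)
    finally have "norm (\<Sum>i\<in>A. g (fst i) (snd i) \<omega> * z i) \<le> \<bar>S1 \<omega>\<bar> + \<bar>S2 \<omega>\<bar> + (\<bar>S3 \<omega>\<bar> + \<bar>S4 \<omega>\<bar>)"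
      using norm_triangle_ineq[of "Complex (S1 \<omega>) (S2 \<omega>)" "Complex (S3 \<omega>) (S4 \<omega>)"]
        cmod_le[of "Complex (S1 \<omega>) (S2 \<omega>)"] cmod_le[of "Complex (S3 \<omega>) (S4 \<omega>)"] by simp
    then have "norm (\<Sum>i\<in>A. g (fst i) (snd i) \<omega> * z i) ^ k \<le> (\<bar>S1 \<omega>\<bar> + \<bar>S2 \<omega>\<bar> + (\<bar>S3 \<omega>\<bar> + \<bar>S4 \<omega>\<bar>)) ^ k"
      by (intro power_mono) auto
    then show ?thesis
      using power_sum4_le[of "\<bar>S1 \<omega>\<bar>" "\<bar>S2 \<omega>\<bar>" "\<bar>S3 \<omega>\<bar>" "\<bar>S4 \<omega>\<bar>" k] by simp
  qed
  have "(\<integral>\<^sup>+\<omega>. ennreal (norm (\<Sum>i\<in>A. g (fst i) (snd i) \<omega> * z i) ^ k) \<partial>M)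
    \<le> (\<integral>\<^sup>+\<omega>. ennreal (4 ^ k) * (ennreal (\<bar>S1 \<omega>\<bar> ^ k) + ennreal (\<bar>S2 \<omega>\<bar> ^ k) + ennreal (\<bar>S3 \<omega>\<bar> ^ k) + ennreal (\<bar>S4 \<omega>\<bar> ^ k)) \<partial>M)"
    using bnd by (intro nn_integral_mono) (simp add: ennreal_plus[symmetric] ennreal_mult'[symmetric] ennreal_leI del: ennreal_plus)
  also have "\<dots> \<le> ennreal (4 ^ k) * (?B + ?B + ?B + ?B)"
    by (simp add: nn_integral_cmult nn_integral_add) (intro mult_left_mono add_mono B, auto)
  also have "\<dots> = ennreal (8 * (4 * exp c0 * sqrt k * \<sigma>) ^ k)"
    using \<sigma> by (simp add: ennreal_plus[symmetric] ennreal_mult'[symmetric] power_mult_distrib mult_ac del: ennreal_plus)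
  \<comment> \<open>The prefactor 8 comes from four sums with a factor 2 each; since k is at least 1
    it is absorbed into the k-th power, where it makes 32 with the 4 from splitting the sum.\<close>
  also have "\<dots> \<le> ennreal (8 ^ k * (4 * exp c0 * sqrt k * \<sigma>) ^ k)"
    using \<sigma> k by (intro ennreal_leI mult_right_mono) (auto intro: self_le_power)
  also have "\<dots> = ennreal ((32 * exp c0 * sqrt k * \<sigma>) ^ k)"
    by (simp only: power_mult_distrib[symmetric] mult.assoc[symmetric]) simp
  finally show ?thesis unfolding \<sigma>_def .
qed

end

section \<open>Moments of mixed norms\<close>

lemma enn_powr_ennreal [simp]: "0 \<le> x \<Longrightarrow> enn_powr (ennreal x) p = ennreal (x powr p)"
  by (simp add: enn_powr_def)

lemma enn_powr_top [simp]: "enn_powr top p = top"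
  by (simp add: enn_powr_def)

lemma enn_powr_zero [simp]: "enn_powr 0 p = 0"
  by (simp add: enn_powr_def)

lemma enn_powr_measurable [measurable]: "(\<lambda>x. enn_powr x p) \<in> borel_measurable borel"
  unfolding enn_powr_def by measurable

lemma enn_powr_power: "k \<ge> 1 \<Longrightarrow> (enn_powr x p) ^ k = enn_powr x (p * real k)"
  by (cases x) (simp_all add: powr_powr[symmetric] powr_realpow' ennreal_power top_power_ennreal)

lemma enn_powr_mono: "x \<le> y \<Longrightarrow> 0 \<le> p \<Longrightarrow> enn_powr x p \<le> enn_powr y p"
  by (cases x; cases y) (auto simp: top_unique intro!: ennreal_leI powr_mono2)

lemma enn_powr_mult: "0 \<le> c \<Longrightarrow> c > 0 \<Longrightarrow> enn_powr (ennreal c * x) p = ennreal (c powr p) * enn_powr x p"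
  by (cases x) (simp_all add: ennreal_mult[symmetric] powr_mult ennreal_mult_top)

text \<open>A convex function lies above its tangent at m; the inequality is Young's with exponents
  1 / p and 1 - 1 / p.\<close>

lemma powr_tangent:
  fixes p y m :: real
  assumes p: "1 \<le> p" and y: "0 \<le> y" and m: "0 < m"
  shows "p * m powr (p - 1) * y \<le> y powr p + (p - 1) * m powr p"
proof (cases "y = 0")
  case True then show ?thesis using p by (auto intro!: mult_nonneg_nonneg)
next
  case False
  then have y: "y > 0" using y by simp
  have "(y powr p) powr (1 / p) * (m powr p) powr (1 - 1 / p) \<le> 1 / p * y powr p + (1 - 1 / p) * m powr p"
    using p y m by (intro Youngs_inequality_0) auto
  also have "(y powr p) powr (1 / p) * (m powr p) powr (1 - 1 / p) = y * m powr (p - 1)"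
    using p y by (simp add: powr_powr right_diff_distrib)
  finally have "p * (y * m powr (p - 1)) \<le> p * (1 / p * y powr p + (1 - 1 / p) * m powr p)"
    using p by (intro mult_left_mono) auto
  moreover have "p * (1 / p * Y + (1 - 1 / p) * Z) = Y + (p - 1) * Z" for Y Z
    using p by (simp add: field_simps)
  ultimately show ?thesis by (simp add: mult_ac)
qed

text \<open>The tangent inequality at the mean m is integrated against w. An infinite mean is
  treated first: f is at most 1 plus its p-th power, so the right side is infinite as well.\<close>

lemma weighted_jensen:
  fixes f :: "'a \<Rightarrow> ennreal" and w :: "'a \<Rightarrow> real"
  assumes [measurable]: "f \<in> borel_measurable N" "w \<in> borel_measurable N"
    and w: "\<And>x. 0 \<le> w x" "(\<integral>\<^sup>+x. ennreal (w x) \<partial>N) = 1" and p: "1 \<le> p"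
  shows "enn_powr (\<integral>\<^sup>+x. ennreal (w x) * f x \<partial>N) p \<le> (\<integral>\<^sup>+x. ennreal (w x) * enn_powr (f x) p \<partial>N)"
proof (cases "\<integral>\<^sup>+x. ennreal (w x) * f x \<partial>N")
  case top
  have "f x \<le> 1 + enn_powr (f x) p" for x
  proof (cases "f x")
    case (real y)
    have "y \<le> 1 + y powr p"
    proof (cases "y \<le> 1")
      case False
      then have "y powr 1 \<le> y powr p" using p by (intro powr_mono) auto
      then show ?thesis using False by simp
    qed (simp add: add_increasing2)
    then show ?thesis using real by (simp add: ennreal_plus[symmetric] ennreal_1[symmetric] del: ennreal_plus ennreal_1)
  qed simp
  then have "(\<integral>\<^sup>+x. ennreal (w x) * f x \<partial>N) \<le> (\<integral>\<^sup>+x. ennreal (w x) * (1 + enn_powr (f x) p) \<partial>N)"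
    by (intro nn_integral_mono mult_left_mono) auto
  also have "\<dots> = 1 + (\<integral>\<^sup>+x. ennreal (w x) * enn_powr (f x) p \<partial>N)"
    using w by (simp add: distrib_left nn_integral_add)
  finally have "(\<integral>\<^sup>+x. ennreal (w x) * enn_powr (f x) p \<partial>N) = top"
    using top by (simp add: top_unique ennreal_add_eq_top)
  then show ?thesis by simp
next
  case (real m)
  show ?thesis
  proof (cases "m = 0")
    case True then show ?thesis using real by simp
  next
    case False
    with real have m: "m > 0" by simp
    let ?J = "\<integral>\<^sup>+x. ennreal (w x) * enn_powr (f x) p \<partial>N"
    have "ennreal (p * m powr (p - 1)) * f x \<le> enn_powr (f x) p + ennreal ((p - 1) * m powr p)" for x
    proof (cases "f x")
      case (real y)
      then show ?thesis using powr_tangent[OF p real(1) m] p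
        by (simp add: ennreal_plus[symmetric] ennreal_mult[symmetric] ennreal_leI del: ennreal_plus)
    qed simp
    then have "(\<integral>\<^sup>+x. ennreal (w x) * (ennreal (p * m powr (p - 1)) * f x) \<partial>N) \<le> (\<integral>\<^sup>+x. ennreal (w x) * (enn_powr (f x) p + ennreal ((p - 1) * m powr p)) \<partial>N)"
      by (intro nn_integral_mono mult_left_mono) auto
    also have "\<dots> = ?J + ennreal ((p - 1) * m powr p)"
      using w by (simp add: distrib_left nn_integral_add nn_integral_multc)
    also have "(\<integral>\<^sup>+x. ennreal (w x) * (ennreal (p * m powr (p - 1)) * f x) \<partial>N) = ennreal (p * m powr (p - 1)) * ennreal m"
      using real by (simp add: mult.left_commute[of "ennreal (w _)"] nn_integral_cmult)
    also have "\<dots> = ennreal (p * m powr p)"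
    proof -
      have "m powr (p - 1) * m = m powr p" using m by (simp add: powr_diff)
      then show ?thesis using p m by (simp add: ennreal_mult[symmetric] mult.assoc)
    qed
    finally have le: "ennreal (p * m powr p) \<le> ?J + ennreal ((p - 1) * m powr p)" .
    have "ennreal (m powr p) \<le> ?J"
    proof (cases ?J)
      case (real J)
      with le have "ennreal (p * m powr p) \<le> ennreal (J + (p - 1) * m powr p)"
        using p by (simp add: ennreal_plus)
      then have "p * m powr p \<le> J + (p - 1) * m powr p"
        using real p by (subst (asm) ennreal_le_iff) auto
      then have "m powr p \<le> J" by (simp add: algebra_simps)
      then show ?thesis using real by (simp add: ennreal_leI)
    qed simp
    then show ?thesis using real by simp
  qed
qed

text \<open>For the essential supremum: it is at most c exactly when the set where f exceeds c is
  null, and the measure of that set depends measurably on the parameter by Tonelli.\<close>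

lemma Lp_norm_measurable:
  assumes "sigma_finite_measure L" and [measurable]: "(\<lambda>(\<omega>, x). f \<omega> x) \<in> borel_measurable (N \<Otimes>\<^sub>M L)"
  shows "(\<lambda>\<omega>. Lp_norm L p (f \<omega>)) \<in> borel_measurable N"
proof (cases "p = \<infinity>")
  case False
  interpret sigma_finite_measure L by fact
  from False show ?thesis unfolding Lp_norm_def by simp
next
  case True
  interpret sigma_finite_measure L by fact
  have [measurable]: "f \<omega> \<in> borel_measurable L" if "\<omega> \<in> space N" for \<omega>
    using measurable_Pair2[OF assms(2) that] by simp
  have *: "Lp_norm L p (f \<omega>) \<le> c \<longleftrightarrow> (\<integral>\<^sup>+x. indicator {c<..} (f \<omega> x) \<partial>L) = 0" if "\<omega> \<in> space N" for \<omega> c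
  proof -
    have "(\<integral>\<^sup>+x. indicator {c<..} (f \<omega> x) \<partial>L) = 0 \<longleftrightarrow> (AE x in L. f \<omega> x \<le> c)"
      using that by (subst nn_integral_0_iff_AE) (auto simp: indicator_def not_less intro!: AE_cong)
    moreover have "esssup L (f \<omega>) \<le> c \<longleftrightarrow> (AE x in L. f \<omega> x \<le> c)"
    proof
      assume "esssup L (f \<omega>) \<le> c"
      then show "AE x in L. f \<omega> x \<le> c"
        using esssup_AE[of "f \<omega>" L] by (auto elim!: eventually_mono)
    qed (use that in auto)
    ultimately show ?thesis using True by (simp add: Lp_norm_def)
  qed
  show ?thesis
  proof (rule borel_measurableI_le)
    fix c
    have "{\<omega> \<in> space N. Lp_norm L p (f \<omega>) \<le> c} = {\<omega> \<in> space N. (\<integral>\<^sup>+x. indicator {c<..} (f \<omega> x) \<partial>L) = 0}"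
      using * by auto
    also have "\<dots> \<in> sets N" by measurable
    finally show "{\<omega> \<in> space N. Lp_norm L p (f \<omega>) \<le> c} \<in> sets N" .
  qed
qed

lemma Lp_norm_cong_AE:
  assumes "f \<in> borel_measurable L" "g \<in> borel_measurable L" "AE x in L. f x = g x"
  shows "Lp_norm L p f = Lp_norm L p g"
proof (cases "p = \<infinity>")
  case True
  have "esssup L f \<le> esssup L g" "esssup L g \<le> esssup L f"
    using assms by (auto intro!: esssup_AE_mono elim!: eventually_mono)
  then show ?thesis using True by (simp add: Lp_norm_def)
next
  case False
  have "(\<integral>\<^sup>+x. enn_powr (f x) (enn2real p) \<partial>L) = (\<integral>\<^sup>+x. enn_powr (g x) (enn2real p) \<partial>L)"
    using assms by (intro nn_integral_cong_AE) (auto elim!: eventually_mono)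
  then show ?thesis using False by (simp add: Lp_norm_def)
qed

text \<open>Jensen's inequality for the density \<open>\<sigma>\<^sup>r / \<integral> \<sigma>\<^sup>r\<close> moves the expectation inside the \<open>L\<^sup>r\<close> norm,
  where the pointwise moment bound applies; \<open>r \<ge> 2\<close> is used to bound \<open>\<sigma>\<^sup>r\<close> by its supremum and \<open>\<sigma>\<^sup>2\<close>.\<close>

lemma Lr_norm_moment:
  fixes V :: "'w \<Rightarrow> 'x \<Rightarrow> complex" and \<sigma> :: "'x \<Rightarrow> real"
  assumes "prob_space M" "sigma_finite_measure L"
    and [measurable]: "(\<lambda>(\<omega>, x). V \<omega> x) \<in> borel_measurable (M \<Otimes>\<^sub>M L)" "\<sigma> \<in> borel_measurable L"
    and \<sigma>: "\<And>x. 0 \<le> \<sigma> x" "\<And>x. \<sigma> x \<le> \<kappa>" "(\<integral>\<^sup>+x. ennreal ((\<sigma> x)\<^sup>2) \<partial>L) \<le> ennreal (\<theta> * \<kappa>\<^sup>2)"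
    and pos: "\<theta> \<ge> 0" "D \<ge> 0"
    and mom: "AE x in L. (\<integral>\<^sup>+\<omega>. ennreal (norm (V \<omega> x) ^ k) \<partial>M) \<le> ennreal ((D * \<sigma> x) ^ k)"
    and r: "2 \<le> r" "r \<le> real k"
  shows "(\<integral>\<^sup>+\<omega>. (Lp_norm L (ennreal r) (\<lambda>x. ennreal (norm (V \<omega> x)))) ^ k \<partial>M) \<le> ennreal ((D * \<kappa> * \<theta> powr (1 / r)) ^ k)"
proof -
  interpret M: prob_space M by fact
  interpret L: sigma_finite_measure L by fact
  interpret P: pair_sigma_finite M L ..
  have k: "k \<ge> 1" using r by simp
  have \<kappa>: "\<kappa> \<ge> 0 \<or> space L = {}" using \<sigma>(1,2) order_trans by blast
  have norm_eq: "(Lp_norm L (ennreal r) (\<lambda>x. ennreal (norm (V \<omega> x)))) ^ k = enn_powr (\<integral>\<^sup>+x. ennreal (norm (V \<omega> x) powr r) \<partial>L) (k / r)" for \<omega>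
    using r k by (simp add: Lp_norm_def enn_powr_power)
  define S where "S = (\<integral>\<^sup>+x. ennreal (\<sigma> x powr r) \<partial>L)"
  have Sle: "S \<le> ennreal (\<theta> * \<kappa> powr r)"
  proof -
    have "\<sigma> x powr r \<le> \<kappa> powr (r - 2) * (\<sigma> x)\<^sup>2" for x
    proof (cases "\<sigma> x = 0")
      case False
      then have "\<sigma> x powr r = \<sigma> x powr (r - 2) * \<sigma> x powr 2"
        by (subst powr_add[symmetric]) simp
      also have "\<dots> = \<sigma> x powr (r - 2) * (\<sigma> x)\<^sup>2" using \<sigma>(1)[of x] by simp
      also have "\<dots> \<le> \<kappa> powr (r - 2) * (\<sigma> x)\<^sup>2"
        using \<sigma> r by (intro mult_right_mono powr_mono2) auto
      finally show ?thesis .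
    qed simp
    then have "S \<le> (\<integral>\<^sup>+x. ennreal (\<kappa> powr (r - 2)) * ennreal ((\<sigma> x)\<^sup>2) \<partial>L)"
      unfolding S_def by (intro nn_integral_mono) (simp add: ennreal_mult[symmetric] ennreal_leI)
    also have "\<dots> \<le> ennreal (\<kappa> powr (r - 2)) * ennreal (\<theta> * \<kappa>\<^sup>2)"
      by (subst nn_integral_cmult) (auto intro!: mult_left_mono \<sigma>)
    also have "\<dots> = ennreal (\<theta> * \<kappa> powr r)"
    proof (cases "\<kappa> = 0")
      case False
      have "\<kappa> \<ge> 0" using \<sigma>(1,2) order_trans by blast
      with False have "\<kappa> powr (r - 2) * \<kappa>\<^sup>2 = \<kappa> powr r"
        by (simp add: powr_diff)
      then show ?thesis using pos by (simp add: ennreal_mult[symmetric] mult.left_commute)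
    qed (use r in simp)
    finally show ?thesis .
  qed
  have null: "AE x in L. \<sigma> x = 0 \<longrightarrow> (\<integral>\<^sup>+\<omega>. ennreal (norm (V \<omega> x) ^ k) \<partial>M) = 0"
    using mom k by (auto elim!: eventually_mono simp: power_0_left)
  \<comment> \<open>The argument divides by \<sigma>. Where \<sigma> is 0 the moment bound forces V
    to vanish almost surely, and Fubini makes this hold for almost every x outside one null set of
    \<omega>.\<close>
  have zero: "AE \<omega> in M. AE x in L. \<sigma> x = 0 \<longrightarrow> V \<omega> x = 0"
  proof -
    have "AE x in L. AE \<omega> in M. \<sigma> x = 0 \<longrightarrow> V \<omega> x = 0"
    proof (rule AE_mp[OF null], rule AE_I2, rule impI)
      fix x assume x: "x \<in> space L" and z: "\<sigma> x = 0 \<longrightarrow> (\<integral>\<^sup>+\<omega>. ennreal (norm (V \<omega> x) ^ k) \<partial>M) = 0"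
      have [measurable]: "(\<lambda>\<omega>. V \<omega> x) \<in> borel_measurable M" using x by measurable
      show "AE \<omega> in M. \<sigma> x = 0 \<longrightarrow> V \<omega> x = 0"
      proof (cases "\<sigma> x = 0")
        case True
        then have "AE \<omega> in M. ennreal (norm (V \<omega> x) ^ k) = 0"
          using z by (subst (asm) nn_integral_0_iff_AE) auto
        then show ?thesis by (auto elim!: eventually_mono)
      qed simp
    qed
    then show ?thesis
      by (subst P.AE_commute) measurable
  qed
  show ?thesis
  proof (cases S)
    case top then show ?thesis using Sle by (simp add: top_unique)
  next
    case (real s)
    show ?thesis
    \<comment> \<open>The density w needs a positive normalisation. If s is 0 then \<sigma> vanishes
      almost everywhere, and so does the norm for almost every \<omega>.\<close>
    proof (cases "s = 0")
      case True
      then have "S = 0" using real by simp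
      then have "AE x in L. ennreal (\<sigma> x powr r) = 0"
        unfolding S_def by (subst (asm) nn_integral_0_iff_AE) auto
      then have \<sigma>0: "AE x in L. \<sigma> x = 0" by (auto elim!: eventually_mono)
      have "AE \<omega> in M. (Lp_norm L (ennreal r) (\<lambda>x. ennreal (norm (V \<omega> x)))) ^ k = 0"
        using zero
      proof (rule AE_mp, intro AE_I2 impI)
        fix \<omega> assume "\<omega> \<in> space M" "AE x in L. \<sigma> x = 0 \<longrightarrow> V \<omega> x = 0"
        then have "AE x in L. ennreal (norm (V \<omega> x) powr r) = 0" using \<sigma>0 by auto
        then have "(\<integral>\<^sup>+x. ennreal (norm (V \<omega> x) powr r) \<partial>L) = (\<integral>\<^sup>+x. 0 \<partial>L)"
          by (rule nn_integral_cong_AE)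
        then have "(\<integral>\<^sup>+x. ennreal (norm (V \<omega> x) powr r) \<partial>L) = 0" by simp
        then show "(Lp_norm L (ennreal r) (\<lambda>x. ennreal (norm (V \<omega> x)))) ^ k = 0"
          by (simp add: norm_eq)
      qed
      then have "(\<integral>\<^sup>+\<omega>. (Lp_norm L (ennreal r) (\<lambda>x. ennreal (norm (V \<omega> x)))) ^ k \<partial>M) = (\<integral>\<^sup>+\<omega>. 0 \<partial>M)"
        by (rule nn_integral_cong_AE)
      then show ?thesis by simp
    next
      case False
      with real have s: "s > 0" by simp
      define w where "w x = \<sigma> x powr r / s" for x
      \<comment> \<open>The normalised field has k-th moment at most \<open>D^k\<close> at every
        point, whatever the size of \<sigma>; division by 0 gives 0, consistent with V = 0
        there.\<close>
      define f where "f \<omega> x = ennreal (norm (V \<omega> x / of_real (\<sigma> x)) powr r)" for \<omega> x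
      have [measurable]: "w \<in> borel_measurable L" unfolding w_def[abs_def] by measurable
      have [measurable]: "(\<lambda>(\<omega>, x). f \<omega> x) \<in> borel_measurable (M \<Otimes>\<^sub>M L)" unfolding f_def by measurable
      have w0: "w x \<ge> 0" for x using s by (simp add: w_def)
      have "(\<integral>\<^sup>+x. ennreal (w x) \<partial>L) = (\<integral>\<^sup>+x. ennreal (1 / s) * ennreal (\<sigma> x powr r) \<partial>L)"
        using s by (intro nn_integral_cong) (simp add: w_def ennreal_mult[symmetric])
      also have "\<dots> = ennreal (1 / s) * ennreal s"
        using real by (subst nn_integral_cmult) (auto simp: S_def)
      finally have w1: "(\<integral>\<^sup>+x. ennreal (w x) \<partial>L) = 1" using s by (simp add: ennreal_mult[symmetric])
      have "AE \<omega> in M. (Lp_norm L (ennreal r) (\<lambda>x. ennreal (norm (V \<omega> x)))) ^ k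
          \<le> ennreal (s powr (k / r)) * (\<integral>\<^sup>+x. ennreal (w x) * ennreal (norm (V \<omega> x / of_real (\<sigma> x)) ^ k) \<partial>L)"
        using zero
      proof (rule AE_mp, intro AE_I2 impI)
        fix \<omega> assume \<omega>: "\<omega> \<in> space M" and z: "AE x in L. \<sigma> x = 0 \<longrightarrow> V \<omega> x = 0"
        have [measurable]: "(\<lambda>x. V \<omega> x) \<in> borel_measurable L" "f \<omega> \<in> borel_measurable L"
          using \<omega> by measurable
        have "(\<integral>\<^sup>+x. ennreal (norm (V \<omega> x) powr r) \<partial>L) = (\<integral>\<^sup>+x. ennreal s * (ennreal (w x) * f \<omega> x) \<partial>L)"
        proof (rule nn_integral_cong_AE)
          show "AE x in L. ennreal (norm (V \<omega> x) powr r) = ennreal s * (ennreal (w x) * f \<omega> x)"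
            using z
          proof eventually_elim
            case (elim x)
            have "norm (V \<omega> x) powr r = s * (w x * norm (V \<omega> x / of_real (\<sigma> x)) powr r)"
              using elim s \<sigma>(1)[of x] by (cases "\<sigma> x = 0") (auto simp: w_def norm_divide powr_divide)
            then show ?case using s w0[of x] by (simp add: f_def ennreal_mult)
          qed
        qed
        also have "\<dots> = ennreal s * (\<integral>\<^sup>+x. ennreal (w x) * f \<omega> x \<partial>L)"
          by (intro nn_integral_cmult) measurable
        finally have "(Lp_norm L (ennreal r) (\<lambda>x. ennreal (norm (V \<omega> x)))) ^ k 
            = ennreal (s powr (k / r)) * enn_powr (\<integral>\<^sup>+x. ennreal (w x) * f \<omega> x \<partial>L) (k / r)"
          unfolding norm_eq using s by (simp add: enn_powr_mult)
        also have "\<dots> \<le> ennreal (s powr (k / r)) * (\<integral>\<^sup>+x. ennreal (w x) * enn_powr (f \<omega> x) (k / r) \<partial>L)"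
          using r by (intro mult_left_mono weighted_jensen w0 w1) auto
        also have "(\<lambda>x. enn_powr (f \<omega> x) (k / r)) = (\<lambda>x. ennreal (norm (V \<omega> x / of_real (\<sigma> x)) ^ k))"
          using r k by (auto simp: f_def powr_powr powr_realpow')
        finally show "(Lp_norm L (ennreal r) (\<lambda>x. ennreal (norm (V \<omega> x)))) ^ k
          \<le> ennreal (s powr (k / r)) * (\<integral>\<^sup>+x. ennreal (w x) * ennreal (norm (V \<omega> x / of_real (\<sigma> x)) ^ k) \<partial>L)" .
      qed
      then have "(\<integral>\<^sup>+\<omega>. (Lp_norm L (ennreal r) (\<lambda>x. ennreal (norm (V \<omega> x)))) ^ k \<partial>M)
          \<le> (\<integral>\<^sup>+\<omega>. ennreal (s powr (k / r)) * (\<integral>\<^sup>+x. ennreal (w x) * ennreal (norm (V \<omega> x / of_real (\<sigma> x)) ^ k) \<partial>L) \<partial>M)"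
        by (rule nn_integral_mono_AE)
      also have "\<dots> = ennreal (s powr (k / r)) * (\<integral>\<^sup>+\<omega>. \<integral>\<^sup>+x. ennreal (w x) * ennreal (norm (V \<omega> x / of_real (\<sigma> x)) ^ k) \<partial>L \<partial>M)"
        by (intro nn_integral_cmult) measurable
      also have "(\<integral>\<^sup>+\<omega>. \<integral>\<^sup>+x. ennreal (w x) * ennreal (norm (V \<omega> x / of_real (\<sigma> x)) ^ k) \<partial>L \<partial>M)
          = (\<integral>\<^sup>+x. \<integral>\<^sup>+\<omega>. ennreal (w x) * ennreal (norm (V \<omega> x / of_real (\<sigma> x)) ^ k) \<partial>M \<partial>L)"
        by (rule P.Fubini'[symmetric]) measurable
      also have "\<dots> \<le> (\<integral>\<^sup>+x. ennreal (w x) * ennreal (D ^ k) \<partial>L)"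
      proof (rule nn_integral_mono_AE)
        show "AE x in L. (\<integral>\<^sup>+\<omega>. ennreal (w x) * ennreal (norm (V \<omega> x / of_real (\<sigma> x)) ^ k) \<partial>M) \<le> ennreal (w x) * ennreal (D ^ k)"
          using mom
        proof (rule AE_mp, intro AE_I2 impI)
          fix x assume x: "x \<in> space L" and m: "(\<integral>\<^sup>+\<omega>. ennreal (norm (V \<omega> x) ^ k) \<partial>M) \<le> ennreal ((D * \<sigma> x) ^ k)"
          have [measurable]: "(\<lambda>\<omega>. V \<omega> x) \<in> borel_measurable M" using x by measurable
          show "(\<integral>\<^sup>+\<omega>. ennreal (w x) * ennreal (norm (V \<omega> x / of_real (\<sigma> x)) ^ k) \<partial>M) \<le> ennreal (w x) * ennreal (D ^ k)"
          proof (cases "\<sigma> x = 0")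
            case False
            with \<sigma>(1)[of x] have s0: "\<sigma> x > 0" by simp
            have "(\<integral>\<^sup>+\<omega>. ennreal (norm (V \<omega> x / of_real (\<sigma> x)) ^ k) \<partial>M) = (\<integral>\<^sup>+\<omega>. ennreal (1 / \<sigma> x ^ k) * ennreal (norm (V \<omega> x) ^ k) \<partial>M)"
              using s0 by (intro nn_integral_cong) (simp add: norm_divide power_divide ennreal_mult[symmetric])
            also have "\<dots> \<le> ennreal (1 / \<sigma> x ^ k) * ennreal ((D * \<sigma> x) ^ k)"
              by (subst nn_integral_cmult) (auto intro!: mult_left_mono m)
            also have "\<dots> = ennreal (D ^ k)"
              using s0 pos by (simp add: ennreal_mult[symmetric] power_mult_distrib)
            finally show ?thesis by (subst nn_integral_cmult) (auto intro!: mult_left_mono)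
          qed (simp add: w_def)
        qed
      qed
      also have "\<dots> = ennreal (D ^ k)"
        using w1 by (simp add: nn_integral_multc)
      also have "ennreal (s powr (k / r)) * ennreal (D ^ k) \<le> ennreal ((D * \<kappa> * \<theta> powr (1 / r)) ^ k)"
      proof (cases "space L = {}")
        case True
        then show ?thesis using w1 by (simp add: nn_integral_empty)
      next
        case ne: False
        then have \<kappa>: "\<kappa> \<ge> 0" using \<kappa> by auto
        have sle: "s \<le> \<theta> * \<kappa> powr r"
          using Sle real pos \<kappa> by (simp add: ennreal_le_iff)
        have "s powr (k / r) \<le> (\<theta> * \<kappa> powr r) powr (k / r)"
          using s sle r by (intro powr_mono2) auto
        also have "\<dots> = (\<kappa> * \<theta> powr (1 / r)) ^ k"
        proof -
          have "(\<theta> * \<kappa> powr r) powr (k / r) = (\<theta> powr (1 / r)) powr k * \<kappa> powr k"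
            using pos \<kappa> r by (simp add: powr_mult powr_powr)
          then show ?thesis using \<kappa> k by (simp add: powr_realpow' power_mult_distrib mult.commute)
        qed
        finally have "s powr (k / r) * D ^ k \<le> (\<kappa> * \<theta> powr (1 / r)) ^ k * D ^ k"
          using pos by (intro mult_right_mono) auto
        then have "s powr (k / r) * D ^ k \<le> (D * \<kappa> * \<theta> powr (1 / r)) ^ k"
          by (simp add: power_mult_distrib mult_ac)
        then show ?thesis using pos by (simp add: ennreal_mult[symmetric] ennreal_leI)
      qed
      finally show ?thesis by (simp add: mult_left_mono)
    qed
  qed
qed

text \<open>Jensen as in \<open>Lr_norm_moment\<close>, but for the constant density 1 / (b - a),
  since the moment bound is uniform in t. The length enters as its power 1 / q.\<close>

lemma Lq_norm_moment:
  fixes Y :: "'w \<Rightarrow> real \<Rightarrow> ennreal"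
  assumes "prob_space M" and ab: "a < b"
    and [measurable]: "(\<lambda>(\<omega>, t). Y \<omega> t) \<in> borel_measurable (M \<Otimes>\<^sub>M restrict_space lborel {a..b})"
    and mom: "\<And>t. t \<in> {a..b} \<Longrightarrow> (\<integral>\<^sup>+\<omega>. (Y \<omega> t) ^ k \<partial>M) \<le> ennreal (B ^ k)"
    and B: "B \<ge> 0" and q: "1 \<le> q" "q \<le> real k"
  shows "(\<integral>\<^sup>+\<omega>. (Lp_norm (restrict_space lborel {a..b}) (ennreal q) (Y \<omega>)) ^ k \<partial>M) \<le> ennreal (((b - a) powr (1 / q) * B) ^ k)"
proof -
  interpret M: prob_space M by fact
  let ?L = "restrict_space lborel {a..b}"
  let ?l = "b - a"
  have l: "?l > 0" using ab by simp
  have k: "k \<ge> 1" using q by simp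
  have em: "emeasure ?L (space ?L) = ennreal ?l"
    using ab by (simp add: emeasure_restrict_space space_restrict_space)
  interpret L: finite_measure ?L by (rule finite_measureI) (unfold em, simp)
  interpret P: pair_sigma_finite M ?L ..
  have norm_le: "(Lp_norm ?L (ennreal q) (Y \<omega>)) ^ k \<le> ennreal (?l powr (k / q - 1)) * (\<integral>\<^sup>+t. (Y \<omega> t) ^ k \<partial>?L)"
    if "\<omega> \<in> space M" for \<omega>
  proof -
    have [measurable]: "Y \<omega> \<in> borel_measurable ?L" using that by measurable
    have "(\<integral>\<^sup>+t. enn_powr (Y \<omega> t) q \<partial>?L) = ennreal ?l * (\<integral>\<^sup>+t. ennreal (1 / ?l) * enn_powr (Y \<omega> t) q \<partial>?L)"
      using l by (subst nn_integral_cmult) (auto simp: mult.assoc[symmetric] ennreal_mult[symmetric])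
    moreover have "(?l powr (1 / q)) ^ k = ?l powr (k / q)"
      using l k by (simp add: powr_powr powr_realpow'[symmetric])
    ultimately have "(Lp_norm ?L (ennreal q) (Y \<omega>)) ^ k = ennreal (?l powr (k / q)) * enn_powr (\<integral>\<^sup>+t. ennreal (1 / ?l) * enn_powr (Y \<omega> t) q \<partial>?L) (k / q)"
      using q k l by (simp add: Lp_norm_def enn_powr_power enn_powr_mult power_mult_distrib ennreal_power)
    also have "\<dots> \<le> ennreal (?l powr (k / q)) * (\<integral>\<^sup>+t. ennreal (1 / ?l) * enn_powr (enn_powr (Y \<omega> t) q) (k / q) \<partial>?L)"
      using q l em by (intro mult_left_mono weighted_jensen) (auto simp: ennreal_mult[symmetric])
    also have "\<dots> = ennreal (?l powr (k / q)) * (\<integral>\<^sup>+t. ennreal (1 / ?l) * (Y \<omega> t) ^ k \<partial>?L)"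
    proof -
      have "enn_powr (enn_powr y q) (k / q) = y ^ k" for y
        using q k enn_powr_power[of k y 1] by (cases y) (auto simp: powr_powr powr_realpow' ennreal_power top_power_ennreal)
      then show ?thesis by simp
    qed
    also have "\<dots> = ennreal (?l powr (k / q)) * ennreal (1 / ?l) * (\<integral>\<^sup>+t. (Y \<omega> t) ^ k \<partial>?L)"
      by (subst nn_integral_cmult) (auto simp: mult.assoc)
    also have "ennreal (?l powr (k / q)) * ennreal (1 / ?l) = ennreal (?l powr (k / q - 1))"
      using l by (simp add: ennreal_mult[symmetric] powr_diff)
    finally show ?thesis .
  qed
  have "(\<integral>\<^sup>+\<omega>. (Lp_norm ?L (ennreal q) (Y \<omega>)) ^ k \<partial>M) \<le> (\<integral>\<^sup>+\<omega>. ennreal (?l powr (k / q - 1)) * (\<integral>\<^sup>+t. (Y \<omega> t) ^ k \<partial>?L) \<partial>M)"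
    by (intro nn_integral_mono norm_le)
  also have "\<dots> = ennreal (?l powr (k / q - 1)) * (\<integral>\<^sup>+\<omega>. \<integral>\<^sup>+t. (Y \<omega> t) ^ k \<partial>?L \<partial>M)"
    by (intro nn_integral_cmult) measurable
  also have "(\<integral>\<^sup>+\<omega>. \<integral>\<^sup>+t. (Y \<omega> t) ^ k \<partial>?L \<partial>M) = (\<integral>\<^sup>+t. \<integral>\<^sup>+\<omega>. (Y \<omega> t) ^ k \<partial>M \<partial>?L)"
    by (rule P.Fubini'[symmetric]) measurable
  also have "\<dots> \<le> (\<integral>\<^sup>+t. ennreal (B ^ k) \<partial>?L)"
    by (intro nn_integral_mono mom) (simp add: space_restrict_space)
  also have "\<dots> = ennreal (B ^ k) * ennreal ?l" using em by simp
  also have "ennreal (?l powr (k / q - 1)) * (ennreal (B ^ k) * ennreal ?l) = ennreal ((?l powr (1 / q) * B) ^ k)"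
  proof -
    have "?l powr (k / q - 1) * (B ^ k * ?l) = (?l powr (k / q - 1) * ?l) * B ^ k" by simp
    also have "?l powr (k / q - 1) * ?l = ?l powr (k / q)" using l by (simp add: powr_diff)
    also have "\<dots> = (?l powr (1 / q)) ^ k" using l k by (simp add: powr_powr powr_realpow'[symmetric])
    finally show ?thesis using l B by (simp add: ennreal_mult[symmetric] power_mult_distrib)
  qed
  finally show ?thesis by (simp add: mult_left_mono)
qed

section \<open>Smoothing and the supremum norm\<close>

abbreviation unit_ball_measure :: "(real^'d::finite) measure" where
  "unit_ball_measure \<equiv> uniform_measure lborel (ball 0 1)"

lemma unit_ball_content: "emeasure lborel (ball (0::real^'d::finite) 1) = ennreal (unit_ball_vol CARD('d))"
  by (subst emeasure_ball) auto

lemma unit_ball_vol_card_pos: "0 < unit_ball_vol (real CARD('d::finite))"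
  by (intro unit_ball_vol_pos) auto

lemma unit_ball_vol_card_neq_0 [simp]: "unit_ball_vol (real CARD('d::finite)) \<noteq> 0"
  using unit_ball_vol_card_pos[where 'd='d] by linarith

lemma prob_space_unit_ball: "prob_space (unit_ball_measure :: (real^'d::finite) measure)"
  by (intro prob_space_uniform_measure) (auto simp: unit_ball_content)

definition ball_avg :: "real \<Rightarrow> (real^'d::finite \<Rightarrow> complex) \<Rightarrow> real^'d \<Rightarrow> complex" where
  "ball_avg \<delta> f x = (LINT y|unit_ball_measure. f (x + \<delta> *\<^sub>R y))"

text \<open>The Fourier symbol of averaging over the unit ball; the average over radius \<delta> has
  the dilated symbol, see \<open>ball_avg_inv_fourier\<close>.\<close>

definition ball_symbol :: "real^'d::finite \<Rightarrow> complex" where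
  "ball_symbol \<xi> = (LINT y|unit_ball_measure. cis (y \<bullet> \<xi>))"

lemma ball_symbol_measurable [measurable]: "ball_symbol \<in> borel_measurable borel"
proof -
  interpret U: prob_space "unit_ball_measure :: (real^'d) measure" by (rule prob_space_unit_ball)
  show ?thesis unfolding ball_symbol_def[abs_def] by measurable
qed

lemma integrable_unit_ball:
  fixes f :: "real^'d::finite \<Rightarrow> 'b::{banach, second_countable_topology}"
  assumes [measurable]: "f \<in> borel_measurable borel" and B: "\<And>x. norm (f x) \<le> B"
  shows "integrable unit_ball_measure f"
proof -
  interpret U: prob_space "unit_ball_measure :: (real^'d) measure" by (rule prob_space_unit_ball)
  show ?thesis by (rule U.integrable_const_bound[of _ B]) (use B in auto)
qed

lemma norm_ball_symbol:
  fixes \<xi> :: "real^'d::finite"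
  shows "norm (ball_symbol \<xi>) \<le> 1"
proof -
  interpret U: prob_space "unit_ball_measure :: (real^'d) measure" by (rule prob_space_unit_ball)
  have "norm (ball_symbol \<xi>) \<le> (LINT y|unit_ball_measure. norm (cis (y \<bullet> \<xi>)))"
    unfolding ball_symbol_def by (rule integral_norm_bound)
  then show ?thesis using U.prob_space by simp
qed

lemma cnj_ball_symbol: "cnj (ball_symbol \<xi>) = ball_symbol (- \<xi>)"
  using Bochner_Integration.integral_cnj[of unit_ball_measure "\<lambda>y. cis (y \<bullet> \<xi>)"]
  by (simp add: ball_symbol_def cis_cnj)

text \<open>On the unit ball the phase is at most 1 in modulus, which is below \<pi> / 3, so the
  cosine is at least 1 / 2.\<close>

lemma ball_symbol_lower:
  fixes \<xi> :: "real^'d::finite"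
  assumes "norm \<xi> \<le> 1" shows "1 / 2 \<le> norm (ball_symbol \<xi>)"
proof -
  interpret U: prob_space "unit_ball_measure :: (real^'d) measure" by (rule prob_space_unit_ball)
  have c: "1 / 2 \<le> cos t" if "\<bar>t\<bar> \<le> 1" for t :: real
  proof -
    have "cos (pi / 3) \<le> cos \<bar>t\<bar>" using that pi_gt3 by (intro cos_monotone_0_pi_le) auto
    then show ?thesis by (simp add: cos_60)
  qed
  have "(LINT y|(unit_ball_measure :: (real^'d) measure). 1 / 2) \<le> (LINT y|unit_ball_measure. Re (cis (y \<bullet> \<xi>)))"
  proof (rule integral_mono_AE)
    show "integrable unit_ball_measure (\<lambda>y. Re (cis (y \<bullet> \<xi>)))"
      by (rule integrable_unit_ball[where B = 1]) auto
    show "AE y in unit_ball_measure. 1 / 2 \<le> Re (cis (y \<bullet> \<xi>))"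
    proof (rule AE_uniform_measureI)
      show "AE y in lborel. y \<in> ball 0 1 \<longrightarrow> 1 / 2 \<le> Re (cis (y \<bullet> \<xi>))"
      proof (intro AE_I2 impI)
        fix y :: "real^'d" assume "y \<in> ball 0 1"
        then have "\<bar>y \<bullet> \<xi>\<bar> \<le> 1 * 1"
          using assms by (intro order_trans[OF Cauchy_Schwarz_ineq2] mult_mono) auto
        then show "1 / 2 \<le> Re (cis (y \<bullet> \<xi>))" using c by simp
      qed
    qed auto
  qed auto
  also have "(LINT y|unit_ball_measure. Re (cis (y \<bullet> \<xi>))) = Re (ball_symbol \<xi>)"
    unfolding ball_symbol_def by (rule integral_Re) (rule integrable_unit_ball[where B = 1], auto)
  also have "\<dots> \<le> norm (ball_symbol \<xi>)" by (rule complex_Re_le_cmod)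
  finally show ?thesis using U.prob_space by simp
qed

lemma ball_avg_inv_fourier:
  fixes h :: "real^'d::finite \<Rightarrow> complex"
  assumes h: "integrable lborel h"
  shows "ball_avg \<delta> (inv_fourier h) x = inv_fourier (\<lambda>\<xi>. ball_symbol (\<delta> *\<^sub>R \<xi>) * h \<xi>) x"
proof -
  interpret U: prob_space "unit_ball_measure :: (real^'d) measure" by (rule prob_space_unit_ball)
  interpret P: pair_sigma_finite "unit_ball_measure :: (real^'d) measure" "lborel :: (real^'d) measure" ..
  have [measurable]: "h \<in> borel_measurable borel" using h by auto
  let ?c = "complex_of_real (1 / (2 * pi) ^ CARD('d))"
  have "integrable (unit_ball_measure \<Otimes>\<^sub>M lborel) (\<lambda>(y, \<xi>). cis ((x + \<delta> *\<^sub>R y) \<bullet> \<xi>) * h \<xi>)"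
  proof (rule P.Fubini_integrable)
    show "AE y in unit_ball_measure. integrable lborel (\<lambda>\<xi>. case (y, \<xi>) of (y, \<xi>) \<Rightarrow> cis ((x + \<delta> *\<^sub>R y) \<bullet> \<xi>) * h \<xi>)"
      using h by (auto intro!: integrable_cis_mult)
  qed (auto simp: norm_mult)
  note fub = P.Fubini_integral[OF this]
  have "ball_avg \<delta> (inv_fourier h) x = ?c * (LINT y|unit_ball_measure. LINT \<xi>|lborel. cis ((x + \<delta> *\<^sub>R y) \<bullet> \<xi>) * h \<xi>)"
    unfolding ball_avg_def inv_fourier_def by simp
  also have "(LINT y|unit_ball_measure. LINT \<xi>|lborel. cis ((x + \<delta> *\<^sub>R y) \<bullet> \<xi>) * h \<xi>)
     = (LINT \<xi>|lborel. LINT y|unit_ball_measure. cis ((x + \<delta> *\<^sub>R y) \<bullet> \<xi>) * h \<xi>)"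
    using fub by simp
  also have "\<dots> = (LINT \<xi>|lborel. cis (x \<bullet> \<xi>) * (ball_symbol (\<delta> *\<^sub>R \<xi>) * h \<xi>))"
  proof (rule Bochner_Integration.integral_cong[OF refl])
    fix \<xi>
    have "(LINT y|unit_ball_measure. cis ((x + \<delta> *\<^sub>R y) \<bullet> \<xi>) * h \<xi>) = (LINT y|unit_ball_measure. (cis (x \<bullet> \<xi>) * h \<xi>) * cis (y \<bullet> (\<delta> *\<^sub>R \<xi>)))"
      by (simp add: inner_add_left cis_mult[symmetric] mult_ac)
    then show "(LINT y|unit_ball_measure. cis ((x + \<delta> *\<^sub>R y) \<bullet> \<xi>) * h \<xi>) = cis (x \<bullet> \<xi>) * (ball_symbol (\<delta> *\<^sub>R \<xi>) * h \<xi>)"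
      by (simp add: ball_symbol_def)
  qed
  finally show ?thesis unfolding inv_fourier_def .
qed

lemma ball_avg_norm_le:
  fixes f :: "real^'d::finite \<Rightarrow> complex"
  assumes "\<And>x. ennreal (norm (f x)) \<le> B"
  shows "ennreal (norm (ball_avg \<delta> f x)) \<le> B"
proof -
  interpret U: prob_space "unit_ball_measure :: (real^'d) measure" by (rule prob_space_unit_ball)
  have "ennreal (norm (ball_avg \<delta> f x)) \<le> (\<integral>\<^sup>+y. ennreal (norm (f (x + \<delta> *\<^sub>R y))) \<partial>unit_ball_measure)"
    unfolding ball_avg_def by (rule norm_integral_le_nn_integral)
  also have "\<dots> \<le> (\<integral>\<^sup>+y. B \<partial>(unit_ball_measure :: (real^'d) measure))"
    by (intro nn_integral_mono assms)
  also have "\<dots> = B" using U.emeasure_space_1 by simp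
  finally show ?thesis .
qed

text \<open>A bound of Bernstein type: Jensen on the ball, then a change of variables, which yields
  the volume of a ball of radius \<delta> to the power -1 / \<rho>.\<close>

lemma ball_avg_Lp_le:
  fixes f :: "real^'d::finite \<Rightarrow> complex"
  assumes [measurable]: "f \<in> borel_measurable borel" and \<delta>: "\<delta> \<noteq> 0" and \<rho>: "1 \<le> \<rho>"
  shows "ennreal (norm (ball_avg \<delta> f x)) \<le> ennreal ((1 / (unit_ball_vol CARD('d) * \<bar>\<delta>\<bar> ^ CARD('d))) powr (1 / \<rho>))
     * Lp_norm lborel (ennreal \<rho>) (\<lambda>x. ennreal (norm (f x)))"
proof -
  let ?v = "unit_ball_vol (real CARD('d))"
  have v: "?v > 0" by (rule unit_ball_vol_card_pos)
  define w where "w y = indicator (ball 0 1) y / ?v" for y :: "real^'d"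
  have [measurable]: "ball (0::real^'d) 1 \<in> sets borel" by simp
  have [measurable]: "w \<in> borel_measurable borel" unfolding w_def[abs_def] by measurable
  have w0: "0 \<le> w y" for y using v by (simp add: w_def)
  have "(\<integral>\<^sup>+y. ennreal (w y) \<partial>lborel) = (\<integral>\<^sup>+y. ennreal (1 / ?v) * indicator (ball (0::real^'d) 1) y \<partial>lborel)"
    using v by (intro nn_integral_cong) (auto simp: w_def indicator_def)
  also have "\<dots> = 1" using v by (subst nn_integral_cmult_indicator) (auto simp: unit_ball_content ennreal_mult[symmetric])
  finally have w1: "(\<integral>\<^sup>+y. ennreal (w y) \<partial>lborel) = 1" .
  let ?F = "\<lambda>y. ennreal (norm (f (x + \<delta> *\<^sub>R y)))"
  let ?I = "\<integral>\<^sup>+x. ennreal (norm (f x) powr \<rho>) \<partial>lborel"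
  have "ennreal (norm (ball_avg \<delta> f x)) \<le> (\<integral>\<^sup>+y. ?F y \<partial>unit_ball_measure)"
    unfolding ball_avg_def by (rule norm_integral_le_nn_integral)
  also have "\<dots> = (\<integral>\<^sup>+y. ?F y * indicator (ball 0 1) y \<partial>lborel) / emeasure lborel (ball (0::real^'d) 1)"
    by (rule nn_integral_uniform_measure) auto
  also have "\<dots> = (\<integral>\<^sup>+y. ennreal (1 / ?v) * (?F y * indicator (ball 0 1) y) \<partial>lborel)"
    using v by (subst nn_integral_cmult) (auto simp: unit_ball_content divide_ennreal_def inverse_ennreal mult.commute inverse_eq_divide)
  also have "\<dots> = (\<integral>\<^sup>+y. ennreal (w y) * ?F y \<partial>lborel)"
    using v by (intro nn_integral_cong) (auto simp: w_def indicator_def)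
  finally have 1: "ennreal (norm (ball_avg \<delta> f x)) \<le> (\<integral>\<^sup>+y. ennreal (w y) * ?F y \<partial>lborel)" .
  have "enn_powr (\<integral>\<^sup>+y. ennreal (w y) * ?F y \<partial>lborel) \<rho> \<le> (\<integral>\<^sup>+y. ennreal (w y) * enn_powr (?F y) \<rho> \<partial>lborel)"
    by (intro weighted_jensen w0 w1 \<rho>) auto
  also have "\<dots> \<le> (\<integral>\<^sup>+y. ennreal (1 / ?v) * ennreal (norm (f (x + \<delta> *\<^sub>R y)) powr \<rho>) \<partial>lborel)"
    using v by (intro nn_integral_mono) (auto simp: w_def indicator_def intro!: mult_right_mono)
  also have "\<dots> = ennreal (1 / ?v) * (\<integral>\<^sup>+y. ennreal (norm (f (x + \<delta> *\<^sub>R y)) powr \<rho>) \<partial>lborel)"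
    by (intro nn_integral_cmult) measurable
  also have "\<dots> = ennreal (1 / (?v * \<bar>\<delta>\<bar> ^ CARD('d))) * ?I"
  proof -
    have "?I = ennreal (\<bar>\<delta>\<bar> ^ CARD('d)) * (\<integral>\<^sup>+y. ennreal (norm (f (x + \<delta> *\<^sub>R y)) powr \<rho>) \<partial>lborel)"
      using nn_integral_lborel_affine[of "\<lambda>x. ennreal (norm (f x) powr \<rho>)" \<delta> x] \<delta> by simp
    then show ?thesis using v \<delta> by (simp add: mult.assoc[symmetric] ennreal_mult[symmetric])
  qed
  finally have 2: "enn_powr (\<integral>\<^sup>+y. ennreal (w y) * ?F y \<partial>lborel) \<rho> \<le> ennreal (1 / (?v * \<bar>\<delta>\<bar> ^ CARD('d))) * ?I" .
  have id: "enn_powr (enn_powr z \<rho>) (1 / \<rho>) = z" for z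
    using \<rho> by (cases z) (auto simp: powr_powr)
  have "(\<integral>\<^sup>+y. ennreal (w y) * ?F y \<partial>lborel) \<le> enn_powr (ennreal (1 / (?v * \<bar>\<delta>\<bar> ^ CARD('d))) * ?I) (1 / \<rho>)"
    using enn_powr_mono[OF 2, of "1 / \<rho>"] \<rho> by (simp add: id)
  also have "\<dots> = ennreal ((1 / (?v * \<bar>\<delta>\<bar> ^ CARD('d))) powr (1 / \<rho>)) * Lp_norm lborel (ennreal \<rho>) (\<lambda>x. ennreal (norm (f x)))"
    using v \<delta> \<rho> by (subst enn_powr_mult) (auto simp: Lp_norm_def)
  finally show ?thesis using 1 by (rule order_trans[rotated])
qed

text \<open>A stand-in for the Bessel potential of order \<open>s\<close>: a superposition of averages over balls of
  radius \<open>2\<^sup>-\<^sup>l\<close>. Averaging twice makes the symbol nonnegative, so the sum cannot vanish.\<close>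

definition potential_symbol :: "real \<Rightarrow> real^'d::finite \<Rightarrow> real" where
  "potential_symbol s \<xi> = (\<Sum>l. 2 powr (- s * real l) * (norm (ball_symbol ((1 / 2 ^ l) *\<^sub>R \<xi>)))\<^sup>2)"

lemma summable_powr_neg: "s > 0 \<Longrightarrow> summable (\<lambda>l. 2 powr (- s * real l))"
proof -
  assume s: "s > 0"
  have "(\<lambda>l. 2 powr (- s * real l)) = (\<lambda>l. (2 powr (- s)) ^ l)"
    by (simp add: powr_powr powr_realpow[symmetric])
  moreover have "2 powr (- s) < 1" using s by (simp add: powr_less_one)
  ultimately show ?thesis by (simp add: summable_geometric)
qed

lemma summable_potential_symbol:
  "s > 0 \<Longrightarrow> summable (\<lambda>l. 2 powr (- s * real l) * (norm (ball_symbol ((1 / 2 ^ l) *\<^sub>R \<xi>)))\<^sup>2)"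
  by (rule summable_comparison_test'[OF summable_powr_neg[of s], of 0])
    (auto simp: abs_mult power_le_one_iff norm_ball_symbol intro!: mult_left_le)

lemma potential_symbol_measurable [measurable]: "potential_symbol s \<in> borel_measurable borel"
  unfolding potential_symbol_def[abs_def] by measurable

text \<open>One term is enough. For the least l with norm at most \<open>2^l\<close> the dilated
  frequency lies in the unit ball, where \<open>ball_symbol\<close> is at least 1 / 2, and
  \<open>2^l\<close> is at most twice the bracket.\<close>

lemma potential_symbol_lower:
  fixes \<xi> :: "real^'d::finite"
  assumes s: "s > 0"
  shows "2 powr (- s) / 4 * bracket \<xi> powr (- s) \<le> potential_symbol s \<xi>"
proof -
  have "\<exists>l. norm \<xi> \<le> 2 ^ l" using real_arch_pow[of 2 "norm \<xi>"] by (auto intro: less_imp_le)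
  define l where "l = (LEAST l. norm \<xi> \<le> 2 ^ l)"
  have l: "norm \<xi> \<le> 2 ^ l" unfolding l_def by (rule LeastI_ex) fact
  have l2: "2 ^ l \<le> 2 * bracket \<xi>"
  proof (cases l)
    case 0 then show ?thesis using bracket_ge_1[of \<xi>] by simp
  next
    case (Suc m)
    then have "\<not> norm \<xi> \<le> 2 ^ m" using not_less_Least[of m "\<lambda>l. norm \<xi> \<le> 2 ^ l"] unfolding l_def[symmetric] by simp
    then show ?thesis using Suc by (simp add: bracket_def)
  qed
  have "1 / 2 \<le> norm (ball_symbol ((1 / 2 ^ l) *\<^sub>R \<xi>))"
    using l by (intro ball_symbol_lower) simp
  then have "(1 / 2)\<^sup>2 \<le> (norm (ball_symbol ((1 / 2 ^ l) *\<^sub>R \<xi>)))\<^sup>2" by (intro power_mono) auto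
  then have J: "1 / 4 \<le> (norm (ball_symbol ((1 / 2 ^ l) *\<^sub>R \<xi>)))\<^sup>2" by (simp add: power2_eq_square)
  have "(2 * bracket \<xi>) powr (- s) \<le> (2 ^ l) powr (- s)"
    using s l2 by (intro powr_mono2') auto
  then have "2 powr (- s) * bracket \<xi> powr (- s) \<le> 2 powr (- s * real l)"
    by (simp add: powr_mult powr_realpow[symmetric] powr_powr mult.commute)
  then have "2 powr (- s) * bracket \<xi> powr (- s) * (1 / 4) \<le> 2 powr (- s * real l) * (norm (ball_symbol ((1 / 2 ^ l) *\<^sub>R \<xi>)))\<^sup>2"
    by (intro mult_mono J) auto
  also have "\<dots> \<le> potential_symbol s \<xi>"
    unfolding potential_symbol_def
    using sum_le_suminf[OF summable_potential_symbol[OF s], of "{l}" \<xi>] by simp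
  finally show ?thesis by simp
qed

text \<open>Sobolev embedding. With f the inverse transform of the quotient, the inverse transform
  of h is the sum over l of \<open>2 powr (- s * l)\<close> times a double average of f over balls
  of radius \<open>2^-l\<close>. The inner average costs \<open>2 powr (l * d / \<rho>)\<close> in
  passing to the supremum and the outer one nothing, so the series converges because s exceeds d /
  \<rho>.\<close>

lemma sup_le_potential_Lp:
  fixes s \<rho> :: real
  assumes s: "s > 0" and \<rho>: "1 \<le> \<rho>" "real CARD('d::finite) < \<rho> * s"
  obtains C where "C \<ge> 0"
    "\<And>h :: real^'d \<Rightarrow> complex. integrable lborel h \<Longrightarrow> integrable lborel (\<lambda>\<xi>. h \<xi> / of_real (potential_symbol s \<xi>)) \<Longrightarrow>
      (\<forall>x. ennreal (norm (inv_fourier h x)) \<le>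
        ennreal C * Lp_norm lborel (ennreal \<rho>) (\<lambda>x. ennreal (norm (inv_fourier (\<lambda>\<xi>. h \<xi> / of_real (potential_symbol s \<xi>)) x))))"
proof -
  let ?d = "real CARD('d)"
  let ?v = "unit_ball_vol ?d"
  have v: "?v > 0" by (rule unit_ball_vol_card_pos)
  \<comment> \<open>The exponent left after paying the loss d / \<rho>; its positivity is the
    hypothesis on \<rho>.\<close>
  define a where "a = s - ?d / \<rho>"
  have a: "a > 0" using \<rho> by (simp add: a_def divide_less_eq mult.commute)
  define K where "K = (1 / ?v) powr (1 / \<rho>)"
  define C where "C = (\<Sum>l. K * 2 powr (- a * real l))"
  have sumC: "summable (\<lambda>l. K * 2 powr (- a * real l))"
    by (intro summable_mult summable_powr_neg a)
  have K: "K \<ge> 0" by (simp add: K_def)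
  show ?thesis
  proof (rule that[of C])
    show "C \<ge> 0" unfolding C_def using K by (intro suminf_nonneg sumC) auto
    fix h :: "real^'d \<Rightarrow> complex"
    assume h: "integrable lborel h" and Ph: "integrable lborel (\<lambda>\<xi>. h \<xi> / of_real (potential_symbol s \<xi>))"
    let ?p = "\<lambda>\<xi>. h \<xi> / of_real (potential_symbol s \<xi>)"
    let ?f = "inv_fourier ?p"
    let ?N = "Lp_norm lborel (ennreal \<rho>) (\<lambda>x. ennreal (norm (?f x)))"
    have [measurable]: "h \<in> borel_measurable borel" using h by auto
    define b where "b l \<xi> = ball_symbol ((1 / 2 ^ l) *\<^sub>R \<xi>)" for l :: nat and \<xi> :: "real^'d"
    have [measurable]: "b l \<in> borel_measurable borel" for l unfolding b_def[abs_def] by measurable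
    have b1: "norm (b l \<xi>) \<le> 1" for l \<xi> by (simp add: b_def norm_ball_symbol)
    have ib: "integrable lborel (\<lambda>\<xi>. b l \<xi> * ?p \<xi>)" for l
    proof (rule Bochner_Integration.integrable_bound[OF Ph])
      have "norm (b l \<xi> * y) \<le> norm y" for \<xi> y
        using mult_right_mono[OF b1[of l \<xi>], of "norm y"] by (simp add: norm_mult)
      then show "AE \<xi> in lborel. norm (b l \<xi> * ?p \<xi>) \<le> norm (?p \<xi>)" by (intro AE_I2)
    qed measurable
    \<comment> \<open>The opposite sign of the second radius conjugates the symbol, so the two
      averages together have symbol \<open>(norm (b l \<xi>))\<^sup>2\<close>.\<close>
    define e where "e l x = ball_avg (- 1 / 2 ^ l) (ball_avg (1 / 2 ^ l) ?f) x" for l :: nat and x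
    have e_eq: "e l x = inv_fourier (\<lambda>\<xi>. of_real ((norm (b l \<xi>))\<^sup>2) * ?p \<xi>) x" for l x
    proof -
      have 1: "ball_avg (1 / 2 ^ l) ?f = inv_fourier (\<lambda>\<xi>. b l \<xi> * ?p \<xi>)"
        using ball_avg_inv_fourier[OF Ph] by (auto simp: b_def)
      have "e l x = inv_fourier (\<lambda>\<xi>. ball_symbol ((- 1 / 2 ^ l) *\<^sub>R \<xi>) * (b l \<xi> * ?p \<xi>)) x"
        unfolding e_def 1 by (rule ball_avg_inv_fourier[OF ib])
      also have "(\<lambda>\<xi>. ball_symbol ((- 1 / 2 ^ l) *\<^sub>R \<xi>) * (b l \<xi> * ?p \<xi>)) = (\<lambda>\<xi>. of_real ((norm (b l \<xi>))\<^sup>2) * ?p \<xi>)"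
      proof
        fix \<xi>
        have "ball_symbol ((- 1 / 2 ^ l) *\<^sub>R \<xi>) = cnj (b l \<xi>)"
          by (simp add: b_def cnj_ball_symbol)
        then show "ball_symbol ((- 1 / 2 ^ l) *\<^sub>R \<xi>) * (b l \<xi> * ?p \<xi>) = of_real ((norm (b l \<xi>))\<^sup>2) * ?p \<xi>"
          by (simp only: complex_norm_square) (simp add: mult_ac)
      qed
      finally show ?thesis .
    qed
    have e_le: "ennreal (norm (e l x)) \<le> ennreal (K * 2 powr (?d / \<rho> * l)) * ?N" for l x
    proof -
      have "ennreal (norm (ball_avg (1 / 2 ^ l) ?f x)) \<le> ennreal ((1 / (?v * \<bar>1 / 2 ^ l\<bar> ^ CARD('d))) powr (1 / \<rho>)) * ?N" for x
        by (rule ball_avg_Lp_le) (use \<rho> Ph in auto)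
      moreover have "(1 / (?v * \<bar>1 / 2 ^ l\<bar> ^ CARD('d))) powr (1 / \<rho>) = K * 2 powr (?d / \<rho> * l)"
      proof -
        have "(1 / (?v * \<bar>1 / 2 ^ l\<bar> ^ CARD('d))) = (1 / ?v) * 2 powr (l * ?d)"
          by (simp add: power_one_over powr_realpow[symmetric] powr_powr)
        also have "\<dots> powr (1 / \<rho>) = K * 2 powr (?d / \<rho> * l)"
          using v unfolding powr_mult[of "1 / ?v"] by (simp add: K_def powr_powr mult.commute)
        finally show ?thesis .
      qed
      ultimately have "ennreal (norm (ball_avg (1 / 2 ^ l) ?f x)) \<le> ennreal (K * 2 powr (?d / \<rho> * l)) * ?N" for x
        by (simp only:)
      then show ?thesis unfolding e_def by (rule ball_avg_norm_le)
    qed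
    show "\<forall>x. ennreal (norm (inv_fourier h x)) \<le> ennreal C * ?N"
    proof
      fix x
      let ?c = "complex_of_real (1 / (2 * pi) ^ CARD('d))"
      let ?G = "\<lambda>l \<xi>. of_real (2 powr (- s * real l)) * (of_real ((norm (b l \<xi>))\<^sup>2) * ?p \<xi>)"
      have nG: "norm (?G l \<xi>) \<le> 2 powr (- s * real l) * norm (?p \<xi>)" for l \<xi>
      proof -
        have "norm (of_real u * (of_real (t\<^sup>2) * y)) \<le> u * norm y" if "0 \<le> u" "0 \<le> t" "t \<le> 1" for u t and y :: complex
        proof -
          have "norm (of_real u * (of_real (t\<^sup>2) * y)) = u * (t\<^sup>2 * norm y)"
            using that by (simp add: norm_mult norm_power)
          also have "\<dots> \<le> u * (1 * norm y)"
            using that by (intro mult_left_mono mult_right_mono power_le_one) auto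
          finally show ?thesis by simp
        qed
        note aux = this
        show ?thesis by (rule aux) (use b1[of l \<xi>] in auto)
      qed
      have ncis: "norm (cis r * y) = norm y" for r y by (simp add: norm_mult)
      have iG: "integrable lborel (\<lambda>\<xi>. cis (x \<bullet> \<xi>) * ?G l \<xi>)" for l
      proof (rule integrable_cis_mult)
        show "integrable lborel (?G l)"
        proof (rule Bochner_Integration.integrable_bound)
          show "integrable lborel (\<lambda>\<xi>. 2 powr (- s * real l) *\<^sub>R ?p \<xi>)" using Ph by (intro integrable_scaleR_right)
          show "AE \<xi> in lborel. norm (?G l \<xi>) \<le> norm (2 powr (- s * real l) *\<^sub>R ?p \<xi>)"
            using nG by (auto simp del: norm_divide)
        qed measurable
      qed measurable
      have pos: "potential_symbol s \<xi> > 0" for \<xi> :: "real^'d"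
        using potential_symbol_lower[OF s, of \<xi>] by (smt (verit) divide_pos_pos mult_pos_pos powr_gt_zero bracket_neq_0 zero_less_numeral)
      have sums: "(\<lambda>l. ?G l \<xi>) sums h \<xi>" for \<xi>
      proof -
        have "(\<lambda>l. 2 powr (- s * real l) * (norm (b l \<xi>))\<^sup>2) sums potential_symbol s \<xi>"
          unfolding potential_symbol_def b_def by (intro summable_sums summable_potential_symbol s)
        then have "(\<lambda>l. complex_of_real (2 powr (- s * real l) * (norm (b l \<xi>))\<^sup>2) * ?p \<xi>) sums (of_real (potential_symbol s \<xi>) * ?p \<xi>)"
          by (intro sums_mult2 sums_of_real)
        then show ?thesis using pos[of \<xi>] by (simp add: mult.assoc)
      qed
      have "(\<lambda>l. LINT \<xi>|lborel. cis (x \<bullet> \<xi>) * ?G l \<xi>) sums (LINT \<xi>|lborel. (\<Sum>l. cis (x \<bullet> \<xi>) * ?G l \<xi>))"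
      proof (rule sums_integral[OF iG])
        show "AE \<xi> in lborel. summable (\<lambda>l. norm (cis (x \<bullet> \<xi>) * ?G l \<xi>))"
        proof (rule AE_I2)
          fix \<xi> show "summable (\<lambda>l. norm (cis (x \<bullet> \<xi>) * ?G l \<xi>))"
          proof (rule summable_comparison_test')
            show "summable (\<lambda>l. 2 powr (- s * real l) * norm (?p \<xi>))"
              by (intro summable_mult2 summable_powr_neg s)
            show "norm (norm (cis (x \<bullet> \<xi>) * ?G l \<xi>)) \<le> 2 powr (- s * real l) * norm (?p \<xi>)" for l
              using nG[of l \<xi>] by (simp only: ncis real_norm_def abs_norm_cancel)
          qed
        qed
        show "summable (\<lambda>l. LINT \<xi>|lborel. norm (cis (x \<bullet> \<xi>) * ?G l \<xi>))"
        proof (rule summable_comparison_test')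
          show "summable (\<lambda>l. 2 powr (- s * real l) * (LINT \<xi>|lborel. norm (?p \<xi>)))"
            by (intro summable_mult2 summable_powr_neg s)
          fix l :: nat
          have "(LINT \<xi>|lborel. norm (cis (x \<bullet> \<xi>) * ?G l \<xi>)) \<le> (LINT \<xi>|lborel. 2 powr (- s * real l) * norm (?p \<xi>))"
            using nG[of l] by (intro integral_mono integrable_norm iG integrable_mult_right Ph) (simp only: ncis)
          then show "norm (LINT \<xi>|lborel. norm (cis (x \<bullet> \<xi>) * ?G l \<xi>)) \<le> 2 powr (- s * real l) * (LINT \<xi>|lborel. norm (?p \<xi>))"
            by (simp only: real_norm_def abs_of_nonneg[OF Bochner_Integration.integral_nonneg[OF norm_ge_zero]] integral_mult_right_zero)
        qed
      qed
      also have "(\<lambda>\<xi>. \<Sum>l. cis (x \<bullet> \<xi>) * ?G l \<xi>) = (\<lambda>\<xi>. cis (x \<bullet> \<xi>) * h \<xi>)"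
        using sums_mult[OF sums] by (auto simp: sums_iff)
      finally have "(\<lambda>l. ?c * (LINT \<xi>|lborel. cis (x \<bullet> \<xi>) * ?G l \<xi>)) sums inv_fourier h x"
        unfolding inv_fourier_def by (rule sums_mult)
      moreover have "?c * (LINT \<xi>|lborel. cis (x \<bullet> \<xi>) * ?G l \<xi>) = of_real (2 powr (- s * real l)) * e l x" for l
      proof -
        have "(LINT \<xi>|lborel. cis (x \<bullet> \<xi>) * ?G l \<xi>)
            = of_real (2 powr (- s * real l)) * (LINT \<xi>|lborel. cis (x \<bullet> \<xi>) * (of_real ((norm (b l \<xi>))\<^sup>2) * ?p \<xi>))"
          by (subst integral_mult_right_zero[symmetric]) (simp only: mult.left_commute)
        then show ?thesis unfolding e_eq inv_fourier_def by (simp only: mult.left_commute)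
      qed
      ultimately have S: "(\<lambda>l. of_real (2 powr (- s * real l)) * e l x) sums inv_fourier h x" by simp
      have eb: "ennreal (norm (of_real (2 powr (- s * real l)) * e l x)) \<le> ennreal (K * 2 powr (- a * real l)) * ?N" for l
      proof -
        have "ennreal (norm (of_real (2 powr (- s * real l)) * e l x)) = ennreal (2 powr (- s * real l)) * ennreal (norm (e l x))"
          by (simp add: norm_mult ennreal_mult)
        also have "\<dots> \<le> ennreal (2 powr (- s * real l)) * (ennreal (K * 2 powr (?d / \<rho> * l)) * ?N)"
          by (intro mult_left_mono e_le) auto
        also have "\<dots> = ennreal (2 powr (- s * real l) * (K * 2 powr (?d / \<rho> * l))) * ?N"
          using K by (simp add: ennreal_mult mult.assoc)
        also have "2 powr (- s * real l) * (K * 2 powr (?d / \<rho> * l)) = K * 2 powr (- a * real l)"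
          by (simp add: a_def powr_add[symmetric] algebra_simps)
        finally show ?thesis .
      qed
      show "ennreal (norm (inv_fourier h x)) \<le> ennreal C * ?N"
      proof (cases "ennreal C * ?N")
        case (real B)
        have "norm (inv_fourier h x) \<le> B"
        proof (rule LIMSEQ_le_const2)
          show "(\<lambda>n. norm (\<Sum>l<n. of_real (2 powr (- s * real l)) * e l x)) \<longlonglongrightarrow> norm (inv_fourier h x)"
            using S unfolding sums_def by (rule tendsto_norm)
          have "norm (\<Sum>l<n. of_real (2 powr (- s * real l)) * e l x) \<le> B" for n :: nat
          proof -
          have "ennreal (norm (\<Sum>l<n. of_real (2 powr (- s * real l)) * e l x)) \<le> ennreal (\<Sum>l<n. norm (of_real (2 powr (- s * real l)) * e l x))"
            by (intro ennreal_leI norm_sum)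
          also have "\<dots> = (\<Sum>l<n. ennreal (norm (of_real (2 powr (- s * real l)) * e l x)))"
            by (rule sum_ennreal[symmetric]) auto
          also have "\<dots> \<le> (\<Sum>l<n. ennreal (K * 2 powr (- a * real l)) * ?N)"
            by (intro sum_mono eb)
          also have "\<dots> = ennreal (\<Sum>l<n. K * 2 powr (- a * real l)) * ?N"
            using K by (simp add: sum_distrib_right[symmetric] sum_ennreal)
          also have "\<dots> \<le> ennreal C * ?N"
            unfolding C_def using K by (intro mult_right_mono ennreal_leI sum_le_suminf sumC) auto
          finally show ?thesis
            using real by (simp add: ennreal_le_iff)
          qed
          then show "\<exists>n0. \<forall>n\<ge>n0. norm (\<Sum>l<n. of_real (2 powr (- s * real l)) * e l x) \<le> B" by blast
        qed
        then show ?thesis using real by (simp add: ennreal_leI)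
      qed simp
    qed
  qed
qed

section \<open>Random series of functions\<close>

lemma enn_powr_strict_mono: "x < y \<Longrightarrow> 0 < p \<Longrightarrow> enn_powr x p < enn_powr y p"
  by (cases x; cases y) (auto simp: ennreal_less_iff intro!: ennreal_lessI powr_less_mono2 elim: order.strict_trans1[rotated])

lemma enn_powr_inverse: "0 < p \<Longrightarrow> enn_powr (enn_powr x p) (1 / p) = x" "0 < p \<Longrightarrow> enn_powr (enn_powr x (1 / p)) p = x"
  by (cases x; simp add: powr_powr)+

lemma enn_powr_liminf_le:
  fixes a :: "nat \<Rightarrow> ennreal"
  assumes p: "0 < p"
  shows "enn_powr (liminf a) p \<le> liminf (\<lambda>n. enn_powr (a n) p)"
  unfolding le_Liminf_iff
proof (intro allI impI)
  fix y assume "y < enn_powr (liminf a) p"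
  then have "enn_powr y (1 / p) < enn_powr (enn_powr (liminf a) p) (1 / p)"
    using p by (intro enn_powr_strict_mono) auto
  then have "enn_powr y (1 / p) < liminf a" using p by (simp add: enn_powr_inverse)
  then have "\<forall>\<^sub>F n in sequentially. enn_powr y (1 / p) < a n"
    using le_Liminf_iff[of "liminf a" sequentially a] by auto
  then show "\<forall>\<^sub>F n in sequentially. y < enn_powr (a n) p"
  proof eventually_elim
    case (elim n)
    from enn_powr_strict_mono[OF this p] show ?case using p by (simp add: enn_powr_inverse)
  qed
qed

lemma power_liminf_le:
  fixes a :: "nat \<Rightarrow> ennreal"
  assumes k: "k \<ge> 1" shows "(liminf a) ^ k \<le> liminf (\<lambda>n. a n ^ k)"
proof -
  have "x ^ k = enn_powr x (real k)" for x
    using k by (cases x) (simp_all add: powr_realpow' ennreal_power top_power_ennreal)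
  then show ?thesis using enn_powr_liminf_le[of "real k" a] k by simp
qed

lemma Lp_norm_liminf:
  assumes r: "0 < r" and m: "\<And>n. u n \<in> borel_measurable L" and lim: "AE x in L. (\<lambda>n. u n x) \<longlonglongrightarrow> v x"
  shows "Lp_norm L (ennreal r) v \<le> liminf (\<lambda>n. Lp_norm L (ennreal r) (u n))"
proof -
  have "(\<integral>\<^sup>+x. enn_powr (v x) r \<partial>L) \<le> (\<integral>\<^sup>+x. liminf (\<lambda>n. enn_powr (u n x) r) \<partial>L)"
  proof (rule nn_integral_mono_AE)
    show "AE x in L. enn_powr (v x) r \<le> liminf (\<lambda>n. enn_powr (u n x) r)"
      using lim
    proof eventually_elim
      case (elim x)
      then have "v x = liminf (\<lambda>n. u n x)" using lim_imp_Liminf by force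
      then show ?case using enn_powr_liminf_le[OF r, of "\<lambda>n. u n x"] by simp
    qed
  qed
  also have "\<dots> \<le> liminf (\<lambda>n. \<integral>\<^sup>+x. enn_powr (u n x) r \<partial>L)"
    using m by (intro nn_integral_liminf) auto
  finally have "enn_powr (\<integral>\<^sup>+x. enn_powr (v x) r \<partial>L) (1 / r) \<le> enn_powr (liminf (\<lambda>n. \<integral>\<^sup>+x. enn_powr (u n x) r \<partial>L)) (1 / r)"
    using r by (intro enn_powr_mono) auto
  also have "\<dots> \<le> liminf (\<lambda>n. enn_powr (\<integral>\<^sup>+x. enn_powr (u n x) r \<partial>L) (1 / r))"
    using r by (intro enn_powr_liminf_le) auto
  finally show ?thesis using r by (simp add: Lp_norm_def)
qed

lemma moment_liminf_le:
  fixes y :: "nat \<Rightarrow> 'a \<Rightarrow> ennreal"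
  assumes k: "k \<ge> 1" and m: "\<And>n. y n \<in> borel_measurable N"
    and le: "AE \<omega> in N. Y \<omega> \<le> liminf (\<lambda>n. y n \<omega>)" and B: "\<And>n. (\<integral>\<^sup>+\<omega>. y n \<omega> ^ k \<partial>N) \<le> B"
  shows "(\<integral>\<^sup>+\<omega>. Y \<omega> ^ k \<partial>N) \<le> B"
proof -
  have "(\<integral>\<^sup>+\<omega>. Y \<omega> ^ k \<partial>N) \<le> (\<integral>\<^sup>+\<omega>. liminf (\<lambda>n. y n \<omega> ^ k) \<partial>N)"
  proof (rule nn_integral_mono_AE)
    show "AE \<omega> in N. Y \<omega> ^ k \<le> liminf (\<lambda>n. y n \<omega> ^ k)"
      using le
    proof eventually_elim
      case (elim \<omega>)
      then have "Y \<omega> ^ k \<le> (liminf (\<lambda>n. y n \<omega>)) ^ k" by (intro power_mono) auto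
      then show ?case using power_liminf_le[OF k, of "\<lambda>n. y n \<omega>"] by (rule order_trans)
    qed
  qed
  also have "\<dots> \<le> liminf (\<lambda>n. \<integral>\<^sup>+\<omega>. y n \<omega> ^ k \<partial>N)"
    using m by (intro nn_integral_liminf) auto
  also have "\<dots> \<le> B" using B by (intro Liminf_le) auto
  finally show ?thesis .
qed

text \<open>The geometric weights in the energy give \<open>\<bar>D\<^sub>n p\<bar> \<le> 2\<^sup>n D\<^sub>n\<^sup>2 + 2\<^sup>-\<^sup>n p\<^sup>2\<close>, so that the increments \<open>D\<^sub>n\<close>
  are summable with a dominating function.\<close>

lemma increment_le: "d * p \<le> 2 ^ n * d\<^sup>2 + (1 / 2) ^ n * (p :: real)\<^sup>2"
proof -
  define a where "a = sqrt (2 ^ n)"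
  have a: "a > 0" "a\<^sup>2 = 2 ^ n" by (simp_all add: a_def)
  have "2 * (d * p) = 2 * (a * d) * (p / a)" using a by simp
  also have "\<dots> \<le> (a * d)\<^sup>2 + (p / a)\<^sup>2"
    by (rule sum_squares_bound)
  also have "(a * d)\<^sup>2 + (p / a)\<^sup>2 = 2 ^ n * d\<^sup>2 + (1 / 2) ^ n * p\<^sup>2"
    using a by (simp add: power_mult_distrib power_divide power_one_over)
  finally have "2 * (d * p) \<le> 2 ^ n * d\<^sup>2 + (1 / 2) ^ n * p\<^sup>2" .
  moreover have "0 \<le> 2 ^ n * d\<^sup>2 + (1 / 2) ^ n * p\<^sup>2" by simp
  ultimately show ?thesis by linarith
qed

text \<open>The interface is abstract because two families of modes are used with the same K,
  \<theta>, \<kappa> and A: those of the solution, and those with symbol divided by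
  \<open>potential_symbol\<close>. K i bounds mode i uniformly, \<theta> plays the part of the
  volume on which it lives, \<kappa> is the total size. The tail rate \<open>(1 / 8)^n\<close>
  outweighs the factor \<open>2^n\<close> in the energy.\<close>

locale random_series = random_coefficients M g c0
  for M :: "'w measure" and g :: "nat \<Rightarrow> int^'d::{finite,linorder} \<Rightarrow> 'w \<Rightarrow> complex" and c0 :: real +
  fixes z :: "nat \<times> (int, 'd) vec \<Rightarrow> real \<Rightarrow> (real, 'd) vec \<Rightarrow> complex"
    and K :: "nat \<times> (int, 'd) vec \<Rightarrow> real" and \<theta> \<kappa> :: real and I :: "real set"
    and A :: "nat \<Rightarrow> (nat \<times> (int, 'd) vec) set"
  assumes z_measurable: "(\<lambda>(t, x). z i t x) \<in> borel_measurable (borel \<Otimes>\<^sub>M borel)"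
    and z_sup: "i \<in> {0, 1} \<times> UNIV \<Longrightarrow> t \<in> I \<Longrightarrow> norm (z i t x) \<le> K i"
    and z_L2: "i \<in> {0, 1} \<times> UNIV \<Longrightarrow> t \<in> I \<Longrightarrow> (\<integral>\<^sup>+x. ennreal ((norm (z i t x))\<^sup>2) \<partial>lborel) \<le> ennreal (\<theta> * (K i)\<^sup>2)"
    and \<theta>_nonneg: "\<theta> \<ge> 0" and \<kappa>_nonneg: "\<kappa> \<ge> 0"
    and A_finite: "finite (A n)" and A_sub: "A n \<subseteq> {0, 1} \<times> UNIV" and A_mono: "A n \<subseteq> A (Suc n)"
    and K_sum: "finite F \<Longrightarrow> F \<subseteq> {0, 1} \<times> UNIV \<Longrightarrow> (\<Sum>i\<in>F. (K i)\<^sup>2) \<le> \<kappa>\<^sup>2"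
    and K_tail: "(\<Sum>i\<in>A (Suc n) - A n. (K i)\<^sup>2) \<le> (1 / 8) ^ n"
begin

definition psum :: "(nat \<times> (int, 'd) vec) set \<Rightarrow> 'w \<Rightarrow> real \<Rightarrow> (real, 'd) vec \<Rightarrow> complex" where
  "psum F \<omega> t x = (\<Sum>i\<in>F. g (fst i) (snd i) \<omega> * z i t x)"

text \<open>\<open>lim\<close> assigns a value also at points of divergence, so the function is
  defined and jointly measurable everywhere; its values matter only where the energy is
  finite.\<close>

definition series :: "'w \<Rightarrow> real \<Rightarrow> (real, 'd) vec \<Rightarrow> complex" where
  "series \<omega> t x = lim (\<lambda>n. psum (A n) \<omega> t x)"

definition energy :: "'w \<Rightarrow> real \<Rightarrow> (real, 'd) vec \<Rightarrow> ennreal" where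
  "energy \<omega> t x = (\<Sum>n. ennreal (2 ^ n * (norm (psum (A (Suc n) - A n) \<omega> t x))\<^sup>2))"

lemma z_measurable' [measurable (raw)]:
  assumes "b \<in> borel_measurable N" "c \<in> borel_measurable N"
  shows "(\<lambda>p. z i (b p) (c p)) \<in> borel_measurable N"
  using measurable_compose[OF measurable_Pair[OF assms] z_measurable[of i]] by simp

lemma psum_measurable:
  assumes F: "F \<subseteq> {0, 1} \<times> UNIV" and [measurable]: "a \<in> measurable N M" "b \<in> borel_measurable N" "c \<in> borel_measurable N"
  shows "(\<lambda>p. psum F (a p) (b p) (c p)) \<in> borel_measurable N"
  unfolding psum_def
proof (rule borel_measurable_sum)
  fix i assume "i \<in> F"
  then have [measurable]: "g (fst i) (snd i) \<in> borel_measurable M"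
    using F by (intro random_variable) auto
  show "(\<lambda>p. g (fst i) (snd i) (a p) * z i (b p) (c p)) \<in> borel_measurable N" by measurable
qed

lemma psum_A_measurable [measurable (raw)]:
  assumes "a \<in> measurable N M" "b \<in> borel_measurable N" "c \<in> borel_measurable N"
  shows "(\<lambda>p. psum (A n) (a p) (b p) (c p)) \<in> borel_measurable N"
  by (rule psum_measurable[OF A_sub assms])

lemma psum_diff_measurable [measurable (raw)]:
  assumes "a \<in> measurable N M" "b \<in> borel_measurable N" "c \<in> borel_measurable N"
  shows "(\<lambda>p. psum (A (Suc n) - A n) (a p) (b p) (c p)) \<in> borel_measurable N"
  using A_sub by (intro psum_measurable assms) auto

lemma series_measurable [measurable (raw)]:
  assumes [measurable]: "a \<in> measurable N M" "b \<in> borel_measurable N" "c \<in> borel_measurable N"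
  shows "(\<lambda>p. series (a p) (b p) (c p)) \<in> borel_measurable N"
  unfolding series_def by (rule borel_measurable_lim_metric) measurable

lemma energy_measurable [measurable (raw)]:
  assumes [measurable]: "a \<in> measurable N M" "b \<in> borel_measurable N" "c \<in> borel_measurable N"
  shows "(\<lambda>p. energy (a p) (b p) (c p)) \<in> borel_measurable N"
  unfolding energy_def by measurable

lemma psum_moment:
  assumes "finite F" "F \<subseteq> {0, 1} \<times> UNIV" "k \<ge> 1"
  shows "(\<integral>\<^sup>+\<omega>. ennreal (norm (psum F \<omega> t x) ^ k) \<partial>M) \<le> ennreal ((32 * exp c0 * sqrt k * sqrt (\<Sum>i\<in>F. (norm (z i t x))\<^sup>2)) ^ k)"
  unfolding psum_def by (rule khinchine[OF assms])

lemma sum_z_L2: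
  assumes F: "finite F" "F \<subseteq> {0, 1} \<times> UNIV" and t: "t \<in> I"
  shows "(\<integral>\<^sup>+x. ennreal (\<Sum>i\<in>F. (norm (z i t x))\<^sup>2) \<partial>lborel) \<le> ennreal (\<theta> * (\<Sum>i\<in>F. (K i)\<^sup>2))"
proof -
  have "(\<integral>\<^sup>+x. ennreal (\<Sum>i\<in>F. (norm (z i t x))\<^sup>2) \<partial>lborel) = (\<integral>\<^sup>+x. (\<Sum>i\<in>F. ennreal ((norm (z i t x))\<^sup>2)) \<partial>lborel)"
    by simp
  also have "\<dots> = (\<Sum>i\<in>F. \<integral>\<^sup>+x. ennreal ((norm (z i t x))\<^sup>2) \<partial>lborel)"
    by (rule nn_integral_sum) measurable
  also have "\<dots> \<le> (\<Sum>i\<in>F. ennreal (\<theta> * (K i)\<^sup>2))"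
    using F t by (intro sum_mono z_L2) auto
  also have "\<dots> = ennreal (\<theta> * (\<Sum>i\<in>F. (K i)\<^sup>2))"
    using \<theta>_nonneg by (simp add: sum_ennreal sum_distrib_left)
  finally show ?thesis .
qed

text \<open>Second moments of the increments, from \<open>psum_moment\<close> with k = 2: the weight
  \<open>2^n\<close> against the tail \<open>8^-n\<close> leaves a geometric series of ratio 1 /
  4.\<close>

lemma energy_integral_finite:
  assumes t: "t \<in> I"
  shows "(\<integral>\<^sup>+\<omega>. \<integral>\<^sup>+x. energy \<omega> t x \<partial>lborel \<partial>M) < \<infinity>" and "(\<integral>\<^sup>+x. \<integral>\<^sup>+\<omega>. energy \<omega> t x \<partial>M \<partial>lborel) < \<infinity>"
proof -
  interpret P: pair_sigma_finite M "lborel :: (real, 'd) vec measure" ..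
  define D where "D = 32 * exp c0"
  have D: "D \<ge> 0" by (simp add: D_def)
  let ?d = "\<lambda>n \<omega> x. ennreal (2 ^ n * (norm (psum (A (Suc n) - A n) \<omega> t x))\<^sup>2)"
  have n: "(\<integral>\<^sup>+x. \<integral>\<^sup>+\<omega>. ?d n \<omega> x \<partial>M \<partial>lborel) \<le> ennreal (2 * D\<^sup>2 * \<theta> * (1 / 4) ^ n)" for n
  proof -
    let ?F = "A (Suc n) - A n"
    have F: "finite ?F" "?F \<subseteq> {0, 1} \<times> UNIV" using A_finite A_sub by auto
    have "(\<integral>\<^sup>+\<omega>. ?d n \<omega> x \<partial>M) \<le> ennreal (2 ^ n * (2 * D\<^sup>2)) * ennreal (\<Sum>i\<in>?F. (norm (z i t x))\<^sup>2)" for x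
    proof -
      have "(\<integral>\<^sup>+\<omega>. ?d n \<omega> x \<partial>M) = (\<integral>\<^sup>+\<omega>. ennreal (2 ^ n) * ennreal ((norm (psum ?F \<omega> t x))\<^sup>2) \<partial>M)"
        by (simp add: ennreal_mult)
      also have "\<dots> = ennreal (2 ^ n) * (\<integral>\<^sup>+\<omega>. ennreal ((norm (psum ?F \<omega> t x))\<^sup>2) \<partial>M)"
        by (intro nn_integral_cmult) measurable
      also have "\<dots> \<le> ennreal (2 ^ n) * ennreal ((D * sqrt 2 * sqrt (\<Sum>i\<in>?F. (norm (z i t x))\<^sup>2))\<^sup>2)"
        using psum_moment[OF F, of 2 t x] by (intro mult_left_mono) (auto simp: D_def)
      also have "(D * sqrt 2 * sqrt (\<Sum>i\<in>?F. (norm (z i t x))\<^sup>2))\<^sup>2 = 2 * D\<^sup>2 * (\<Sum>i\<in>?F. (norm (z i t x))\<^sup>2)"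
        by (simp add: power_mult_distrib sum_nonneg)
      finally show ?thesis by (simp add: ennreal_mult[symmetric] sum_nonneg mult_ac)
    qed
    then have "(\<integral>\<^sup>+x. \<integral>\<^sup>+\<omega>. ?d n \<omega> x \<partial>M \<partial>lborel) \<le> (\<integral>\<^sup>+x. ennreal (2 ^ n * (2 * D\<^sup>2)) * ennreal (\<Sum>i\<in>?F. (norm (z i t x))\<^sup>2) \<partial>lborel)"
      by (intro nn_integral_mono)
    also have "\<dots> = ennreal (2 ^ n * (2 * D\<^sup>2)) * (\<integral>\<^sup>+x. ennreal (\<Sum>i\<in>?F. (norm (z i t x))\<^sup>2) \<partial>lborel)"
      by (intro nn_integral_cmult) measurable
    also have "\<dots> \<le> ennreal (2 ^ n * (2 * D\<^sup>2)) * ennreal (\<theta> * (1 / 8) ^ n)"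
      by (intro mult_left_mono order_trans[OF sum_z_L2[OF F t]] ennreal_leI K_tail \<theta>_nonneg) auto
    also have "\<dots> = ennreal (2 ^ n * (2 * D\<^sup>2) * (\<theta> * (1 / 8) ^ n))"
      using \<theta>_nonneg by (simp add: ennreal_mult)
    also have "2 ^ n * (2 * D\<^sup>2) * (\<theta> * (1 / 8) ^ n) = 2 * D\<^sup>2 * \<theta> * (2 * (1 / 8)) ^ n"
      by (simp only: power_mult_distrib mult_ac)
    finally show ?thesis by simp
  qed
  have "(\<integral>\<^sup>+x. \<integral>\<^sup>+\<omega>. energy \<omega> t x \<partial>M \<partial>lborel) = (\<Sum>n. \<integral>\<^sup>+x. \<integral>\<^sup>+\<omega>. ?d n \<omega> x \<partial>M \<partial>lborel)"
    unfolding energy_def by (subst nn_integral_suminf, measurable)+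
  also have "\<dots> \<le> (\<Sum>n. ennreal (2 * D\<^sup>2 * \<theta> * (1 / 4) ^ n))"
    by (intro suminf_le n) auto
  also have "\<dots> = ennreal (\<Sum>n. 2 * D\<^sup>2 * \<theta> * (1 / 4) ^ n)"
    using \<theta>_nonneg by (intro suminf_ennreal2) (auto intro!: summable_mult)
  also have "\<dots> < \<infinity>" by simp
  finally show *: "(\<integral>\<^sup>+x. \<integral>\<^sup>+\<omega>. energy \<omega> t x \<partial>M \<partial>lborel) < \<infinity>" .
  have "(\<integral>\<^sup>+x. \<integral>\<^sup>+\<omega>. energy \<omega> t x \<partial>M \<partial>lborel) = (\<integral>\<^sup>+\<omega>. \<integral>\<^sup>+x. energy \<omega> t x \<partial>lborel \<partial>M)"
    by (rule P.Fubini') measurable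
  with * show "(\<integral>\<^sup>+\<omega>. \<integral>\<^sup>+x. energy \<omega> t x \<partial>lborel \<partial>M) < \<infinity>" by simp
qed

lemma AE_energy_finite:
  assumes t: "t \<in> I" shows "AE \<omega> in M. (\<integral>\<^sup>+x. energy \<omega> t x \<partial>lborel) < \<infinity>"
proof -
  have "(\<lambda>\<omega>. \<integral>\<^sup>+x. energy \<omega> t x \<partial>lborel) \<in> borel_measurable M" by measurable
  from nn_integral_PInf_AE[OF this less_imp_neq[OF energy_integral_finite(1)[OF t]]]
  show ?thesis by (auto simp: less_top)
qed

lemma psum_Suc: "psum (A (Suc n)) \<omega> t x = psum (A n) \<omega> t x + psum (A (Suc n) - A n) \<omega> t x"
  unfolding psum_def using sum.subset_diff[OF A_mono A_finite] by (simp add: add.commute)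

lemma psum_telescope: "psum (A n) \<omega> t x = psum (A 0) \<omega> t x + (\<Sum>m<n. psum (A (Suc m) - A m) \<omega> t x)"
  by (induction n) (auto simp: psum_Suc)

lemma energy_finite_summable:
  assumes "energy \<omega> t x < \<infinity>"
  shows "summable (\<lambda>n. 2 ^ n * (norm (psum (A (Suc n) - A n) \<omega> t x))\<^sup>2)"
    and "energy \<omega> t x = ennreal (\<Sum>n. 2 ^ n * (norm (psum (A (Suc n) - A n) \<omega> t x))\<^sup>2)"
proof -
  show s: "summable (\<lambda>n. 2 ^ n * (norm (psum (A (Suc n) - A n) \<omega> t x))\<^sup>2)"
    using assms unfolding energy_def by (intro summable_suminf_not_top) (auto simp: less_top)
  show "energy \<omega> t x = ennreal (\<Sum>n. 2 ^ n * (norm (psum (A (Suc n) - A n) \<omega> t x))\<^sup>2)"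
    unfolding energy_def using s by (intro suminf_ennreal2) auto
qed

lemma energy_convergent:
  assumes "energy \<omega> t x < \<infinity>"
  shows "(\<lambda>n. psum (A n) \<omega> t x) \<longlonglongrightarrow> series \<omega> t x"
proof -
  let ?D = "\<lambda>n. psum (A (Suc n) - A n) \<omega> t x"
  have "summable (\<lambda>n. 2 ^ n * (norm (?D n))\<^sup>2 + (1 / 2) ^ n * 1\<^sup>2)"
    by (intro summable_add energy_finite_summable(1)[OF assms]) (simp add: summable_geometric)
  then have "summable ?D"
    by (rule summable_comparison_test') (use increment_le[of "norm (?D _)" 1] in simp)
  then have "(\<lambda>n. psum (A 0) \<omega> t x + (\<Sum>m<n. ?D m)) \<longlonglongrightarrow> psum (A 0) \<omega> t x + suminf ?D"
    by (intro tendsto_intros summable_LIMSEQ)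
  then have "convergent (\<lambda>n. psum (A n) \<omega> t x)"
    unfolding psum_telescope[symmetric] by (rule convergentI)
  then show ?thesis unfolding series_def convergent_LIMSEQ_iff .
qed

text \<open>The majorant for pairing the partial sums with a test function of value p at x. The
  energy is integrable in x, and \<open>increment_le\<close> produces it together with the square of
  p, which is integrable too.\<close>

lemma psum_dominated:
  assumes "energy \<omega> t x < \<infinity>"
  shows "norm (psum (A n) \<omega> t x * p) \<le> norm (psum (A 0) \<omega> t x) * norm p + enn2real (energy \<omega> t x) + 2 * (norm p)\<^sup>2"
proof -
  let ?D = "\<lambda>n. psum (A (Suc n) - A n) \<omega> t x"
  let ?e = "\<lambda>n. 2 ^ n * (norm (?D n))\<^sup>2"
  have s: "summable ?e" by (rule energy_finite_summable(1)[OF assms])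
  have g: "summable (\<lambda>n. (1 / 2 :: real) ^ n)" by (simp add: summable_geometric)
  have "norm (psum (A n) \<omega> t x) \<le> norm (psum (A 0) \<omega> t x) + (\<Sum>m<n. norm (?D m))"
    unfolding psum_telescope[of n] by (intro norm_triangle_le add_left_mono norm_sum)
  then have "norm (psum (A n) \<omega> t x) * norm p \<le> (norm (psum (A 0) \<omega> t x) + (\<Sum>m<n. norm (?D m))) * norm p"
    by (intro mult_right_mono) auto
  also have "\<dots> = norm (psum (A 0) \<omega> t x) * norm p + (\<Sum>m<n. norm (?D m) * norm p)"
    by (simp add: distrib_right sum_distrib_right)
  also have "(\<Sum>m<n. norm (?D m) * norm p) \<le> (\<Sum>m<n. ?e m + (1 / 2) ^ m * (norm p)\<^sup>2)"
    by (intro sum_mono increment_le)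
  also have "\<dots> = (\<Sum>m<n. ?e m) + (\<Sum>m<n. (1 / 2) ^ m) * (norm p)\<^sup>2"
    by (simp add: sum.distrib sum_distrib_right)
  also have "\<dots> \<le> suminf ?e + (\<Sum>m. (1 / 2) ^ m) * (norm p)\<^sup>2"
    by (intro add_mono mult_right_mono sum_le_suminf s g) auto
  also have "(\<Sum>m. (1 / 2 :: real) ^ m) = 2" by (simp add: suminf_geometric)
  also have "suminf ?e = enn2real (energy \<omega> t x)"
    unfolding energy_finite_summable(2)[OF assms] by (subst enn2real_ennreal) (auto intro!: suminf_nonneg s)
  finally show ?thesis by (simp add: norm_mult)
qed

text \<open>Finite energy gives both convergence and domination, so the limit passes under the
  integral; the same sums of pairings converge to the distribution by hypothesis.\<close>

lemma series_represents:
  assumes t: "t \<in> I" and \<omega>: "\<omega> \<in> space M" and fin: "(\<integral>\<^sup>+x. energy \<omega> t x \<partial>lborel) < \<infinity>"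
    and W: "\<And>\<phi>. schwartz \<phi> \<Longrightarrow>
      (\<lambda>n. \<Sum>i\<in>A n. g (fst i) (snd i) \<omega> * (LINT x|lborel. z i t x * \<phi> x)) \<longlonglongrightarrow> W \<phi>"
  shows "represents (series \<omega> t) W"
  unfolding represents_def
proof (intro conjI allI impI)
  have [measurable]: "psum (A n) \<omega> t \<in> borel_measurable borel" "series \<omega> t \<in> borel_measurable borel"
    "energy \<omega> t \<in> borel_measurable borel" for n
    using \<omega> by measurable
  show "series \<omega> t \<in> borel_measurable lborel" by simp
  fix \<phi> :: "(real, 'd) vec \<Rightarrow> complex" assume \<phi>: "schwartz \<phi>"
  have [measurable]: "\<phi> \<in> borel_measurable borel" by (rule schwartz_measurable[OF \<phi>])
  have AEfin: "AE x in lborel. energy \<omega> t x < \<infinity>"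
    using nn_integral_PInf_AE[of "energy \<omega> t" lborel] fin by (auto simp: less_top)
  obtain C where C: "C \<ge> 0" "\<And>x. norm (\<phi> x) \<le> C / bracket x ^ 0" using schwartz_bound[OF \<phi>] by blast
  have i\<phi>: "integrable lborel \<phi>" by (rule schwartz_integrable[OF \<phi>])
  have iz: "integrable lborel (\<lambda>x. z i t x * \<phi> x)" if "i \<in> A n" for i n
  proof (rule Bochner_Integration.integrable_bound)
    show "integrable lborel (\<lambda>x. K i *\<^sub>R \<phi> x)" using i\<phi> by simp
    have "norm (z i t x * \<phi> x) \<le> norm (K i *\<^sub>R \<phi> x)" for x
    proof -
      have "norm (z i t x) \<le> K i" using that A_sub t by (intro z_sup) auto
      then show ?thesis by (simp add: norm_mult mult_right_mono)
    qed
    then show "AE x in lborel. norm (z i t x * \<phi> x) \<le> norm (K i *\<^sub>R \<phi> x)" by simp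
  qed measurable
  have ip: "integrable lborel (\<lambda>x. psum (A n) \<omega> t x * \<phi> x)" 
    and Lp: "(LINT x|lborel. psum (A n) \<omega> t x * \<phi> x) = (\<Sum>i\<in>A n. g (fst i) (snd i) \<omega> * (LINT x|lborel. z i t x * \<phi> x))" for n
  proof -
    have eq: "(\<lambda>x. psum (A n) \<omega> t x * \<phi> x) = (\<lambda>x. \<Sum>i\<in>A n. g (fst i) (snd i) \<omega> * (z i t x * \<phi> x))"
      by (simp add: psum_def sum_distrib_right mult.assoc)
    show "integrable lborel (\<lambda>x. psum (A n) \<omega> t x * \<phi> x)"
      unfolding eq using iz by (intro Bochner_Integration.integrable_sum integrable_mult_right)
    show "(LINT x|lborel. psum (A n) \<omega> t x * \<phi> x) = (\<Sum>i\<in>A n. g (fst i) (snd i) \<omega> * (LINT x|lborel. z i t x * \<phi> x))"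
      unfolding eq using iz by (subst Bochner_Integration.integral_sum) auto
  qed
  define w where "w x = norm (psum (A 0) \<omega> t x) * norm (\<phi> x) + enn2real (energy \<omega> t x) + 2 * (norm (\<phi> x))\<^sup>2" for x
  have w: "integrable lborel w"
    unfolding w_def
  proof (intro Bochner_Integration.integrable_add integrable_mult_right)
    show "integrable lborel (\<lambda>x. norm (psum (A 0) \<omega> t x) * norm (\<phi> x))"
      using integrable_norm[OF ip[of 0]] by (simp add: norm_mult)
    show "integrable lborel (\<lambda>x. enn2real (energy \<omega> t x))"
    proof (rule integrableI_bounded)
      have "(\<integral>\<^sup>+x. ennreal (norm (enn2real (energy \<omega> t x))) \<partial>lborel) \<le> (\<integral>\<^sup>+x. energy \<omega> t x \<partial>lborel)"
      proof (rule nn_integral_mono)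
        fix x show "ennreal (norm (enn2real (energy \<omega> t x))) \<le> energy \<omega> t x"
          by (cases "energy \<omega> t x") auto
      qed
      then show "(\<integral>\<^sup>+x. ennreal (norm (enn2real (energy \<omega> t x))) \<partial>lborel) < \<infinity>" using fin by simp
    qed measurable
    show "integrable lborel (\<lambda>x. (norm (\<phi> x))\<^sup>2)"
    proof (rule Bochner_Integration.integrable_bound)
      show "integrable lborel (\<lambda>x. C *\<^sub>R \<phi> x)" using i\<phi> by simp
      have "(norm (\<phi> x))\<^sup>2 \<le> C * norm (\<phi> x)" for x
        using C(2)[of x] by (simp add: power2_eq_square mult_right_mono)
      then show "AE x in lborel. norm ((norm (\<phi> x))\<^sup>2) \<le> norm (C *\<^sub>R \<phi> x)" using C(1) by simp
    qed measurable
  qed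
  have b: "AE x in lborel. norm (psum (A n) \<omega> t x * \<phi> x) \<le> w x" for n
    using AEfin unfolding w_def by eventually_elim (rule psum_dominated)
  have l: "AE x in lborel. (\<lambda>n. psum (A n) \<omega> t x * \<phi> x) \<longlonglongrightarrow> series \<omega> t x * \<phi> x"
    using AEfin by eventually_elim (intro tendsto_intros energy_convergent)
  show "integrable lborel (\<lambda>x. series \<omega> t x * \<phi> x)"
    by (rule integrable_dominated_convergence[OF _ _ w l b]) measurable
  have "(\<lambda>n. LINT x|lborel. psum (A n) \<omega> t x * \<phi> x) \<longlonglongrightarrow> (LINT x|lborel. series \<omega> t x * \<phi> x)"
    by (rule integral_dominated_convergence[OF _ _ w l b]) measurable
  then show "W \<phi> = (LINT x|lborel. series \<omega> t x * \<phi> x)"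
    unfolding Lp using W[OF \<phi>] LIMSEQ_unique by blast
qed

lemma psum_Lr_moment:
  assumes F: "finite F" "F \<subseteq> {0, 1} \<times> UNIV" and t: "t \<in> I" and r: "2 \<le> r" "r \<le> real k"
  shows "(\<integral>\<^sup>+\<omega>. (Lp_norm lborel (ennreal r) (\<lambda>x. ennreal (norm (psum F \<omega> t x)))) ^ k \<partial>M)
     \<le> ennreal ((32 * exp c0 * sqrt k * \<kappa> * \<theta> powr (1 / r)) ^ k)"
proof (rule Lr_norm_moment[where \<sigma> = "\<lambda>x. sqrt (\<Sum>i\<in>F. (norm (z i t x))\<^sup>2)"])
  show "(\<lambda>(\<omega>, x). psum F \<omega> t x) \<in> borel_measurable (M \<Otimes>\<^sub>M lborel)"
    unfolding case_prod_beta by (intro psum_measurable F) auto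
  have s: "(\<Sum>i\<in>F. (norm (z i t x))\<^sup>2) \<le> (\<Sum>i\<in>F. (K i)\<^sup>2)" for x
    using F t by (intro sum_mono power_mono z_sup) auto
  show "sqrt (\<Sum>i\<in>F. (norm (z i t x))\<^sup>2) \<le> \<kappa>" for x
    using order_trans[OF s K_sum[OF F]] \<kappa>_nonneg by (intro real_le_lsqrt) auto
  have "(\<integral>\<^sup>+x. ennreal (\<Sum>i\<in>F. (norm (z i t x))\<^sup>2) \<partial>lborel) \<le> ennreal (\<theta> * \<kappa>\<^sup>2)"
    by (intro order_trans[OF sum_z_L2[OF F t]] ennreal_leI mult_left_mono K_sum F \<theta>_nonneg)
  then show "(\<integral>\<^sup>+x. ennreal ((sqrt (\<Sum>i\<in>F. (norm (z i t x))\<^sup>2))\<^sup>2) \<partial>lborel) \<le> ennreal (\<theta> * \<kappa>\<^sup>2)"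
    by (simp add: sum_nonneg)
  show "AE x in lborel. (\<integral>\<^sup>+\<omega>. ennreal (norm (psum F \<omega> t x) ^ k) \<partial>M) \<le> ennreal ((32 * exp c0 * sqrt k * sqrt (\<Sum>i\<in>F. (norm (z i t x))\<^sup>2)) ^ k)"
    using r by (intro AE_I2 psum_moment F) auto
qed (use r \<theta>_nonneg in \<open>auto intro!: sum_nonneg lborel.sigma_finite_measure_axioms prob_space_axioms\<close>)

text \<open>Fatou in \<omega>. The majorants y n are left open: for finite r they are norms of the
  partial sums, for r = infinity they are norms of a different series.\<close>

lemma series_moment:
  assumes t: "t \<in> I" and k: "k \<ge> 1" and y: "\<And>n. y n \<in> borel_measurable M"
    and B: "\<And>n. (\<integral>\<^sup>+\<omega>. y n \<omega> ^ k \<partial>M) \<le> B"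
    and le: "\<And>\<omega>. \<omega> \<in> space M \<Longrightarrow> AE x in lborel. (\<lambda>n. psum (A n) \<omega> t x) \<longlonglongrightarrow> series \<omega> t x \<Longrightarrow>
       Lp_norm lborel r (\<lambda>x. ennreal (norm (series \<omega> t x))) \<le> liminf (\<lambda>n. y n \<omega>)"
  shows "(\<integral>\<^sup>+\<omega>. (Lp_norm lborel r (\<lambda>x. ennreal (norm (series \<omega> t x)))) ^ k \<partial>M) \<le> B"
proof (rule moment_liminf_le[OF k y _ B])
  show "AE \<omega> in M. Lp_norm lborel r (\<lambda>x. ennreal (norm (series \<omega> t x))) \<le> liminf (\<lambda>n. y n \<omega>)"
    using AE_energy_finite[OF t] AE_space
  proof eventually_elim
    case (elim \<omega>)
    have "energy \<omega> t \<in> borel_measurable lborel" using elim(2) by measurable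
    then have "AE x in lborel. energy \<omega> t x < \<infinity>"
      using nn_integral_PInf_AE[of "energy \<omega> t" lborel] elim(1) by (auto simp: less_top)
    then have "AE x in lborel. (\<lambda>n. psum (A n) \<omega> t x) \<longlonglongrightarrow> series \<omega> t x"
      by eventually_elim (rule energy_convergent)
    then show ?case using le elim(2) by blast
  qed
qed

lemma series_Lr_moment:
  assumes t: "t \<in> I" and r: "2 \<le> r" "r \<le> real k"
  shows "(\<integral>\<^sup>+\<omega>. (Lp_norm lborel (ennreal r) (\<lambda>x. ennreal (norm (series \<omega> t x)))) ^ k \<partial>M)
     \<le> ennreal ((32 * exp c0 * sqrt k * \<kappa> * \<theta> powr (1 / r)) ^ k)"
proof (rule series_moment[OF t _ _ psum_Lr_moment[OF A_finite A_sub t r]])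
  show "k \<ge> 1" using r by simp
  show "(\<lambda>\<omega>. Lp_norm lborel (ennreal r) (\<lambda>x. ennreal (norm (psum (A n) \<omega> t x)))) \<in> borel_measurable M" for n
    by (rule Lp_norm_measurable) (auto intro: lborel.sigma_finite_measure_axioms)
  fix \<omega> assume \<omega>: "\<omega> \<in> space M" and l: "AE x in lborel. (\<lambda>n. psum (A n) \<omega> t x) \<longlonglongrightarrow> series \<omega> t x"
  show "Lp_norm lborel (ennreal r) (\<lambda>x. ennreal (norm (series \<omega> t x)))
      \<le> liminf (\<lambda>n. Lp_norm lborel (ennreal r) (\<lambda>x. ennreal (norm (psum (A n) \<omega> t x))))"
  proof (rule Lp_norm_liminf)
    show "AE x in lborel. (\<lambda>n. ennreal (norm (psum (A n) \<omega> t x))) \<longlonglongrightarrow> ennreal (norm (series \<omega> t x))"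
      using l by eventually_elim (intro tendsto_intros)
    show "(\<lambda>x. ennreal (norm (psum (A n) \<omega> t x))) \<in> borel_measurable lborel" for n
      using \<omega> by measurable
  qed (use r in simp)
qed

end

lemma tail_from_moments:
  fixes X :: "'a \<Rightarrow> ennreal"
  assumes "prob_space N" and [measurable]: "X \<in> borel_measurable N" and k0: "1 \<le> k0" and R: "0 \<le> R" and lam: "0 < lam"
    and mom: "\<And>k. k0 \<le> k \<Longrightarrow> (\<integral>\<^sup>+\<omega>. X \<omega> ^ k \<partial>N) \<le> ennreal ((R * sqrt k) ^ k)"
  shows "emeasure N {\<omega> \<in> space N. ennreal lam < X \<omega>} \<le> ennreal (exp (real k0) * exp_neg_quot (lam\<^sup>2 / exp 2) (R\<^sup>2))"
proof -
  interpret prob_space N by fact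
  let ?E = "{\<omega> \<in> space N. ennreal lam < X \<omega>}"
  have markov: "ennreal (lam ^ k) * emeasure N ?E \<le> ennreal ((R * sqrt k) ^ k)" if k: "k0 \<le> k" for k
  proof -
    have "ennreal (lam ^ k) * emeasure N ?E = (\<integral>\<^sup>+\<omega>. ennreal (lam ^ k) * indicator ?E \<omega> \<partial>N)"
      by (rule nn_integral_cmult_indicator[symmetric]) measurable
    also have "\<dots> \<le> (\<integral>\<^sup>+\<omega>. X \<omega> ^ k \<partial>N)"
    proof (rule nn_integral_mono)
      fix \<omega> show "ennreal (lam ^ k) * indicator ?E \<omega> \<le> X \<omega> ^ k"
        using lam power_mono[of "ennreal lam" "X \<omega>" k] by (auto simp: indicator_def ennreal_power)
    qed
    also have "\<dots> \<le> ennreal ((R * sqrt k) ^ k)" by (rule mom[OF k])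
    finally show ?thesis .
  qed
  have le: "emeasure N ?E \<le> ennreal ((R * sqrt k / lam) ^ k)" if k: "k0 \<le> k" for k
  proof -
    have "emeasure N ?E = ennreal (1 / lam ^ k) * (ennreal (lam ^ k) * emeasure N ?E)"
      using lam by (simp add: mult.assoc[symmetric] ennreal_mult[symmetric])
    also have "\<dots> \<le> ennreal (1 / lam ^ k) * ennreal ((R * sqrt k) ^ k)"
      by (intro mult_left_mono markov k) auto
    also have "\<dots> = ennreal ((R * sqrt k / lam) ^ k)"
      using lam R by (simp add: ennreal_mult[symmetric] power_divide)
    finally show ?thesis .
  qed
  show ?thesis
  proof (cases "R = 0")
    case True
    then show ?thesis using le[of k0] k0 by (simp add: exp_neg_quot_def power_0_left)
  next
    case False
    with R have R: "R > 0" by simp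
    \<comment> \<open>The real exponent at which R sqrt(y) / lam is exactly 1 / e; its integer part
      will be k.\<close>
    define y where "y = lam\<^sup>2 / exp 2 / R\<^sup>2"
    have y: "y > 0" using lam R by (simp add: y_def)
    have goal: "exp (real k0) * exp_neg_quot (lam\<^sup>2 / exp 2) (R\<^sup>2) = exp (real k0 - y)"
      using False by (simp add: exp_neg_quot_def y_def exp_diff exp_minus divide_inverse)
    show ?thesis
    proof (cases "y < real k0")
      case True
      have "emeasure N ?E \<le> 1" by (rule emeasure_le_1)
      also have "1 \<le> ennreal (exp (real k0 - y))"
        using True ennreal_leI[of 1 "exp (real k0 - y)"] by simp
      finally show ?thesis unfolding goal .
    next
      case False
      define k where "k = nat \<lfloor>y\<rfloor>"
      have k: "k0 \<le> k" "real k \<le> y" "y < real k + 1"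
        using False y by (auto simp: k_def le_nat_floor)
      have "sqrt y = lam / exp 1 / R"
      proof -
        have "y = (lam / exp 1 / R)\<^sup>2"
          using exp_double[of "1::real"] by (simp add: y_def power_divide power_mult_distrib)
        then show ?thesis using lam R by simp
      qed
      then have "R * sqrt y / lam = exp (- 1)" using lam R by (simp add: exp_minus field_simps)
      moreover have "R * sqrt k / lam \<le> R * sqrt y / lam"
        using k lam R by (intro divide_right_mono mult_left_mono) auto
      ultimately have "(R * sqrt k / lam) ^ k \<le> exp (- 1) ^ k"
        using R lam by (intro power_mono) auto
      also have "\<dots> = exp (- real k)" by (simp add: exp_of_nat_mult[symmetric])
      \<comment> \<open>Rounding down loses less than 1 in the exponent, and k0 is at least
        1.\<close>
      also have "\<dots> \<le> exp (real k0 - y)" using k k0 by simp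
      finally show ?thesis unfolding goal using le[OF k(1)] ennreal_leI order_trans by blast
    qed
  qed
qed

section \<open>From moments of the series to the tail of the mixed norm of the distribution\<close>

context random_series
begin

lemma series_Lp_measurable:
  assumes "a \<in> measurable N M" "b \<in> borel_measurable N"
  shows "(\<lambda>p. Lp_norm lborel r (\<lambda>x. ennreal (norm (series (a p) (b p) x)))) \<in> borel_measurable N"
proof (rule Lp_norm_measurable)
  have [measurable]: "(\<lambda>p. a (fst p)) \<in> measurable (N \<Otimes>\<^sub>M (lborel :: (real, 'd) vec measure)) M"
    "(\<lambda>p. b (fst p)) \<in> borel_measurable (N \<Otimes>\<^sub>M (lborel :: (real, 'd) vec measure))"
    using assms by measurable
  show "(\<lambda>(p, x). ennreal (norm (series (a p) (b p) x))) \<in> borel_measurable (N \<Otimes>\<^sub>M lborel)"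
    unfolding case_prod_beta by measurable
qed (rule lborel.sigma_finite_measure_axioms)

lemma Lr_norm_distr_series:
  assumes \<eta>: "cutoff (\<eta> :: (real, 'd) vec \<Rightarrow> real)" and rep: "represents (series \<omega> t) W" and \<omega>: "\<omega> \<in> space M"
  shows "Lr_norm_distr r W = Lp_norm lborel r (\<lambda>x. ennreal (norm (series \<omega> t x)))"
proof -
  have "Lp_norm lborel r (\<lambda>x. ennreal (norm (v x))) = Lp_norm lborel r (\<lambda>x. ennreal (norm (series \<omega> t x)))"
    if v: "represents v W" for v
  proof (rule Lp_norm_cong_AE)
    have [measurable]: "v \<in> borel_measurable borel" "series \<omega> t \<in> borel_measurable borel"
      using v rep by (auto simp: represents_def)
    show "(\<lambda>x. ennreal (norm (v x))) \<in> borel_measurable lborel" "(\<lambda>x. ennreal (norm (series \<omega> t x))) \<in> borel_measurable lborel"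
      by measurable
    show "AE x in lborel. ennreal (norm (v x)) = ennreal (norm (series \<omega> t x))"
      using represents_unique[OF \<eta> v rep] by eventually_elim simp
  qed
  then have "Lr_norm_distr r W = (INF v\<in>{v. represents v W}. Lp_norm lborel r (\<lambda>x. ennreal (norm (series \<omega> t x))))"
    unfolding Lr_norm_distr_def by (intro INF_cong) auto
  also have "\<dots> = Lp_norm lborel r (\<lambda>x. ennreal (norm (series \<omega> t x)))"
    using rep by (intro cINF_const) auto
  finally show ?thesis .
qed

text \<open>The mixed norm is compared with X, the same norm computed from the jointly measurable
  series. They agree almost surely, so the event differs from a measurable one by a null set; the
  tail bound is that of X.\<close>

lemma mixed_norm_tail:
  fixes W :: "'w \<Rightarrow> real \<Rightarrow> 'd distr"
  assumes \<eta>: "cutoff (\<eta> :: (real, 'd) vec \<Rightarrow> real)" and ab: "a \<le> b" "{a..b} \<subseteq> I" and q: "1 \<le> q" "q \<le> real k0"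
    and R: "0 \<le> R" and lam: "0 < lam"
    and mom: "\<And>t k. t \<in> {a..b} \<Longrightarrow> k0 \<le> k \<Longrightarrow>
      (\<integral>\<^sup>+\<omega>. (Lp_norm lborel r (\<lambda>x. ennreal (norm (series \<omega> t x)))) ^ k \<partial>M) \<le> ennreal ((R * sqrt k) ^ k)"
    and W: "AE \<omega> in M. \<forall>t\<in>{a..b}. \<forall>\<phi>. schwartz \<phi> \<longrightarrow>
      (\<lambda>n. \<Sum>i\<in>A n. g (fst i) (snd i) \<omega> * (LINT x|lborel. z i t x * \<phi> x)) \<longlonglongrightarrow> W \<omega> t \<phi>"
  defines "E \<equiv> {\<omega> \<in> space M. mixed_norm q r {a..b} (W \<omega>) > ennreal lam}"
  shows "E \<in> sets (completion M)"
    "measure (completion M) E \<le> exp (real k0) * exp_neg_quot (lam\<^sup>2 / exp 2) (((b - a) powr (1 / q) * R)\<^sup>2)"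
proof -
  let ?L = "restrict_space lborel {a..b}"
  define Y where "Y \<omega> t = Lp_norm lborel r (\<lambda>x. ennreal (norm (series \<omega> t x)))" for \<omega> t
  define X where "X \<omega> = Lp_norm ?L (ennreal q) (Y \<omega>)" for \<omega>
  interpret L: finite_measure ?L
    using ab by (intro finite_measureI) (simp add: emeasure_restrict_space space_restrict_space)
  interpret P: pair_sigma_finite M ?L ..
  have [measurable]: "(\<lambda>p. snd p) \<in> borel_measurable (M \<Otimes>\<^sub>M ?L)"
    using measurable_compose[OF measurable_snd measurable_restrict_space1[OF measurable_ident_sets[OF sets_lborel]]] .
  have Ym: "(\<lambda>(\<omega>, t). Y \<omega> t) \<in> borel_measurable (M \<Otimes>\<^sub>M ?L)"
    unfolding Y_def case_prod_beta by (intro series_Lp_measurable) measurable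
  have Xm: "X \<in> borel_measurable M"
    unfolding X_def by (rule Lp_norm_measurable[OF L.sigma_finite_measure_axioms Ym])
  \<comment> \<open>The null set of \<omega> depends on t. Exchanging the quantifiers gives one null
    set of \<omega>, outside which the energy is finite for almost every t.\<close>
  have "AE t in ?L. AE \<omega> in M. (\<integral>\<^sup>+x. energy \<omega> t x \<partial>lborel) < \<infinity>"
    using ab by (intro AE_I2 AE_energy_finite) (auto simp: space_restrict_space)
  then have "AE \<omega> in M. AE t in ?L. (\<integral>\<^sup>+x. energy \<omega> t x \<partial>lborel) < \<infinity>"
    by (subst P.AE_commute) measurable
  then have XE: "AE \<omega> in M. mixed_norm q r {a..b} (W \<omega>) = X \<omega>"
    using W AE_space
  proof eventually_elim
    case (elim \<omega>)
    have "AE t in ?L. Lr_norm_distr r (W \<omega> t) = Y \<omega> t"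
      using elim(1) AE_space[of ?L]
    proof eventually_elim
      case (elim t)
      then have "t \<in> {a..b}" by (simp add: space_restrict_space)
      then have "represents (series \<omega> t) (W \<omega> t)"
        using \<open>\<forall>t\<in>{a..b}. _\<close> \<open>\<omega> \<in> space M\<close> elim(1) ab(2) by (intro series_represents) auto
      then show ?case unfolding Y_def using \<open>\<omega> \<in> space M\<close> by (intro Lr_norm_distr_series[OF \<eta>])
    qed
    then have "(\<integral>\<^sup>+t. enn_powr (Lr_norm_distr r (W \<omega> t)) q \<partial>?L) = (\<integral>\<^sup>+t. enn_powr (Y \<omega> t) q \<partial>?L)"
      by (intro nn_integral_cong_AE) (auto elim!: eventually_mono)
    then show ?case using q by (simp add: mixed_norm_def X_def Lp_norm_def)
  qed
  let ?F = "{\<omega> \<in> space M. X \<omega> > ennreal lam}"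
  have F: "?F \<in> sets M" using Xm by measurable
  have EF: "AE \<omega> in completion M. \<omega> \<in> ?F \<longleftrightarrow> \<omega> \<in> E"
    unfolding AE_completion_iff using XE by eventually_elim (auto simp: E_def)
  show E: "E \<in> sets (completion M)"
    by (rule completion.in_sets_AE[OF EF]) (use F in \<open>auto simp: E_def\<close>)
  have "measure (completion M) E = measure (completion M) ?F"
    using EF E F by (intro measure_eq_AE) (auto elim!: eventually_mono)
  also have "\<dots> = measure M ?F" using F by (rule measure_completion)
  also have "\<dots> \<le> exp (real k0) * exp_neg_quot (lam\<^sup>2 / exp 2) (((b - a) powr (1 / q) * R)\<^sup>2)"
  proof -
    have k0: "1 \<le> k0" using q by simp
    have "(\<integral>\<^sup>+\<omega>. X \<omega> ^ k \<partial>M) \<le> ennreal (((b - a) powr (1 / q) * R * sqrt k) ^ k)" if k: "k0 \<le> k" for k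
    proof (cases "a < b")
      case True
      have "(\<integral>\<^sup>+\<omega>. X \<omega> ^ k \<partial>M) \<le> ennreal (((b - a) powr (1 / q) * (R * sqrt k)) ^ k)"
        unfolding X_def
      proof (rule Lq_norm_moment[OF prob_space_axioms True Ym])
        show "(\<integral>\<^sup>+\<omega>. Y \<omega> t ^ k \<partial>M) \<le> ennreal ((R * sqrt k) ^ k)" if "t \<in> {a..b}" for t
          unfolding Y_def by (rule mom[OF that k])
      qed (use R q k in auto)
      then show ?thesis by (simp add: mult.assoc)
    next
      case False
      \<comment> \<open>A single instant has measure zero, so X vanishes; this agrees with the
        bound, where 0 powr (1 / q) is 0.\<close>
      then have "{a..b} = {a}" using ab by auto
      then have "(\<integral>\<^sup>+t. f t \<partial>?L) = 0" for f :: "real \<Rightarrow> ennreal"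
      proof -
        have "(\<integral>\<^sup>+t. f t \<partial>?L) = (\<integral>\<^sup>+t. f t * indicator {a} t \<partial>lborel)"
          unfolding \<open>{a..b} = {a}\<close> by (rule nn_integral_restrict_space) simp
        also have "\<dots> = (\<integral>\<^sup>+t. 0 \<partial>(lborel :: real measure))"
        proof (rule nn_integral_cong_AE)
          show "AE t in lborel. f t * indicator {a} t = 0"
            using AE_lborel_singleton[of a] by eventually_elim simp
        qed
        finally show ?thesis by simp
      qed
      then show ?thesis using q k0 k by (simp add: X_def Lp_norm_def power_0_left)
    qed
    from tail_from_moments[OF prob_space_axioms Xm k0 _ lam this]
    have "emeasure M ?F \<le> ennreal (exp (real k0) * exp_neg_quot (lam\<^sup>2 / exp 2) (((b - a) powr (1 / q) * R)\<^sup>2))"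
      using R by simp
    then show ?thesis
      unfolding emeasure_eq_measure by (subst (asm) ennreal_le_iff) (auto simp: exp_neg_quot_def)
  qed
  finally show "measure (completion M) E \<le> exp (real k0) * exp_neg_quot (lam\<^sup>2 / exp 2) (((b - a) powr (1 / q) * R)\<^sup>2)" .
qed

end

section \<open>The randomized wave evolution\<close>

text \<open>Summability provides, for each k, a finite set off which every finite sum is at most
  \<open>(1 / 8)^k\<close>; the sets B n must contain these and also exhaust the whole type.\<close>

lemma exhaustion:
  fixes f :: "'a::countable \<Rightarrow> real"
  assumes f: "f summable_on UNIV" and nn: "\<And>x. 0 \<le> f x"
  obtains B :: "nat \<Rightarrow> 'a set" where "\<And>n. finite (B n)" "\<And>n. B n \<subseteq> B (Suc n)" "\<And>x. \<exists>n. x \<in> B n"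
    "\<And>n. sum f (B (Suc n) - B n) \<le> (1 / 8) ^ n"
proof -
  have "\<exists>G. finite G \<and> (\<forall>F. finite F \<and> F \<inter> G = {} \<longrightarrow> sum f F \<le> e)" if e: "e > 0" for e
  proof -
    have "\<forall>\<^sub>F F in finite_subsets_at_top UNIV. dist (sum f F) (infsum f UNIV) < e"
      using infsum_tendsto[OF f] e by (rule tendstoD)
    then obtain G where G: "finite G" "\<And>F. finite F \<Longrightarrow> G \<subseteq> F \<Longrightarrow> dist (sum f F) (infsum f UNIV) < e"
      unfolding eventually_finite_subsets_at_top by auto
    have "sum f F \<le> e" if F: "finite F" "F \<inter> G = {}" for F
    proof -
      have "sum f G + sum f F = sum f (G \<union> F)"
        using F G(1) by (subst sum.union_disjoint) auto
      also have "\<dots> \<le> infsum f UNIV"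
        using F G(1) nn by (intro finite_sum_le_infsum f) auto
      finally show ?thesis using G(2)[of G] G(1) by (simp add: dist_real_def)
    qed
    then show ?thesis using G(1) by blast
  qed
  then have "\<forall>k::nat. \<exists>G. finite G \<and> (\<forall>F. finite F \<and> F \<inter> G = {} \<longrightarrow> sum f F \<le> (1 / 8) ^ k)" by simp
  then obtain G where G: "\<And>k::nat. finite (G k)" "\<And>k F. finite F \<Longrightarrow> F \<inter> G k = {} \<Longrightarrow> sum f F \<le> (1 / 8) ^ k"
    by metis
  \<comment> \<open>The first part contains G n, so that B (n + 1) minus B n avoids it; the
    enumerated part guarantees that every element is reached.\<close>
  define B where "B n = (\<Union>k\<le>n. G k) \<union> from_nat ` {..n}" for n
  show ?thesis
  proof (rule that[of B])
    show fin: "finite (B n)" for n using G(1) by (simp add: B_def)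
    show "B n \<subseteq> B (Suc n)" for n by (auto simp: B_def le_SucI)
    show "\<exists>n. x \<in> B n" for x
      by (rule exI[of _ "to_nat x"]) (auto simp: B_def intro!: rev_image_eqI[of "to_nat x"])
    show "sum f (B (Suc n) - B n) \<le> (1 / 8) ^ n" for n
      using fin by (intro G(2)) (auto simp: B_def)
  qed
qed

lemma sum_exhaustion_tendsto:
  fixes f :: "'a \<Rightarrow> complex"
  assumes f: "f summable_on UNIV" and B: "\<And>n. finite (B n)" "\<And>n. B n \<subseteq> B (Suc n)" "\<And>x. \<exists>n. x \<in> B n"
  shows "(\<lambda>n. sum f (B n)) \<longlonglongrightarrow> infsum f UNIV"
proof (rule filterlim_compose[OF infsum_tendsto[OF f]])
  have mono: "B m \<subseteq> B n" if "m \<le> n" for m n using that B(2) by (rule lift_Suc_mono_le[rotated])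
  show "filterlim B (finite_subsets_at_top UNIV) sequentially"
    unfolding filterlim_finite_subsets_at_top
  proof (intro allI impI)
    fix X :: "'a set" assume X: "finite X \<and> X \<subseteq> UNIV"
    obtain n where n: "\<And>x. x \<in> B (n x)" using B(3) by metis
    have "X \<subseteq> B m" if m: "m \<ge> Max (insert 0 (n ` X))" for m
    proof
      fix x assume "x \<in> X"
      then have "n x \<le> m" using X m by (intro order_trans[OF _ m] Max_ge) auto
      then show "x \<in> B m" using n mono by blast
    qed
    then show "\<forall>\<^sub>F y in sequentially. finite (B y) \<and> X \<subseteq> B y \<and> B y \<subseteq> UNIV"
      unfolding eventually_sequentially using B(1) by blast
  qed
qed

lemma sum_pairs:
  fixes f :: "nat \<times> 'a \<Rightarrow> 'b::comm_monoid_add"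
  shows "sum f ({0, 1} \<times> F) = (\<Sum>n\<in>F. f (0, n) + f (1, n))"
  by (simp add: sum.cartesian_product' sum.distrib)

section \<open>Symbol bounds relative to the Sobolev weights, and summability of the random
  coefficients\<close>

definition wave_symbol :: "nat \<Rightarrow> real \<Rightarrow> real^'d::finite \<Rightarrow> complex" where
  "wave_symbol j t = (if j = 0 then cos_symbol t else sinc_symbol t)"

definition weight :: "real \<Rightarrow> nat \<times> (int^'d::finite) \<Rightarrow> real" where
  "weight s i = bracket (freq (snd i)) powr (if fst i = 0 then s else s - 1)"

lemma weight_nonneg [simp]: "0 \<le> weight s i"
  by (simp add: weight_def)

lemma wave_symbol_measurable_pair:
  "(\<lambda>(t, \<xi>). wave_symbol j t \<xi>) \<in> borel_measurable (borel \<Otimes>\<^sub>M (borel :: (real^'d::finite) measure))"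
  by (cases "j = 0") (simp_all add: wave_symbol_def)

lemma wave_symbol_measurable: "wave_symbol j t \<in> borel_measurable borel"
  using measurable_Pair2[OF wave_symbol_measurable_pair, of t j] by simp

lemma bracket_powr_shift:
  assumes "\<bar>p\<bar> \<le> real N"
  shows "bracket \<xi> powr p \<le> bracket \<nu> powr p * bracket (\<xi> - \<nu>) ^ N"
proof -
  have "bracket (\<xi> - \<nu>) powr \<bar>p\<bar> \<le> bracket (\<xi> - \<nu>) powr real N"
    using assms bracket_ge_1 by (intro powr_mono) auto
  then have "bracket (\<xi> - \<nu>) powr \<bar>p\<bar> \<le> bracket (\<xi> - \<nu>) ^ N" by (simp add: powr_realpow)
  then have "bracket \<nu> powr p * bracket (\<xi> - \<nu>) powr \<bar>p\<bar> \<le> bracket \<nu> powr p * bracket (\<xi> - \<nu>) ^ N"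
    by (intro mult_left_mono) auto
  then show ?thesis using bracket_powr_peetre[of \<xi> p \<nu>] by linarith
qed

text \<open>The factor e is 1 with \<sigma> = 0 for the solution itself, and the reciprocal of
  \<open>potential_symbol\<close> with \<sigma> = s for the supremum norm; in both cases the result
  is the Sobolev weight at \<open>freq n\<close>. The assumption on N lets the power of the bracket
  move from \<xi> to \<open>freq n\<close> for either datum, the second gaining one order from the
  sine symbol.\<close>

lemma wave_symbol_powr_bound:
  assumes s: "0 \<le> s" and t: "0 \<le> t" "t \<le> b" and N: "s + 1 \<le> real N" and j: "j \<in> {0, 1}"
    and e: "\<bar>e\<bar> \<le> E * bracket \<xi> powr \<sigma>" "0 \<le> E" and \<sigma>: "\<sigma> \<in> {0, s}"
  shows "norm (wave_symbol j t \<xi>) * \<bar>e\<bar> \<le> 2 * E * max 1 b * weight s (j, n) * bracket (\<xi> - freq n) ^ N"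
proof (cases "j = 0")
  case True
  have "bracket \<xi> powr \<sigma> \<le> bracket (freq n) powr \<sigma> * bracket (\<xi> - freq n) ^ N"
    using \<sigma> s N by (intro bracket_powr_shift) auto
  also have "\<dots> \<le> bracket (freq n) powr s * bracket (\<xi> - freq n) ^ N"
    using \<sigma> s bracket_ge_1 by (intro mult_right_mono powr_mono) auto
  finally have 1: "bracket \<xi> powr \<sigma> \<le> bracket (freq n) powr s * bracket (\<xi> - freq n) ^ N" .
  have "norm (wave_symbol j t \<xi>) * \<bar>e\<bar> \<le> 1 * (E * bracket \<xi> powr \<sigma>)"
    using True e cos_symbol_bound by (intro mult_mono) (auto simp: wave_symbol_def)
  also have "\<dots> \<le> E * (bracket (freq n) powr s * bracket (\<xi> - freq n) ^ N)"
    using e(2) 1 by (simp add: mult_left_mono)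
  also have "\<dots> \<le> (2 * max 1 b) * (E * (bracket (freq n) powr s * bracket (\<xi> - freq n) ^ N))"
  proof -
    have "1 \<le> 2 * max 1 b" by simp
    moreover have "0 \<le> E * (bracket (freq n) powr s * bracket (\<xi> - freq n) ^ N)" using e(2) by simp
    ultimately show ?thesis by (metis mult_1 mult_right_mono)
  qed
  finally show ?thesis using True by (simp add: weight_def mult_ac)
next
  case False
  have "bracket \<xi> powr (\<sigma> - 1) \<le> bracket (freq n) powr (\<sigma> - 1) * bracket (\<xi> - freq n) ^ N"
    using \<sigma> s N by (intro bracket_powr_shift) auto
  also have "\<dots> \<le> bracket (freq n) powr (s - 1) * bracket (\<xi> - freq n) ^ N"
    using \<sigma> s bracket_ge_1 by (intro mult_right_mono powr_mono) auto
  finally have 1: "bracket \<xi> powr (\<sigma> - 1) \<le> bracket (freq n) powr (s - 1) * bracket (\<xi> - freq n) ^ N" .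
  have "2 * max 1 t / bracket \<xi> \<le> 2 * max 1 b / bracket \<xi>"
    using t by (intro divide_right_mono) auto
  then have "norm (wave_symbol j t \<xi>) * \<bar>e\<bar> \<le> (2 * max 1 b / bracket \<xi>) * (E * bracket \<xi> powr \<sigma>)"
    using False e sinc_symbol_bracket_bound[OF t(1), of \<xi>] by (intro mult_mono) (auto simp: wave_symbol_def)
  also have "\<dots> = 2 * max 1 b * E * bracket \<xi> powr (\<sigma> - 1)"
    by (simp add: powr_diff)
  also have "\<dots> \<le> 2 * max 1 b * E * (bracket (freq n) powr (s - 1) * bracket (\<xi> - freq n) ^ N)"
    using e(2) by (intro mult_left_mono 1) auto
  finally show ?thesis using False by (simp add: weight_def mult_ac)
qed

lemma inv_fourier_sum:
  assumes "finite F" and "\<And>i. i \<in> F \<Longrightarrow> integrable lborel (f i)"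
  shows "inv_fourier (\<lambda>\<xi>. \<Sum>i\<in>F. c i * f i \<xi>) x = (\<Sum>i\<in>F. c i * inv_fourier (f i) x)"
proof -
  have "(LINT \<xi>|lborel. cis (x \<bullet> \<xi>) * (\<Sum>i\<in>F. c i * f i \<xi>)) = (LINT \<xi>|lborel. (\<Sum>i\<in>F. c i * (cis (x \<bullet> \<xi>) * f i \<xi>)))"
    by (intro Bochner_Integration.integral_cong) (auto simp: sum_distrib_left mult_ac)
  also have "\<dots> = (\<Sum>i\<in>F. c i * (LINT \<xi>|lborel. cis (x \<bullet> \<xi>) * f i \<xi>))"
    using assms by (subst Bochner_Integration.integral_sum) (auto intro!: integrable_cis_mult)
  finally show ?thesis by (simp add: inv_fourier_def sum_distrib_left mult.left_commute)
qed

lemma pair_Hs_norm_sq: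
  fixes u :: "nat \<Rightarrow> int^'d::finite \<Rightarrow> complex"
  assumes u: "u 0 \<in> Hs s" "u 1 \<in> Hs (s - 1)"
  defines "a \<equiv> \<lambda>i. (norm (u (fst i) (snd i)) * weight s i)\<^sup>2"
  shows "(\<lambda>n. a (0, n) + a (1, n)) summable_on UNIV"
    and "(pair_Hs_norm s (u 0) (u 1))\<^sup>2 = (\<Sum>\<^sub>\<infinity>n. a (0, n) + a (1, n))"
    and "finite F \<Longrightarrow> F \<subseteq> {0, 1} \<times> UNIV \<Longrightarrow> sum a F \<le> (pair_Hs_norm s (u 0) (u 1))\<^sup>2"
proof -
  have sq: "(x powr p)\<^sup>2 = x powr (2 * p)" for x p :: real
    by (simp add: power2_eq_square powr_add[symmetric])
  have a0: "a (0, n) = bracket (freq n) powr (2 * s) * (cmod (u 0 n))\<^sup>2" for n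
    by (simp add: a_def weight_def power_mult_distrib sq mult.commute)
  have a1: "a (1, n) = bracket (freq n) powr (2 * (s - 1)) * (cmod (u 1 n))\<^sup>2" for n
    by (simp add: a_def weight_def power_mult_distrib sq mult.commute)
  have s0: "(\<lambda>n. a (0, n)) summable_on UNIV" and s1: "(\<lambda>n. a (1, n)) summable_on UNIV"
    using u unfolding Hs_def a0 a1 by (simp_all only: mem_Collect_eq)
  show sm: "(\<lambda>n. a (0, n) + a (1, n)) summable_on UNIV" by (intro summable_on_add s0 s1)
  have an: "0 \<le> a i" for i by (simp add: a_def)
  have "(Hs_norm s (u 0))\<^sup>2 = (\<Sum>\<^sub>\<infinity>n. a (0, n))" "(Hs_norm (s - 1) (u 1))\<^sup>2 = (\<Sum>\<^sub>\<infinity>n. a (1, n))"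
    unfolding Hs_norm_def a0 a1 by (simp_all add: infsum_nonneg)
  then show eq: "(pair_Hs_norm s (u 0) (u 1))\<^sup>2 = (\<Sum>\<^sub>\<infinity>n. a (0, n) + a (1, n))"
    using infsum_add[OF s0 s1] by (simp add: pair_Hs_norm_def infsum_nonneg an)
  assume F: "finite F" "F \<subseteq> {0, 1} \<times> UNIV"
  have "sum a F \<le> sum a ({0, 1} \<times> snd ` F)"
    using F an by (intro sum_mono2) force+
  also have "\<dots> = (\<Sum>n\<in>snd ` F. a (0, n) + a (1, n))"
    by (rule sum_pairs)
  also have "\<dots> \<le> (\<Sum>\<^sub>\<infinity>n. a (0, n) + a (1, n))"
    using F an by (intro finite_sum_le_infsum sm) auto
  finally show "sum a F \<le> (pair_Hs_norm s (u 0) (u 1))\<^sup>2" unfolding eq .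
qed

text \<open>Makes the infinite sums in \<open>periodic_distr\<close> genuine, since
  \<open>infsum\<close> of a non-summable family is 0 by convention. First absolute moments of the g
  are uniformly bounded, so the expected sum is finite. In the exponent d + 2, one power compensates
  the growth of u and d + 1 are left for summability over the lattice.\<close>

lemma (in random_coefficients) AE_coefficients_summable:
  fixes u :: "(int, 'd) vec \<Rightarrow> complex"
  assumes j: "j \<in> {0, 1}" and u: "\<And>n. norm (u n) \<le> U * bracket (freq n)"
  shows "AE \<omega> in M. (\<lambda>n. norm (g j n \<omega> * u n) / bracket (freq n) ^ (CARD('d) + 2)) summable_on UNIV"
proof -
  let ?N = "CARD('d) + 2"
  let ?w = "\<lambda>n :: (int, 'd) vec. 1 / bracket (freq n) ^ Suc CARD('d)"
  have U: "U \<ge> 0" using u[of 0] by (metis bracket_pos norm_ge_zero order_trans zero_le_mult_iff not_le)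
  have w: "?w summable_on UNIV" by (rule summable_bracket_freq) simp
  obtain B :: "nat \<Rightarrow> (int, 'd) vec set" where B: "\<And>n. finite (B n)" "\<And>n. B n \<subseteq> B (Suc n)" "\<And>x. \<exists>n. x \<in> B n"
    using exhaustion[OF w] by (metis bracket_nonneg divide_nonneg_nonneg zero_le_one zero_le_power)
  have mono: "B m \<subseteq> B n" if "m \<le> n" for m n using that B(2) by (rule lift_Suc_mono_le[rotated])
  have [measurable]: "g j n \<in> borel_measurable M" for n using j by measurable
  define D where "D = 32 * exp c0"
  have Eg: "(\<integral>\<^sup>+\<omega>. ennreal (norm (g j n \<omega>)) \<partial>M) \<le> ennreal D" for n
    using khinchine[of "{(j, n)}" 1 "\<lambda>_. 1"] j by (simp add: D_def)
  define f where "f n \<omega> = norm (g j n \<omega> * u n) / bracket (freq n) ^ ?N" for n \<omega>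
  have f0: "0 \<le> f n \<omega>" for n \<omega> by (simp add: f_def)
  define S where "S k \<omega> = (\<Sum>n\<in>B k. ennreal (f n \<omega>))" for k \<omega>
  have [measurable]: "S k \<in> borel_measurable M" for k unfolding S_def f_def by measurable
  have "(\<integral>\<^sup>+\<omega>. (SUP k. S k \<omega>) \<partial>M) = (SUP k. \<integral>\<^sup>+\<omega>. S k \<omega> \<partial>M)"
  proof (rule nn_integral_monotone_convergence_SUP)
    show "incseq S" unfolding S_def by (intro incseq_SucI le_funI sum_mono2 B) auto
  qed measurable
  also have "\<dots> \<le> ennreal (U * D * infsum ?w UNIV)"
  proof (rule SUP_least)
    fix k
    have "(\<integral>\<^sup>+\<omega>. S k \<omega> \<partial>M) = (\<Sum>n\<in>B k. \<integral>\<^sup>+\<omega>. ennreal (f n \<omega>) \<partial>M)"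
      unfolding S_def f_def by (intro nn_integral_sum) measurable
    also have "\<dots> \<le> (\<Sum>n\<in>B k. ennreal (U * D * ?w n))"
    proof (rule sum_mono)
      fix n
      let ?c = "norm (u n) / bracket (freq n) ^ ?N"
      have "(\<integral>\<^sup>+\<omega>. ennreal (f n \<omega>) \<partial>M) = (\<integral>\<^sup>+\<omega>. ennreal ?c * ennreal (norm (g j n \<omega>)) \<partial>M)"
        by (intro nn_integral_cong) (simp add: f_def norm_mult ennreal_mult[symmetric] mult.commute)
      also have "\<dots> = ennreal ?c * (\<integral>\<^sup>+\<omega>. ennreal (norm (g j n \<omega>)) \<partial>M)"
        by (intro nn_integral_cmult) measurable
      also have "\<dots> \<le> ennreal ?c * ennreal D" by (intro mult_left_mono Eg) auto
      also have "\<dots> = ennreal (?c * D)" by (subst ennreal_mult[symmetric]) (auto simp: D_def)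
      also have "\<dots> \<le> ennreal (U * D * ?w n)"
      proof (rule ennreal_leI)
        have "?c \<le> U * bracket (freq n) / bracket (freq n) ^ ?N"
          by (intro divide_right_mono u) auto
        also have "\<dots> = U * ?w n" by simp
        finally show "?c * D \<le> U * D * ?w n"
          using mult_right_mono[of ?c "U * ?w n" D] by (simp add: D_def mult_ac)
      qed
      finally show "(\<integral>\<^sup>+\<omega>. ennreal (f n \<omega>) \<partial>M) \<le> ennreal (U * D * ?w n)" .
    qed
    also have "\<dots> = ennreal (U * D * (\<Sum>n\<in>B k. ?w n))"
      using U by (subst sum_ennreal) (auto simp: D_def sum_distrib_left)
    also have "\<dots> \<le> ennreal (U * D * infsum ?w UNIV)"
      using U B by (intro ennreal_leI mult_left_mono finite_sum_le_infsum w) (auto simp: D_def)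
    finally show "(\<integral>\<^sup>+\<omega>. S k \<omega> \<partial>M) \<le> ennreal (U * D * infsum ?w UNIV)" .
  qed
  also have "\<dots> < \<infinity>" by simp
  finally have "AE \<omega> in M. (SUP k. S k \<omega>) \<noteq> \<infinity>"
    by (intro nn_integral_PInf_AE) auto
  then show ?thesis
  proof eventually_elim
    case (elim \<omega>)
    then obtain b where b: "(SUP k. S k \<omega>) = ennreal b" "b \<ge> 0"
      by (cases "SUP k. S k \<omega>") auto
    have "(\<lambda>n. f n \<omega>) summable_on UNIV"
    proof (rule nonneg_bounded_partial_sums_imp_summable_on)
      show "\<forall>\<^sub>F F in finite_subsets_at_top UNIV. sum (\<lambda>n. f n \<omega>) F \<le> b"
      proof (rule eventually_finite_subsets_at_top_weakI)
        fix F :: "(int, 'd) vec set" assume F: "finite F"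
        obtain m where m: "\<And>x. x \<in> B (m x)" using B(3) by metis
        have "F \<subseteq> B (Max (insert 0 (m ` F)))"
        proof
          fix x assume "x \<in> F"
          then have "m x \<le> Max (insert 0 (m ` F))" using F by (intro Max_ge) auto
          then show "x \<in> B (Max (insert 0 (m ` F)))" using m mono by blast
        qed
        then have "ennreal (sum (\<lambda>n. f n \<omega>) F) \<le> ennreal (sum (\<lambda>n. f n \<omega>) (B (Max (insert 0 (m ` F)))))"
          using B f0 by (intro ennreal_leI sum_mono2) auto
        also have "\<dots> = S (Max (insert 0 (m ` F))) \<omega>"
          unfolding S_def using f0 by (subst sum_ennreal) auto
        also have "\<dots> \<le> ennreal b" unfolding b(1)[symmetric] by (rule SUP_upper) simp
        finally show "sum (\<lambda>n. f n \<omega>) F \<le> b" using b(2) by (simp add: ennreal_le_iff)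
      qed
    qed (use f0 in auto)
    then show ?case by (simp add: f_def)
  qed
qed

text \<open>If D is 0 then so is R, and both sides take the limit value 0; this keeps the convention
  of \<open>exp_neg_quot\<close> consistent under comparison.\<close>

lemma exp_neg_quot_mono:
  assumes "0 \<le> x" "0 \<le> R" "0 < G" "R \<le> G * D" "0 \<le> D"
  shows "exp_neg_quot x R \<le> exp_neg_quot (x / G) D"
proof (cases "D = 0 \<or> R = 0")
  case True
  then show ?thesis using assms by (auto simp: exp_neg_quot_def)
next
  case False
  then have "x / (G * D) \<le> x / R"
    using assms by (intro divide_left_mono mult_pos_pos) auto
  then show ?thesis using False by (simp add: exp_neg_quot_def)
qed

section \<open>The tail estimate with explicit constants\<close>

context random_coefficients
begin

text \<open>The constants Ca and Cs enter through hypotheses so that they are fixed before T, the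
  data, lam and the interval; this gives the uniformity required in the theorem. In the disjunction
  finite r takes \<rho> = r and Cs = 1, whereas for r = infinity the exponent \<rho> is auxiliary
  and Cs is the embedding constant.\<close>

lemma wave_tail:
  fixes \<eta> :: "(real, 'd) vec \<Rightarrow> real" and u :: "nat \<Rightarrow> (int, 'd) vec \<Rightarrow> complex"
    and s q \<rho> Cs Ca T lam a b :: real and r :: ennreal and N k0 :: nat
  assumes \<eta>: "cutoff \<eta>" and s: "0 \<le> s" "s + 1 \<le> real N"
    and Ca: "1 \<le> Ca"
      "\<And>T m n B. m \<in> borel_measurable borel \<Longrightarrow> B \<ge> 0 \<Longrightarrow> (\<And>\<xi>. norm (m \<xi>) \<le> B * bracket (\<xi> - freq n) ^ N) \<Longrightarrow>
       integrable lborel (\<lambda>\<xi>. m \<xi> * window \<eta> T (\<xi> - freq n)) \<and>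
       (\<forall>x. norm (atom \<eta> T m n x) \<le> Ca * B) \<and>
       (\<integral>\<^sup>+x. ennreal ((norm (atom \<eta> T m n x))\<^sup>2) \<partial>lborel) \<le> ennreal (Ca * bracket T ^ CARD('d) * B\<^sup>2)"
    and q: "1 \<le> q" "q \<le> real k0" and \<rho>: "2 \<le> \<rho>" "\<rho> \<le> real k0"
    and r: "r = ennreal \<rho> \<and> Cs = 1 \<or> r = \<infinity> \<and> 0 < s \<and> 0 \<le> Cs \<and>
      (\<forall>h :: (real, 'd) vec \<Rightarrow> complex. integrable lborel h \<longrightarrow> integrable lborel (\<lambda>\<xi>. h \<xi> / of_real (potential_symbol s \<xi>)) \<longrightarrow>
        (\<forall>x. ennreal (norm (inv_fourier h x)) \<le>
          ennreal Cs * Lp_norm lborel (ennreal \<rho>) (\<lambda>x. ennreal (norm (inv_fourier (\<lambda>\<xi>. h \<xi> / of_real (potential_symbol s \<xi>)) x)))))"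
    and u: "u 0 \<in> Hs s" "u 1 \<in> Hs (s - 1)" and lam: "0 < lam" and ab: "0 \<le> a" "a \<le> b"
  defines "\<kappa> \<equiv> Ca * (8 * 2 powr s * max 1 b) * pair_Hs_norm s (u 0) (u 1)"
    and "E \<equiv> {\<omega> \<in> space M. mixed_norm q r {a..b}
         (\<lambda>t. wave_propagator t (cutoff_random \<eta> T g 0 (u 0) \<omega>) (cutoff_random \<eta> T g 1 (u 1) \<omega>)) > ennreal lam}"
  shows "E \<in> sets (completion M)"
    and "measure (completion M) E \<le> exp (real k0) * exp_neg_quot (lam\<^sup>2 / exp 2)
      (((b - a) powr (1 / q) * (Cs * (32 * exp c0) * \<kappa> * (bracket T ^ CARD('d)) powr (1 / \<rho>)))\<^sup>2)"
proof -
  \<comment> \<open>The reciprocal of the constant in \<open>potential_symbol_lower\<close>. It is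
    at least 1, so it also bounds the trivial factor 1 and both families of modes get the same
    constant.\<close>
  define E0 where "E0 = 4 * 2 powr s"
  have E0: "1 \<le> E0" "0 \<le> E0"
    using powr_mono[of 0 s 2] s(1) by (auto simp: E0_def)
  define C1 where "C1 = 2 * E0 * max 1 b"
  have C1: "0 \<le> C1" using E0 by (simp add: C1_def)
  define \<theta> where "\<theta> = bracket T ^ CARD('d)"
  have \<theta>: "0 \<le> \<theta>" by (simp add: \<theta>_def)
  let ?U = "pair_Hs_norm s (u 0) (u 1)"
  have U: "0 \<le> ?U" by (simp add: pair_Hs_norm_def)
  have \<kappa>: "\<kappa> = Ca * C1 * ?U" by (simp add: \<kappa>_def C1_def E0_def)
  have \<kappa>0: "0 \<le> \<kappa>" unfolding \<kappa> using Ca C1 U by simp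
  define K where "K i = Ca * C1 * (norm (u (fst i) (snd i)) * weight s i)" for i
  let ?a = "\<lambda>i. (norm (u (fst i) (snd i)) * weight s i)\<^sup>2"
  have Ksq: "(K i)\<^sup>2 = (Ca * C1)\<^sup>2 * ?a i" for i by (simp add: K_def power_mult_distrib)
  have "(\<lambda>n. (K (0, n))\<^sup>2 + (K (1, n))\<^sup>2) summable_on UNIV"
    using summable_on_cmult_right[OF pair_Hs_norm_sq(1)[OF u], of "(Ca * C1)\<^sup>2"] by (simp add: Ksq distrib_left)
  then obtain B :: "nat \<Rightarrow> (int, 'd) vec set" where B: "\<And>n. finite (B n)" "\<And>n. B n \<subseteq> B (Suc n)" "\<And>x. \<exists>n. x \<in> B n"
    "\<And>n. (\<Sum>n\<in>B (Suc n) - B n. (K (0, n))\<^sup>2 + (K (1, n))\<^sup>2) \<le> (1 / 8) ^ n"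
    by (rule exhaustion) auto
  define A where "A n = {0, 1 :: nat} \<times> B n" for n
  define Z where "Z m i t x = u (fst i) (snd i) * atom \<eta> T (m (fst i) t) (snd i) x"
    for m :: "nat \<Rightarrow> real \<Rightarrow> (real, 'd) vec \<Rightarrow> complex" and i t x
  have atomb: "integrable lborel (\<lambda>\<xi>. m j t \<xi> * window \<eta> T (\<xi> - freq n)) \<and>
       (\<forall>x. norm (atom \<eta> T (m j t) n x) \<le> Ca * (C1 * weight s (j, n))) \<and>
       (\<integral>\<^sup>+x. ennreal ((norm (atom \<eta> T (m j t) n x))\<^sup>2) \<partial>lborel) \<le> ennreal (Ca * \<theta> * (C1 * weight s (j, n))\<^sup>2)"
    if "(\<lambda>(t, \<xi>). m j t \<xi>) \<in> borel_measurable (borel \<Otimes>\<^sub>M borel)"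
      and "\<And>\<xi>. norm (m j t \<xi>) \<le> C1 * weight s (j, n) * bracket (\<xi> - freq n) ^ N"
    for m :: "nat \<Rightarrow> real \<Rightarrow> (real, 'd) vec \<Rightarrow> complex" and j t n
    unfolding \<theta>_def using measurable_Pair2[OF that(1), of t] C1 that(2)
    by (intro Ca(2)) auto
  \<comment> \<open>Stated for an arbitrary family of symbols obeying the common bound, since it is
    used once for \<open>wave_symbol\<close> and once for its quotient by
    \<open>potential_symbol\<close>.\<close>
  have RS: "random_series M g c0 (Z m) K \<theta> \<kappa> {0..b} A"
    if mm: "\<And>j. (\<lambda>(t, \<xi>). m j t \<xi>) \<in> borel_measurable (borel \<Otimes>\<^sub>M borel)"
      and mb: "\<And>j t n \<xi>. j \<in> {0, 1} \<Longrightarrow> t \<in> {0..b} \<Longrightarrow> norm (m j t \<xi>) \<le> C1 * weight s (j, n) * bracket (\<xi> - freq n) ^ N"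
    for m :: "nat \<Rightarrow> real \<Rightarrow> (real, 'd) vec \<Rightarrow> complex"
  proof (intro random_series.intro random_series_axioms.intro)
    show "random_coefficients M g c0" ..
    show "(\<lambda>(t, x). Z m i t x) \<in> borel_measurable (borel \<Otimes>\<^sub>M borel)" for i
      using atom_measurable_pair[OF \<eta> mm[of "fst i"], of T "snd i"] unfolding Z_def case_prod_beta
      by (intro borel_measurable_times borel_measurable_const)
    fix i :: "nat \<times> (int, 'd) vec" and t assume i: "i \<in> {0, 1} \<times> UNIV" and t: "t \<in> {0..b}"
    obtain j n where jn: "i = (j, n)" "j \<in> {0, 1}" using i by (cases i) auto
    note ab = atomb[of m j t n, OF mm mb[OF jn(2) t]]
    have "norm (Z m i t x) \<le> norm (u j n) * (Ca * (C1 * weight s (j, n)))" for x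
      using ab by (simp add: Z_def jn norm_mult mult_left_mono)
    then show "norm (Z m i t x) \<le> K i" for x by (simp add: K_def jn mult_ac)
    have "(\<integral>\<^sup>+x. ennreal ((norm (Z m i t x))\<^sup>2) \<partial>lborel) = (\<integral>\<^sup>+x. ennreal ((norm (u j n))\<^sup>2) * ennreal ((norm (atom \<eta> T (m j t) n x))\<^sup>2) \<partial>lborel)"
      by (simp add: Z_def jn norm_mult power_mult_distrib ennreal_mult)
    also have "\<dots> = ennreal ((norm (u j n))\<^sup>2) * (\<integral>\<^sup>+x. ennreal ((norm (atom \<eta> T (m j t) n x))\<^sup>2) \<partial>lborel)"
    proof (rule nn_integral_cmult)
      have [measurable]: "(\<lambda>(t, x). atom \<eta> T (m j t) n x) \<in> borel_measurable (borel \<Otimes>\<^sub>M borel)"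
        by (rule atom_measurable_pair[OF \<eta> mm])
      have [measurable]: "atom \<eta> T (m j t) n \<in> borel_measurable borel"
        using measurable_Pair2[of "\<lambda>(t, x). atom \<eta> T (m j t) n x" borel borel borel t] by simp
      show "(\<lambda>x. ennreal ((norm (atom \<eta> T (m j t) n x))\<^sup>2)) \<in> borel_measurable lborel" by measurable
    qed
    also have "\<dots> \<le> ennreal ((norm (u j n))\<^sup>2) * ennreal (Ca * \<theta> * (C1 * weight s (j, n))\<^sup>2)"
      using ab by (intro mult_left_mono) auto
    also have "\<dots> = ennreal ((norm (u j n))\<^sup>2 * (Ca * \<theta> * (C1 * weight s (j, n))\<^sup>2))"
      using Ca \<theta> by (simp add: ennreal_mult)
    also have "\<dots> \<le> ennreal (\<theta> * (K i)\<^sup>2)"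
    proof (rule ennreal_leI)
      \<comment> \<open>The square integral bound is linear in Ca but K i squared contains Ca
        squared; Ca being at least 1 reconciles them.\<close>
      have "Ca * 1 \<le> Ca * Ca" using Ca by (intro mult_left_mono) auto
      then have "Ca * (\<theta> * ((norm (u j n))\<^sup>2 * (C1 * weight s (j, n))\<^sup>2)) \<le> (Ca * Ca) * (\<theta> * ((norm (u j n))\<^sup>2 * (C1 * weight s (j, n))\<^sup>2))"
        using \<theta> by (intro mult_right_mono) auto
      then show "(norm (u j n))\<^sup>2 * (Ca * \<theta> * (C1 * weight s (j, n))\<^sup>2) \<le> \<theta> * (K i)\<^sup>2"
        by (simp add: K_def jn power_mult_distrib power2_eq_square[of Ca] mult_ac)
    qed
    finally show "(\<integral>\<^sup>+x. ennreal ((norm (Z m i t x))\<^sup>2) \<partial>lborel) \<le> ennreal (\<theta> * (K i)\<^sup>2)" .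
  next
    show "finite (A n)" "A n \<subseteq> {0, 1} \<times> UNIV" "A n \<subseteq> A (Suc n)" for n
      using B(1,2) by (auto simp: A_def)
    show "(\<Sum>i\<in>F. (K i)\<^sup>2) \<le> \<kappa>\<^sup>2" if "finite F" "F \<subseteq> {0, 1} \<times> UNIV" for F
      using mult_left_mono[OF pair_Hs_norm_sq(3)[OF u that], of "(Ca * C1)\<^sup>2"]
      by (simp add: Ksq sum_distrib_left \<kappa> power_mult_distrib[of "Ca * C1"])
    show "(\<Sum>i\<in>A (Suc n) - A n. (K i)\<^sup>2) \<le> (1 / 8) ^ n" for n
    proof -
      have "A (Suc n) - A n = {0, 1} \<times> (B (Suc n) - B n)" by (auto simp: A_def)
      then have "(\<Sum>i\<in>A (Suc n) - A n. (K i)\<^sup>2) = (\<Sum>n\<in>B (Suc n) - B n. (K (0, n))\<^sup>2 + (K (1, n))\<^sup>2)"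
        by (simp only: sum_pairs)
      then show ?thesis using B(4) by simp
    qed
  qed (use \<theta> \<kappa>0 in auto)
  have mb1: "norm (wave_symbol j t \<xi>) \<le> C1 * weight s (j, n) * bracket (\<xi> - freq n) ^ N"
    if "j \<in> {0, 1}" "t \<in> {0..b}" for j t n and \<xi> :: "(real, 'd) vec"
    using wave_symbol_powr_bound[OF s(1) _ _ s(2) that(1), of t b 1 E0 \<xi> 0 n] that E0 by (simp add: C1_def)
  interpret V: random_series M g c0 "Z wave_symbol" K \<theta> \<kappa> "{0..b}" A
    by (rule RS[OF wave_symbol_measurable_pair mb1])
  have mom: "(\<integral>\<^sup>+\<omega>. (Lp_norm lborel r (\<lambda>x. ennreal (norm (V.series \<omega> t x)))) ^ k \<partial>M)
      \<le> ennreal ((Cs * (32 * exp c0) * \<kappa> * \<theta> powr (1 / \<rho>) * sqrt k) ^ k)" if t: "t \<in> {a..b}" and k: "k0 \<le> k" for t k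
    using r
  proof
    assume "r = ennreal \<rho> \<and> Cs = 1"
    then show ?thesis using V.series_Lr_moment[of t \<rho> k] t k \<rho> ab by (simp add: mult_ac)
  next
    assume rr: "r = \<infinity> \<and> 0 < s \<and> 0 \<le> Cs \<and>
      (\<forall>h :: (real, 'd) vec \<Rightarrow> complex. integrable lborel h \<longrightarrow> integrable lborel (\<lambda>\<xi>. h \<xi> / of_real (potential_symbol s \<xi>)) \<longrightarrow>
        (\<forall>x. ennreal (norm (inv_fourier h x)) \<le>
          ennreal Cs * Lp_norm lborel (ennreal \<rho>) (\<lambda>x. ennreal (norm (inv_fourier (\<lambda>\<xi>. h \<xi> / of_real (potential_symbol s \<xi>)) x)))))"
    then have s0: "0 < s" and Cs: "0 \<le> Cs" by auto
    \<comment> \<open>The symbol of the potential applied to a negative power: its series, measured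
      in the exponent \<rho>, dominates the supremum of the original one. The s derivatives so lost
      are those counted in \<open>weight s\<close>.\<close>
    define m2 where "m2 j t \<xi> = wave_symbol j t \<xi> / of_real (potential_symbol s \<xi>)" for j t and \<xi> :: "(real, 'd) vec"
    have mm2: "(\<lambda>(t, \<xi>). m2 j t \<xi>) \<in> borel_measurable (borel \<Otimes>\<^sub>M borel)" for j
      using wave_symbol_measurable_pair[of j] unfolding m2_def case_prod_beta by measurable
    have mb2: "norm (m2 j t \<xi>) \<le> C1 * weight s (j, n) * bracket (\<xi> - freq n) ^ N"
      if "j \<in> {0, 1}" "t \<in> {0..b}" for j t n and \<xi> :: "(real, 'd) vec"
    proof -
      have low: "2 powr (- s) / 4 * bracket \<xi> powr (- s) \<le> potential_symbol s \<xi>"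
        by (rule potential_symbol_lower[OF s0])
      have p: "0 < 2 powr (- s) / 4 * bracket \<xi> powr (- s)" by simp
      have "1 / potential_symbol s \<xi> \<le> 1 / (2 powr (- s) / 4 * bracket \<xi> powr (- s))"
        using low p by (intro divide_left_mono mult_pos_pos order.strict_trans2[OF p low]) auto
      also have "\<dots> = E0 * bracket \<xi> powr s" by (simp add: E0_def powr_minus field_simps)
      finally have "\<bar>1 / potential_symbol s \<xi>\<bar> \<le> E0 * bracket \<xi> powr s"
        using order.strict_trans2[OF p low] by simp
      from wave_symbol_powr_bound[OF s(1) _ _ s(2) that(1) this, of t b n] that E0
      show ?thesis by (simp add: C1_def m2_def norm_divide)
    qed
    interpret V2: random_series M g c0 "Z m2" K \<theta> \<kappa> "{0..b}" A
      by (rule RS[OF mm2 mb2])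
    have t': "t \<in> {0..b}" using t ab by auto
    let ?y = "\<lambda>n \<omega>. ennreal Cs * Lp_norm lborel (ennreal \<rho>) (\<lambda>x. ennreal (norm (V2.psum (A n) \<omega> t x)))"
    \<comment> \<open>The embedding is applied to the finite sums, whose transform h and its
      quotient are integrable; the limit is taken only afterwards, in
      \<open>series_moment\<close>.\<close>
    have le: "ennreal (norm (V.psum (A n) \<omega> t x)) \<le> ?y n \<omega>" for n \<omega> x
    proof -
      define h where "h \<xi> = (\<Sum>i\<in>A n. (g (fst i) (snd i) \<omega> * u (fst i) (snd i)) * (wave_symbol (fst i) t \<xi> * window \<eta> T (\<xi> - freq (snd i))))" for \<xi>
      have h2: "h \<xi> / of_real (potential_symbol s \<xi>) = (\<Sum>i\<in>A n. (g (fst i) (snd i) \<omega> * u (fst i) (snd i)) * (m2 (fst i) t \<xi> * window \<eta> T (\<xi> - freq (snd i))))" for \<xi>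
        by (simp add: h_def m2_def sum_divide_distrib)
      have int1: "integrable lborel (\<lambda>\<xi>. wave_symbol (fst i) t \<xi> * window \<eta> T (\<xi> - freq (snd i)))" if "i \<in> A n" for i
        using that atomb[of wave_symbol "fst i" t "snd i", OF wave_symbol_measurable_pair mb1[OF _ t']] by (auto simp: A_def)
      have int2: "integrable lborel (\<lambda>\<xi>. m2 (fst i) t \<xi> * window \<eta> T (\<xi> - freq (snd i)))" if "i \<in> A n" for i
        using that atomb[of m2 "fst i" t "snd i", OF mm2 mb2[OF _ t']] by (auto simp: A_def)
      have fin: "finite (A n)" by (rule V.A_finite)
      have "V.psum (A n) \<omega> t x = inv_fourier h x" for x
        unfolding h_def
        using inv_fourier_sum[where f = "\<lambda>i \<xi>. wave_symbol (fst i) t \<xi> * window \<eta> T (\<xi> - freq (snd i))"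
            and c = "\<lambda>i. g (fst i) (snd i) \<omega> * u (fst i) (snd i)", OF fin int1]
        by (simp add: V.psum_def Z_def atom_def mult.assoc)
      moreover have "V2.psum (A n) \<omega> t x = inv_fourier (\<lambda>\<xi>. h \<xi> / of_real (potential_symbol s \<xi>)) x" for x
        unfolding h2
        using inv_fourier_sum[where f = "\<lambda>i \<xi>. m2 (fst i) t \<xi> * window \<eta> T (\<xi> - freq (snd i))"
            and c = "\<lambda>i. g (fst i) (snd i) \<omega> * u (fst i) (snd i)", OF fin int2]
        by (simp add: V2.psum_def Z_def atom_def mult.assoc)
      moreover have "integrable lborel h" unfolding h_def using fin int1 by (intro Bochner_Integration.integrable_sum integrable_mult_right)
      moreover have "integrable lborel (\<lambda>\<xi>. h \<xi> / of_real (potential_symbol s \<xi>))"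
        unfolding h2 using fin int2 by (intro Bochner_Integration.integrable_sum integrable_mult_right)
      ultimately show ?thesis using rr by simp
    qed
    show ?thesis
    proof (rule V.series_moment[OF t'])
      show k1: "1 \<le> k" using q k by simp
      have Lm: "(\<lambda>\<omega>. Lp_norm lborel (ennreal \<rho>) (\<lambda>x. ennreal (norm (V2.psum (A n) \<omega> t x)))) \<in> borel_measurable M" for n
        by (rule Lp_norm_measurable) (auto intro: lborel.sigma_finite_measure_axioms)
      then show "?y n \<in> borel_measurable M" for n by measurable
      show "(\<integral>\<^sup>+\<omega>. ?y n \<omega> ^ k \<partial>M) \<le> ennreal ((Cs * (32 * exp c0) * \<kappa> * \<theta> powr (1 / \<rho>) * sqrt k) ^ k)" for n
      proof -
        have "(\<integral>\<^sup>+\<omega>. ?y n \<omega> ^ k \<partial>M) = ennreal (Cs ^ k) * (\<integral>\<^sup>+\<omega>. Lp_norm lborel (ennreal \<rho>) (\<lambda>x. ennreal (norm (V2.psum (A n) \<omega> t x))) ^ k \<partial>M)"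
          using Lm Cs by (simp add: power_mult_distrib ennreal_power nn_integral_cmult)
        also have "\<dots> \<le> ennreal (Cs ^ k) * ennreal ((32 * exp c0 * sqrt k * \<kappa> * \<theta> powr (1 / \<rho>)) ^ k)"
          using \<rho> k by (intro mult_left_mono V2.psum_Lr_moment V2.A_finite V2.A_sub t') auto
        also have "\<dots> = ennreal ((Cs * (32 * exp c0) * \<kappa> * \<theta> powr (1 / \<rho>) * sqrt k) ^ k)"
          using Cs \<kappa>0 by (simp add: ennreal_mult[symmetric] power_mult_distrib mult_ac)
        finally show ?thesis .
      qed
      fix \<omega> assume \<omega>: "\<omega> \<in> space M" and l: "AE x in lborel. (\<lambda>n. V.psum (A n) \<omega> t x) \<longlonglongrightarrow> V.series \<omega> t x"
      have [measurable]: "V.series \<omega> t \<in> borel_measurable borel" using \<omega> by measurable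
      have "AE x in lborel. ennreal (norm (V.series \<omega> t x)) \<le> liminf (\<lambda>n. ?y n \<omega>)"
        using l
      proof eventually_elim
        case (elim x)
        then have "(\<lambda>n. ennreal (norm (V.psum (A n) \<omega> t x))) \<longlonglongrightarrow> ennreal (norm (V.series \<omega> t x))"
          by (intro tendsto_intros)
        then have "ennreal (norm (V.series \<omega> t x)) = liminf (\<lambda>n. ennreal (norm (V.psum (A n) \<omega> t x)))"
          using lim_imp_Liminf[OF sequentially_bot] by metis
        also have "\<dots> \<le> liminf (\<lambda>n. ?y n \<omega>)" using le by (intro Liminf_mono) auto
        finally show ?case .
      qed
      then show "Lp_norm lborel r (\<lambda>x. ennreal (norm (V.series \<omega> t x))) \<le> liminf (\<lambda>n. ?y n \<omega>)"
        using rr by (simp add: Lp_norm_def esssup_I)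
    qed
  qed
  \<comment> \<open>As s is nonnegative both Sobolev weights are at least 1 / bracket, so each
    coefficient grows at most linearly in the frequency.\<close>
  have ub: "norm (u j n) \<le> ?U * bracket (freq n)" if j: "j \<in> {0, 1}" for j n
  proof -
    have h: "?a (j, n) \<le> ?U\<^sup>2" using pair_Hs_norm_sq(3)[OF u, of "{(j, n)}"] j by simp
    have "norm (u j n) * weight s (j, n) \<le> ?U"
      using power2_le_imp_le[OF h U] by (simp only: fst_conv snd_conv)
    moreover have "weight s (j, n) \<ge> bracket (freq n) powr (-1)"
      unfolding weight_def fst_conv snd_conv by (rule powr_mono) (use s(1) bracket_ge_1 in auto)
    ultimately have "norm (u j n) * bracket (freq n) powr (-1) \<le> ?U"
      by (meson mult_left_mono norm_ge_zero order_trans)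
    then show ?thesis by (simp add: powr_minus field_simps)
  qed
  have sm0: "AE \<omega> in M. (\<lambda>n. norm (g 0 n \<omega> * u 0 n) / bracket (freq n) ^ (CARD('d) + 2)) summable_on UNIV"
    and sm1: "AE \<omega> in M. (\<lambda>n. norm (g 1 n \<omega> * u 1 n) / bracket (freq n) ^ (CARD('d) + 2)) summable_on UNIV"
    using ub[of 0] ub[of 1] by (intro AE_coefficients_summable[where U = ?U]; simp)+
  \<comment> \<open>The exceptional set comes only from summability of the random coefficients,
    hence is the same for all t and all \<phi>. Dependence on t and \<phi> sits in the deterministic
    pairings, which decay in n.\<close>
  have W: "AE \<omega> in M. \<forall>t\<in>{a..b}. \<forall>\<phi>. schwartz \<phi> \<longrightarrow>
      (\<lambda>n. \<Sum>i\<in>A n. g (fst i) (snd i) \<omega> * (LINT x|lborel. Z wave_symbol i t x * \<phi> x))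
      \<longlonglongrightarrow> wave_propagator t (cutoff_random \<eta> T g 0 (u 0) \<omega>) (cutoff_random \<eta> T g 1 (u 1) \<omega>) \<phi>"
    using sm0 sm1
  proof (eventually_elim, intro ballI allI impI)
    fix \<omega> t and \<phi> :: "(real, 'd) vec \<Rightarrow> complex"
    assume sm: "(\<lambda>n. norm (g 0 n \<omega> * u 0 n) / bracket (freq n) ^ (CARD('d) + 2)) summable_on UNIV"
      "(\<lambda>n. norm (g 1 n \<omega> * u 1 n) / bracket (freq n) ^ (CARD('d) + 2)) summable_on UNIV"
      and t: "t \<in> {a..b}" and \<phi>: "schwartz \<phi>"
    have t0: "0 \<le> t" using t ab by simp
    define I where "I j n = (LINT x|lborel. atom \<eta> T (wave_symbol j t) n x * \<phi> x)" for j n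
    define f where "f j n = g j n \<omega> * u j n * I j n" for j n
    have wb: "norm (wave_symbol j t \<xi>) \<le> max 1 t" for j and \<xi> :: "(real, 'd) vec"
      using cos_symbol_bound[of t \<xi>] sinc_symbol_bound[OF t0, of \<xi>] by (auto simp: wave_symbol_def)
    note pair = atom_pairing[OF \<eta> wave_symbol_measurable wb \<phi>]
    have fs: "f j summable_on UNIV" if "j \<in> {0, 1}" for j
    proof -
      obtain C where C: "C \<ge> 0" "\<And>n. norm (I j n) \<le> C / bracket (freq n) ^ (CARD('d) + 2)"
        using pair(2)[of T j "CARD('d) + 2"] unfolding I_def by blast
      have "(\<lambda>n. C * (norm (g j n \<omega> * u j n) / bracket (freq n) ^ (CARD('d) + 2))) summable_on UNIV"
        using sm that by (intro summable_on_cmult_right) auto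
      then have "(\<lambda>n. norm (f j n)) summable_on UNIV"
      proof (rule summable_on_comparison_test)
        fix n
        have "norm (f j n) \<le> norm (g j n \<omega> * u j n) * (C / bracket (freq n) ^ (CARD('d) + 2))"
          unfolding f_def norm_mult[of "g j n \<omega> * u j n"] by (intro mult_left_mono C) auto
        then show "norm (f j n) \<le> C * (norm (g j n \<omega> * u j n) / bracket (freq n) ^ (CARD('d) + 2))" by (simp add: mult_ac)
      qed auto
      then show ?thesis by (rule abs_summable_summable)
    qed
    have "(\<lambda>n. sum (f 0) (B n) + sum (f 1) (B n)) \<longlonglongrightarrow> infsum (f 0) UNIV + infsum (f 1) UNIV"
      by (intro tendsto_add sum_exhaustion_tendsto fs B(1-3)) auto
    moreover have "(\<Sum>i\<in>A n. g (fst i) (snd i) \<omega> * (LINT x|lborel. Z wave_symbol i t x * \<phi> x)) = sum (f 0) (B n) + sum (f 1) (B n)" for n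
    proof -
      have "(LINT x|lborel. Z wave_symbol (j, n) t x * \<phi> x) = u j n * I j n" for j n
        unfolding Z_def I_def by (subst integral_mult_right_zero[symmetric]) (simp add: mult.assoc)
      then show ?thesis
        unfolding A_def sum_pairs by (simp add: f_def mult.assoc sum.distrib)
    qed
    moreover have "wave_propagator t (cutoff_random \<eta> T g 0 (u 0) \<omega>) (cutoff_random \<eta> T g 1 (u 1) \<omega>) \<phi>
        = infsum (f 0) UNIV + infsum (f 1) UNIV"
    proof -
      have "fourier_multiplier (wave_symbol j t) (cutoff_random \<eta> T g j (u j) \<omega>) \<phi> = infsum (f j) UNIV" for j
        unfolding fourier_multiplier_def cutoff_random_def mult_distr_def periodic_distr_def randomize_def f_def I_def pair(1) ..
      from this[of 0] this[of 1] show ?thesis by (simp add: wave_propagator_def wave_symbol_def)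
    qed
    ultimately show "(\<lambda>n. \<Sum>i\<in>A n. g (fst i) (snd i) \<omega> * (LINT x|lborel. Z wave_symbol i t x * \<phi> x))
      \<longlonglongrightarrow> wave_propagator t (cutoff_random \<eta> T g 0 (u 0) \<omega>) (cutoff_random \<eta> T g 1 (u 1) \<omega>) \<phi>" by simp
  qed
  have R: "0 \<le> Cs * (32 * exp c0) * \<kappa> * \<theta> powr (1 / \<rho>)" using r \<kappa>0 by auto
  have "{a..b} \<subseteq> {0..b}" using ab by auto
  from V.mixed_norm_tail[OF \<eta> ab(2) this q R lam mom W]
  show "E \<in> sets (completion M)"
    and "measure (completion M) E \<le> exp (real k0) * exp_neg_quot (lam\<^sup>2 / exp 2)
      (((b - a) powr (1 / q) * (Cs * (32 * exp c0) * \<kappa> * (bracket T ^ CARD('d)) powr (1 / \<rho>)))\<^sup>2)"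
    unfolding E_def \<theta>_def by simp_all
qed

end

theorem proposition4p1:
  fixes M :: "'w measure"
    and g :: "nat \<Rightarrow> int^'d::{finite,linorder} \<Rightarrow> 'w \<Rightarrow> complex"
    and \<eta> :: "real^'d::{finite,linorder} \<Rightarrow> real"
    and c0 s q :: real and r :: ennreal
  assumes dim: "CARD('d::{finite,linorder}) \<in> {3, 4, 5}"
    and rand: "random_coefficients M g c0"
    and eta: "cutoff \<eta>"
    and q: "1 \<le> q"
    and r: "2 \<le> r"
    and s_finite: "r < \<infinity> \<Longrightarrow> s = 0"
    and s_infinite: "r = \<infinity> \<Longrightarrow> s > 0"
  shows "\<exists>C>0. \<exists>c>0. \<forall>T>0. \<forall>u0 u1 :: int^'d::{finite,linorder} \<Rightarrow> complex.
     u0 \<in> Hs s \<longrightarrow> u1 \<in> Hs (s - 1) \<longrightarrow> real_valued u0 \<longrightarrow> real_valued u1 \<longrightarrow>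
     (\<forall>lam>0. \<forall>a b. 0 \<le> a \<and> a \<le> b \<and> b \<le> T \<longrightarrow>
        (let E = {\<omega> \<in> space M.
               mixed_norm q r {a..b}
                 (\<lambda>t. wave_propagator t (cutoff_random \<eta> T g 0 u0 \<omega>) (cutoff_random \<eta> T g 1 u1 \<omega>))
               > ennreal lam}
         in E \<in> sets (completion M) \<and>
            measure (completion M) E
              \<le> C * exp_neg_quot (c * lam\<^sup>2)
                   (max 1 (b\<^sup>2) * bracket T ^ CARD('d::{finite,linorder}) * (b - a) powr (2 / q)
                     * (pair_Hs_norm s u0 u1)\<^sup>2)))"
proof -
  interpret random_coefficients M g c0 by (rule rand)
  have s: "0 \<le> s" using s_finite s_infinite by (cases "r = \<infinity>") (auto simp: less_top)
  \<comment> \<open>The number of window weights: enough to shift brackets raised to any of the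
    exponents s, s - 1 and -1.\<close>
  define N where "N = nat \<lceil>s + 1\<rceil>"
  have N: "s + 1 \<le> real N" unfolding N_def using s by linarith
  obtain Ca0 where Ca0: "Ca0 \<ge> 0"
    "\<And>T m n B. m \<in> borel_measurable borel \<Longrightarrow> B \<ge> 0 \<Longrightarrow> (\<And>\<xi>. norm (m \<xi>) \<le> B * bracket (\<xi> - freq n) ^ N) \<Longrightarrow>
       integrable lborel (\<lambda>\<xi>. m \<xi> * window \<eta> T (\<xi> - freq n)) \<and>
       (\<forall>x. norm (atom \<eta> T m n x) \<le> Ca0 * B) \<and>
       (\<integral>\<^sup>+x. ennreal ((norm (atom \<eta> T m n x))\<^sup>2) \<partial>lborel) \<le> ennreal (Ca0 * bracket T ^ CARD('d) * B\<^sup>2)"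
    using atom_bounds[OF eta, of N] by blast
  define Ca where "Ca = max 1 Ca0"
  have Ca1: "1 \<le> Ca" "Ca0 \<le> Ca" by (simp_all add: Ca_def)
  have Ca: "integrable lborel (\<lambda>\<xi>. m \<xi> * window \<eta> T (\<xi> - freq n)) \<and>
       (\<forall>x. norm (atom \<eta> T m n x) \<le> Ca * B) \<and>
       (\<integral>\<^sup>+x. ennreal ((norm (atom \<eta> T m n x))\<^sup>2) \<partial>lborel) \<le> ennreal (Ca * bracket T ^ CARD('d) * B\<^sup>2)"
    if "m \<in> borel_measurable borel" "B \<ge> 0" "\<And>\<xi>. norm (m \<xi>) \<le> B * bracket (\<xi> - freq n) ^ N" for T m n B
  proof -
    have "Ca0 * B \<le> Ca * B" "Ca0 * bracket T ^ CARD('d) * B\<^sup>2 \<le> Ca * bracket T ^ CARD('d) * B\<^sup>2"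
      using that(2) Ca1 by (auto intro!: mult_right_mono)
    then show ?thesis using Ca0(2)[OF that, of T] by (meson ennreal_leI order_trans)
  qed
  have "\<exists>\<rho> Cs. 2 \<le> \<rho> \<and> (r = ennreal \<rho> \<and> Cs = 1 \<or> r = \<infinity> \<and> 0 < s \<and> 0 \<le> Cs \<and>
      (\<forall>h :: (real, 'd) vec \<Rightarrow> complex. integrable lborel h \<longrightarrow> integrable lborel (\<lambda>\<xi>. h \<xi> / of_real (potential_symbol s \<xi>)) \<longrightarrow>
        (\<forall>x. ennreal (norm (inv_fourier h x)) \<le>
          ennreal Cs * Lp_norm lborel (ennreal \<rho>) (\<lambda>x. ennreal (norm (inv_fourier (\<lambda>\<xi>. h \<xi> / of_real (potential_symbol s \<xi>)) x))))))"
  proof (cases r)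
    case (real \<rho>)
    then have "2 \<le> \<rho>" using r by (metis ennreal_le_iff ennreal_numeral)
    then show ?thesis using real by blast
  next
    case top
    then have s0: "0 < s" using s_infinite by simp
    \<comment> \<open>Any exponent above d / s makes the embedding available; at least 2 is required
      by \<open>Lr_norm_moment\<close>.\<close>
    define \<rho> where "\<rho> = max 2 (real CARD('d) / s + 1)"
    have "real CARD('d) / s < \<rho>" by (simp add: \<rho>_def less_max_iff_disj)
    then have \<rho>: "real CARD('d) < \<rho> * s" "1 \<le> \<rho>" "2 \<le> \<rho>"
      using s0 by (simp add: pos_divide_less_eq, simp_all add: \<rho>_def)
    obtain Cs where "Cs \<ge> 0" "\<And>h :: (real, 'd) vec \<Rightarrow> complex. integrable lborel h \<Longrightarrow>
        integrable lborel (\<lambda>\<xi>. h \<xi> / of_real (potential_symbol s \<xi>)) \<Longrightarrow>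
        (\<forall>x. ennreal (norm (inv_fourier h x)) \<le>
          ennreal Cs * Lp_norm lborel (ennreal \<rho>) (\<lambda>x. ennreal (norm (inv_fourier (\<lambda>\<xi>. h \<xi> / of_real (potential_symbol s \<xi>)) x))))"
      using sup_le_potential_Lp[OF s0 \<rho>(2,1)] by blast
    moreover have "r = \<infinity>" using top by simp
    ultimately show ?thesis using s0 \<rho>(3) by blast
  qed
  then obtain \<rho> Cs where \<rho>: "2 \<le> \<rho>" and rc: "r = ennreal \<rho> \<and> Cs = 1 \<or> r = \<infinity> \<and> 0 < s \<and> 0 \<le> Cs \<and>
      (\<forall>h :: (real, 'd) vec \<Rightarrow> complex. integrable lborel h \<longrightarrow> integrable lborel (\<lambda>\<xi>. h \<xi> / of_real (potential_symbol s \<xi>)) \<longrightarrow>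
        (\<forall>x. ennreal (norm (inv_fourier h x)) \<le>
          ennreal Cs * Lp_norm lborel (ennreal \<rho>) (\<lambda>x. ennreal (norm (inv_fourier (\<lambda>\<xi>. h \<xi> / of_real (potential_symbol s \<xi>)) x)))))"
    by blast
  \<comment> \<open>Jensen's inequality in time and in space requires moments of order at least q
    and \<rho>; this threshold becomes the constant C = exp(k0).\<close>
  define k0 where "k0 = nat \<lceil>max q \<rho>\<rceil>"
  have k0: "q \<le> real k0" "\<rho> \<le> real k0" unfolding k0_def by linarith+
  define L where "L = Cs * (32 * exp c0) * Ca * (8 * 2 powr s)"
  \<comment> \<open>Adding 1 keeps G positive even if L vanishes, so that c is well defined and
    positive.\<close>
  define G where "G = L\<^sup>2 + 1"
  have G: "G > 0" by (simp add: G_def add_nonneg_pos)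
  define c where "c = 1 / (exp 2 * G)"
  have "c > 0" using G by (simp add: c_def)
  show ?thesis
  proof (rule exI[of _ "exp (real k0)"], rule conjI[OF exp_gt_zero], rule exI[of _ c], rule conjI[OF \<open>c > 0\<close>],
      intro allI impI, goal_cases)
    case (1 T u0 u1 lam a b)
    then have lam: "lam > 0" and ab: "0 \<le> a" "a \<le> b" by auto
    define u where "u j = (if j = 0 then u0 else u1)" for j :: nat
    have uu: "u 0 = u0" "u 1 = u1" by (simp_all add: u_def)
    let ?U = "pair_Hs_norm s u0 u1"
    let ?D = "max 1 (b\<^sup>2) * bracket T ^ CARD('d) * (b - a) powr (2 / q) * ?U\<^sup>2"
    let ?R = "((b - a) powr (1 / q) * (Cs * (32 * exp c0) * (Ca * (8 * 2 powr s * max 1 b) * ?U) * (bracket T ^ CARD('d)) powr (1 / \<rho>)))\<^sup>2"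
    have D: "0 \<le> ?D" by (intro mult_nonneg_nonneg) auto
    have RD: "?R \<le> G * ?D"
    proof -
      have mb: "(max 1 b)\<^sup>2 = max 1 (b\<^sup>2)"
      proof (cases "b \<le> 1")
        case True then show ?thesis using ab power_le_one[of b 2] by (simp add: max_absorb1)
      next
        case False then show ?thesis by (simp add: max_def one_le_power)
      qed
      have sq: "(x powr p)\<^sup>2 = x powr (2 * p)" for x p :: real
        by (simp add: power2_eq_square powr_add[symmetric])
      \<comment> \<open>Because \<rho> is at least 2, the power 2 / \<rho> of the volume factor is
        at most the first power that appears in the theorem.\<close>
      have "(bracket T ^ CARD('d)) powr (2 * (1 / \<rho>)) \<le> (bracket T ^ CARD('d)) powr 1"
        using \<rho> bracket_ge_1[of T] by (intro powr_mono one_le_power) auto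
      then have th: "((bracket T ^ CARD('d)) powr (1 / \<rho>))\<^sup>2 \<le> bracket T ^ CARD('d)"
        unfolding sq by simp
      have "?R = L\<^sup>2 * ((b - a) powr (2 / q) * max 1 (b\<^sup>2) * ?U\<^sup>2 * ((bracket T ^ CARD('d)) powr (1 / \<rho>))\<^sup>2)"
        unfolding L_def mb[symmetric] power_mult_distrib sq[of "b - a"] by (simp add: mult_ac)
      also have "\<dots> \<le> G * ((b - a) powr (2 / q) * max 1 (b\<^sup>2) * ?U\<^sup>2 * bracket T ^ CARD('d))"
        using th by (intro mult_mono mult_left_mono mult_nonneg_nonneg) (auto simp: G_def)
      finally show ?thesis by (simp add: mult_ac)
    qed
    have "exp_neg_quot (lam\<^sup>2 / exp 2) ?R \<le> exp_neg_quot (lam\<^sup>2 / exp 2 / G) ?D"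
      using G RD D by (intro exp_neg_quot_mono) auto
    also have "lam\<^sup>2 / exp 2 / G = c * lam\<^sup>2" by (simp add: c_def)
    finally have le: "exp (real k0) * exp_neg_quot (lam\<^sup>2 / exp 2) ?R \<le> exp (real k0) * exp_neg_quot (c * lam\<^sup>2) ?D"
      by (intro mult_left_mono) auto
    have u: "u 0 \<in> Hs s" "u 1 \<in> Hs (s - 1)" using 1 unfolding uu by simp_all
    note tail = wave_tail[OF eta s N Ca1(1) Ca q k0(1) \<rho> k0(2) rc u lam ab(1,2), of T, unfolded uu]
    show ?case
      unfolding Let_def using tail(1) order_trans[OF tail(2) le] by (rule conjI)
  qed
qed

end
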